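(* Let $(\Gamma,\mu,\pi)$ be a graph with pages $\Gamma_1,\dots,\Gamma_l$ and spine $\Gamma_0$ of fixed width $\delta>0$, and let $F$ be the function defined, for $z\in\Gamma$, $r>0$, $B=B(z,r)$, by $$F(z,r):=\begin{cases}V_i(z,r)&\text{if }B\subset\Gamma_i\text{ for some }1\le i\le l,\\ V_{\min}(z,r)&\text{otherwise,}\end{cases}\qquad V_{\min}(z,r):=\min_{i\in J_B}\ \min_{y\in[B]_\delta\cap\Gamma_i\cap[\Gamma_0]_\delta}V_i(y,r),$$ where $J_B=\{1\le i\le l:B\cap\widehat\Gamma_i\ne\emptyset\}$ and $\widehat\Gamma_i=[\Gamma_i]_\delta\cap(\Gamma_i\cup\Gamma_0)$. Assume that, for some constants $C,\alpha>0$, $\Gamma$ has a relative Faber-Krahn function given by $$\Lambda(B(z,r),\nu)=\frac{C}{r^2}\Big(\frac{F(z,r)}{\nu}\Big)^\alpha\qquad(z\in\Gamma,\ r\ge1,\ \nu>0).$$ Then there exist constants $c_1,c_2>0$ such that for all $x,y\in\Gamma$ and all integers $n>0$, $$p(n,x,y)\le\frac{c_1}{\sqrt{F(x,\sqrt n)\,F(y,\sqrt n)}}\exp\Big(-\frac{d^2(x,y)}{c_2n}\Big).$$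
   Context: **Weighted graphs.** Graphs are simple (no loops, no multiple edges) and connected unless stated otherwise. A graph $\Gamma=(V,E)$ carries vertex weights $\pi>0$ and symmetric edge weights $\mu_{xy}=\mu_{yx}\ge 0$ with $\mu_{xy}\neq0\iff\{x,y\}\in E$ (adapted) and $\sum_{y\sim x}\mu_{xy}\le\pi(x)$ (subordinate). Standing assumptions: controlled weights (there is $C_c>1$ with $\mu_{xy}/\pi(x)\ge 1/C_c$ whenever $y\sim x$) and uniform laziness (there is $C_e\in(0,1)$ with $\sum_{y\sim x}\mu_{xy}\le(1-C_e)\pi(x)$ for all $x$). The Markov kernel is $\mathcal K(x,y)=\mu_{xy}/\pi(x)$ for $x\ne y$ and $\mathcal K(x,x)=1-\sum_{z\sim x}\mu_{xz}/\pi(x)$; $\mathcal K^n$ is its $n$-th power; the heat kernel is $p(n,x,y)=\mathcal K^n(x,y)/\pi(y)$. $d=d_\Gamma$ is graph distance, $B(x,r)=\{y:d(x,y)\le r\}$, $V(x,r)=\pi(B(x,r))$, and $[A]_s=\{y\in\Gamma:d_\Gamma(y,A)\le s\}$. $V_i(y,r)$ is the $\pi_i$-volume of the ball of radius $r$ about $y$ in the page $\Gamma_i$ (a graph in its own right, with weights $\pi_i,\mu^i$). If $B\subset\Gamma_i$ for several $i$, any one may be used in the definition of $F$ (the values are comparable). **Graph with pages and spine.** Such a graph is obtained by gluing or by cutting. Gluing: let $(\Gamma_i,\pi_i,\mu^i)$, $1\le i\le l$, be infinite graphs (pages) with marked vertex sets $G_i\subset\Gamma_i$, and let $(\Gamma_0,\pi_0,\mu^0)$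 be a graph (spine), possibly disconnected, with symmetric, adapted, subordinate, controlled and uniformly lazy weights, containing (not necessarily disjoint) vertex sets $G_i'$ with bijections $G_i\leftrightarrow G_i'$. Identified vertices $x\in G_i$, $x'\in G_i'$ satisfy $c_I\pi_0(x')\le\pi_i(x)\le C_I\pi_0(x')$ with uniform constants $c_I,C_I>0$. (A vertex $x'$ with no neighbors in $\Gamma_0$ is also allowed to have $\pi_0(x')=0$; then instead $c_I\pi_j(x_j)\le\pi_i(x_i)\le C_I\pi_j(x_j)$ is required whenever $x_i\in\Gamma_i$, $x_j\in\Gamma_j$ are both identified with $x'$.) $\Gamma$ is the graph obtained by making these identifications, with $\pi=\sum_{i=0}^l\pi_i$, $\mu=\sum_{i=0}^l\mu^i$ (terms being $0$ where undefined). It is required that $\Gamma$ is connected; that $[\Gamma_0]_{\alpha_0}$ is connected in $\Gamma$ for some $\alpha_0>0$; and that, in $\Gamma$, the inner boundary $\partial_I\Gamma_i=\{x\in\Gamma_i:\exists y\in\Gamma\setminus\Gamma_i,\ y\sim x\}$ equals $G_i$ for $1\le i\le l$. Cutting: start from $(\Gamma,\pi,\mu)$ and a vertex set $\Gamma_0$ whose removal leaves finitely many connected components, all infinite; the page $\Gamma_i$ is the $i$-th component together with the set $G_i\subset\Gamma_0$ of vertices adjacent to it; pages and spine carry weights comparable to those of $\Gamma$ ($c_B\pi\le\pi_i\le C_B\pi$ on $\Gamma_i$, similarly for edge weights; $\pi_0=0$ allowed at vertices isolated in $\Gamma_0$); $[\Gamma_0]_{\alpha_0}$ is connected in $\Gamma$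 for some $\alpha_0>0$, and every vertex of $\Gamma_0$ either has all neighbors in $\Gamma_0$ or has neighbors in $\Gamma_i$ and $\Gamma_j$ for some $i\neq j$ in $\{0,\dots,l\}$. **Fixed width.** The spine has fixed width $\delta>0$ if for every $v\in\Gamma_0$ there is $i\in\{1,\dots,l\}$ with $d_\Gamma(v,\Gamma_i)\le\delta$. **Relative Faber-Krahn function.** A function $(B,\nu)\mapsto\Lambda(B,\nu)$ of balls $B=B(z,r)$ (here with $r\ge1$) and $\nu\in(0,\infty)$ is a relative Faber-Krahn function of $\Gamma$ if (1) $\nu\mapsto\Lambda(B,\nu)$ is non-increasing and (2) for every such ball $B$ and every nonempty $\Omega\subset B$, $\lambda_1(\Omega)\ge\Lambda(B,\pi(\Omega))$, where $$\lambda_1(\Omega)=\inf_{f\ne0,\ \operatorname{supp}f\subseteq\Omega}\frac{\frac12\sum_{x,y\in\Gamma}|f(x)-f(y)|^2\mu_{xy}}{\sum_{x\in\Gamma}|f(x)|^2\pi(x)}.$$ *)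

theory Defs
  imports "HOL-Analysis.Analysis"
begin

section \<open>Weighted graphs\<close>

text \<open>
  Weights are total functions on the vertex type; only their values on \<open>verts G\<close> are meaningful,
  and all definitions below are relativised accordingly.
\<close>

record 'a wgraph =
  verts :: "'a set"
  edges :: "'a set set"
  vwt :: "'a \<Rightarrow> real"
  ewt :: "'a \<Rightarrow> 'a \<Rightarrow> real"

definition simple_graph :: "'a wgraph \<Rightarrow> bool" where
  "simple_graph G \<longleftrightarrow> edges G \<subseteq> {{x, y} | x y. x \<in> verts G \<and> y \<in> verts G \<and> x \<noteq> y}"

definition nbrs :: "'a wgraph \<Rightarrow> 'a \<Rightarrow> 'a set" where
  "nbrs G x = {y. {x, y} \<in> edges G}"

definition adj :: "'a wgraph \<Rightarrow> 'a rel" where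
  "adj G = {(x, y). {x, y} \<in> edges G}"

definition connected_in :: "'a wgraph \<Rightarrow> 'a set \<Rightarrow> bool" where
  "connected_in G S \<longleftrightarrow> (\<forall>x\<in>S. \<forall>y\<in>S. (x, y) \<in> (Restr (adj G) S)\<^sup>*)"

definition connected_graph :: "'a wgraph \<Rightarrow> bool" where
  "connected_graph G \<longleftrightarrow> connected_in G (verts G)"

text \<open>The connected components of the subgraph of \<open>G\<close> induced by \<open>S\<close>.\<close>

definition components_in :: "'a wgraph \<Rightarrow> 'a set \<Rightarrow> 'a set set" where
  "components_in G S = (\<lambda>x. (Restr (adj G) S)\<^sup>* `` {x}) ` S"

definition symmetric_weights :: "'a wgraph \<Rightarrow> bool" where
  "symmetric_weights G \<longleftrightarrow>
     (\<forall>x\<in>verts G. \<forall>y\<in>verts G. ewt G x y = ewt G y x \<and> ewt G x y \<ge> 0)"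

definition adapted :: "'a wgraph \<Rightarrow> bool" where
  "adapted G \<longleftrightarrow> (\<forall>x\<in>verts G. \<forall>y\<in>verts G. ewt G x y \<noteq> 0 \<longleftrightarrow> {x, y} \<in> edges G)"

text \<open>
  Summability is part of the requirement: \<open>infsum\<close> returns \<open>0\<close> on families that are not summable.
\<close>

definition subordinate :: "'a wgraph \<Rightarrow> bool" where
  "subordinate G \<longleftrightarrow>
     (\<forall>x\<in>verts G. ewt G x summable_on nbrs G x \<and> (\<Sum>\<^sub>\<infinity>y\<in>nbrs G x. ewt G x y) \<le> vwt G x)"

definition controlled_weights :: "'a wgraph \<Rightarrow> bool" where
  "controlled_weights G \<longleftrightarrow>
     (\<exists>Cc>1. \<forall>x\<in>verts G. \<forall>y\<in>nbrs G x. ewt G x y / vwt G x \<ge> 1 / Cc)"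

definition uniformly_lazy :: "'a wgraph \<Rightarrow> bool" where
  "uniformly_lazy G \<longleftrightarrow>
     (\<exists>Ce. 0 < Ce \<and> Ce < 1 \<and>
       (\<forall>x\<in>verts G. (\<Sum>\<^sub>\<infinity>y\<in>nbrs G x. ewt G x y) \<le> (1 - Ce) * vwt G x))"

definition admissible_weights :: "'a wgraph \<Rightarrow> bool" where
  "admissible_weights G \<longleftrightarrow>
     symmetric_weights G \<and> adapted G \<and> subordinate G \<and> controlled_weights G \<and> uniformly_lazy G"

definition weighted_graph :: "'a wgraph \<Rightarrow> bool" where
  "weighted_graph G \<longleftrightarrow>
     simple_graph G \<and> connected_graph G \<and> (\<forall>x\<in>verts G. vwt G x > 0) \<and> admissible_weights G"

text \<open>A spine may be disconnected, and its vertex weight may vanish at isolated vertices.\<close>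

definition spine_graph :: "'a wgraph \<Rightarrow> bool" where
  "spine_graph G \<longleftrightarrow>
     simple_graph G \<and>
     (\<forall>x\<in>verts G. vwt G x > 0 \<or> (nbrs G x = {} \<and> vwt G x = 0)) \<and>
     admissible_weights G"


section \<open>Distance, volume, heat kernel\<close>

text \<open>Only used for vertices joined by a walk; otherwise the value is unspecified.\<close>

definition gdist :: "'a wgraph \<Rightarrow> 'a \<Rightarrow> 'a \<Rightarrow> nat" where
  "gdist G x y = (LEAST n. (x, y) \<in> adj G ^^ n)"

definition gball :: "'a wgraph \<Rightarrow> 'a \<Rightarrow> real \<Rightarrow> 'a set" where
  "gball G x r = {y \<in> verts G. real (gdist G x y) \<le> r}"

text \<open>
  \<open>nbhd G A s\<close> is $[A]_s$. Distances are natural numbers, so the distance to a nonempty set is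
  attained; the neighbourhood of the empty set is empty.
\<close>

definition nbhd :: "'a wgraph \<Rightarrow> 'a set \<Rightarrow> real \<Rightarrow> 'a set" where
  "nbhd G A s = {y \<in> verts G. \<exists>a\<in>A. real (gdist G y a) \<le> s}"

definition inner_boundary :: "'a wgraph \<Rightarrow> 'a set \<Rightarrow> 'a set" where
  "inner_boundary G A = {x \<in> A. \<exists>y \<in> verts G - A. {x, y} \<in> edges G}"

definition measure_of_set :: "'a wgraph \<Rightarrow> 'a set \<Rightarrow> real" where
  "measure_of_set G A = (\<Sum>\<^sub>\<infinity>x\<in>A. vwt G x)"

definition vol :: "'a wgraph \<Rightarrow> 'a \<Rightarrow> real \<Rightarrow> real" where
  "vol G x r = measure_of_set G (gball G x r)"

definition markov_kernel :: "'a wgraph \<Rightarrow> 'a \<Rightarrow> 'a \<Rightarrow> real" where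
  "markov_kernel G x y =
     (if x = y then 1 - (\<Sum>\<^sub>\<infinity>z\<in>nbrs G x. ewt G x z / vwt G x) else ewt G x y / vwt G x)"

fun kernel_power :: "'a wgraph \<Rightarrow> nat \<Rightarrow> 'a \<Rightarrow> 'a \<Rightarrow> real" where
  "kernel_power G 0 x y = (if x = y then 1 else 0)"
| "kernel_power G (Suc n) x y = (\<Sum>\<^sub>\<infinity>z\<in>verts G. markov_kernel G x z * kernel_power G n z y)"

definition heat_kernel :: "'a wgraph \<Rightarrow> nat \<Rightarrow> 'a \<Rightarrow> 'a \<Rightarrow> real" where
  "heat_kernel G n x y = kernel_power G n x y / vwt G y"


section \<open>Relative Faber-Krahn functions\<close>

definition dirichlet_energy :: "'a wgraph \<Rightarrow> ('a \<Rightarrow> real) \<Rightarrow> real" where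
  "dirichlet_energy G f =
     1 / 2 * (\<Sum>\<^sub>\<infinity>(x, y)\<in>verts G \<times> verts G. \<bar>f x - f y\<bar>\<^sup>2 * ewt G x y)"

definition lambda1 :: "'a wgraph \<Rightarrow> 'a set \<Rightarrow> real" where
  "lambda1 G \<Omega> =
     (INF f \<in> {f :: 'a \<Rightarrow> real. f \<noteq> (\<lambda>_. 0) \<and> {x. f x \<noteq> 0} \<subseteq> \<Omega>}.
        dirichlet_energy G f / (\<Sum>\<^sub>\<infinity>x\<in>verts G. \<bar>f x\<bar>\<^sup>2 * vwt G x))"

text \<open>A ball is given by its centre and radius, so \<open>\<Lambda>\<close> takes the arguments centre, radius, \<open>\<nu>\<close>.\<close>

definition relative_faber_krahn :: "'a wgraph \<Rightarrow> ('a \<Rightarrow> real \<Rightarrow> real \<Rightarrow> real) \<Rightarrow> bool" where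
  "relative_faber_krahn G \<Lambda> \<longleftrightarrow>
     (\<forall>z\<in>verts G. \<forall>r\<ge>1.
        (\<forall>\<nu> \<nu>'. 0 < \<nu> \<longrightarrow> \<nu> \<le> \<nu>' \<longrightarrow> \<Lambda> z r \<nu>' \<le> \<Lambda> z r \<nu>) \<and>
        (\<forall>\<Omega>. \<Omega> \<noteq> {} \<longrightarrow> \<Omega> \<subseteq> gball G z r \<longrightarrow>
            lambda1 G \<Omega> \<ge> \<Lambda> z r (measure_of_set G \<Omega>)))"


section \<open>Graphs with pages and spine\<close>

text \<open>
  In the following, \<open>P 0\<close> is the spine and \<open>P 1, \<dots>, P l\<close> are the pages, all regarded as living on
  vertices of \<open>\<Gamma>\<close>, with their own weights.

  For gluing, the graphs \<open>Q i\<close> are the unglued pages and spine. Their vertex sets are kept apart by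
  the tag \<open>i\<close>, whether or not they overlap as sets. The graph \<open>\<Gamma>\<close> is the quotient by the
  equivalence relation generated by the identifications, with quotient map \<open>\<iota>\<close>, and \<open>P i\<close> is the
  copy of \<open>Q i\<close> inside \<open>\<Gamma>\<close>. Taking the \<open>Q i\<close> over the vertex type of \<open>\<Gamma>\<close> is no restriction, as
  every \<open>Q i\<close> embeds into \<open>\<Gamma>\<close>.
\<close>

definition wgraph_iso :: "('a \<Rightarrow> 'b) \<Rightarrow> 'a wgraph \<Rightarrow> 'b wgraph \<Rightarrow> bool" where
  "wgraph_iso f G H \<longleftrightarrow>
     bij_betw f (verts G) (verts H) \<and>
     edges H = (\<lambda>e. f ` e) ` edges G \<and>
     (\<forall>x\<in>verts G. vwt H (f x) = vwt G x) \<and>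
     (\<forall>x\<in>verts G. \<forall>y\<in>verts G. ewt H (f x) (f y) = ewt G x y)"

definition glue_rel :: "nat \<Rightarrow> (nat \<Rightarrow> 'a set) \<Rightarrow> (nat \<Rightarrow> 'a \<Rightarrow> 'a) \<Rightarrow> (nat \<times> 'a) rel" where
  "glue_rel l M \<phi> = {((i, x), (0, \<phi> i x)) | i x. i \<in> {1..l} \<and> x \<in> M i}"

text \<open>\<open>M i\<close>, \<open>M' i\<close> are the marked sets $G_i$, $G_i'$, and \<open>\<phi> i\<close> is the bijection between them.\<close>

definition gluing_data ::
  "nat \<Rightarrow> (nat \<Rightarrow> 'a wgraph) \<Rightarrow> (nat \<Rightarrow> 'a set) \<Rightarrow> (nat \<Rightarrow> 'a set) \<Rightarrow> (nat \<Rightarrow> 'a \<Rightarrow> 'a) \<Rightarrow> bool" where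
  "gluing_data l Q M M' \<phi> \<longleftrightarrow>
     (\<forall>i\<in>{1..l}. weighted_graph (Q i) \<and> infinite (verts (Q i))) \<and>
     spine_graph (Q 0) \<and>
     (\<forall>i\<in>{1..l}. M i \<subseteq> verts (Q i) \<and> M' i \<subseteq> verts (Q 0) \<and> bij_betw (\<phi> i) (M i) (M' i)) \<and>
     (\<exists>cI>0. \<exists>CI>0.
        (\<forall>i\<in>{1..l}. \<forall>x\<in>M i. vwt (Q 0) (\<phi> i x) \<noteq> 0 \<longrightarrow>
            cI * vwt (Q 0) (\<phi> i x) \<le> vwt (Q i) x \<and> vwt (Q i) x \<le> CI * vwt (Q 0) (\<phi> i x)) \<and>
        (\<forall>i\<in>{1..l}. \<forall>j\<in>{1..l}. \<forall>x\<in>M i. \<forall>y\<in>M j.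
            \<phi> i x = \<phi> j y \<longrightarrow> vwt (Q 0) (\<phi> i x) = 0 \<longrightarrow>
            cI * vwt (Q j) y \<le> vwt (Q i) x \<and> vwt (Q i) x \<le> CI * vwt (Q j) y))"

definition obtained_by_gluing :: "'a wgraph \<Rightarrow> nat \<Rightarrow> (nat \<Rightarrow> 'a wgraph) \<Rightarrow> bool" where
  "obtained_by_gluing \<Gamma> l P \<longleftrightarrow>
     (\<exists>(Q :: nat \<Rightarrow> 'a wgraph) M M' \<phi> \<iota>.
        gluing_data l Q M M' \<phi> \<and>
        (\<forall>i\<in>{0..l}. wgraph_iso (\<iota> i) (Q i) (P i)) \<and>
        (\<forall>i\<in>{0..l}. \<forall>j\<in>{0..l}. \<forall>x\<in>verts (Q i). \<forall>y\<in>verts (Q j).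
            \<iota> i x = \<iota> j y \<longleftrightarrow>
            ((i, x), (j, y)) \<in> (glue_rel l M \<phi> \<union> (glue_rel l M \<phi>)\<inverse>)\<^sup>*) \<and>
        verts \<Gamma> = (\<Union>i\<in>{0..l}. verts (P i)) \<and>
        edges \<Gamma> = (\<Union>i\<in>{0..l}. edges (P i)) \<and>
        (\<forall>x\<in>verts \<Gamma>. vwt \<Gamma> x = (\<Sum>i | i \<in> {0..l} \<and> x \<in> verts (P i). vwt (P i) x)) \<and>
        (\<forall>x\<in>verts \<Gamma>. \<forall>y\<in>verts \<Gamma>.
            ewt \<Gamma> x y = (\<Sum>i | i \<in> {0..l} \<and> x \<in> verts (P i) \<and> y \<in> verts (P i). ewt (P i) x y)) \<and>
        connected_graph \<Gamma> \<and>
        (\<exists>\<alpha>\<^sub>0>0. connected_in \<Gamma> (nbhd \<Gamma> (verts (P 0)) \<alpha>\<^sub>0)) \<and>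
        (\<forall>i\<in>{1..l}. inner_boundary \<Gamma> (verts (P i)) = \<iota> i ` M i))"

text \<open>
  For cutting, \<open>K i\<close> is the \<open>i\<close>-th component left after removing the spine. Pages and spine are the
  induced subgraphs, which is what comparability of the edge weights forces.
\<close>

definition obtained_by_cutting :: "'a wgraph \<Rightarrow> nat \<Rightarrow> (nat \<Rightarrow> 'a wgraph) \<Rightarrow> bool" where
  "obtained_by_cutting \<Gamma> l P \<longleftrightarrow>
     weighted_graph \<Gamma> \<and>
     verts (P 0) \<subseteq> verts \<Gamma> \<and>
     (\<exists>K. bij_betw K {1..l} (components_in \<Gamma> (verts \<Gamma> - verts (P 0))) \<and>
        (\<forall>i\<in>{1..l}. infinite (K i) \<and>
            verts (P i) = K i \<union> {v \<in> verts (P 0). \<exists>y\<in>K i. {v, y} \<in> edges \<Gamma>})) \<and>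
     (\<forall>i\<in>{0..l}. edges (P i) = {e \<in> edges \<Gamma>. e \<subseteq> verts (P i)}) \<and>
     (\<forall>i\<in>{1..l}. weighted_graph (P i)) \<and>
     spine_graph (P 0) \<and>
     (\<exists>cB>0. \<exists>CB>0. \<forall>i\<in>{0..l}.
        (\<forall>x\<in>verts (P i).
            (cB * vwt \<Gamma> x \<le> vwt (P i) x \<and> vwt (P i) x \<le> CB * vwt \<Gamma> x) \<or>
            (i = 0 \<and> nbrs (P 0) x = {} \<and> vwt (P 0) x = 0)) \<and>
        (\<forall>x\<in>verts (P i). \<forall>y\<in>verts (P i).
            cB * ewt \<Gamma> x y \<le> ewt (P i) x y \<and> ewt (P i) x y \<le> CB * ewt \<Gamma> x y)) \<and>
     (\<exists>\<alpha>\<^sub>0>0. connected_in \<Gamma> (nbhd \<Gamma> (verts (P 0)) \<alpha>\<^sub>0)) \<and>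
     (\<forall>v\<in>verts (P 0).
        nbrs \<Gamma> v \<subseteq> verts (P 0) \<or>
        (\<exists>i\<in>{0..l}. \<exists>j\<in>{0..l}. i \<noteq> j \<and>
            nbrs \<Gamma> v \<inter> verts (P i) \<noteq> {} \<and> nbrs \<Gamma> v \<inter> verts (P j) \<noteq> {}))"

definition pages_and_spine :: "'a wgraph \<Rightarrow> nat \<Rightarrow> (nat \<Rightarrow> 'a wgraph) \<Rightarrow> bool" where
  "pages_and_spine \<Gamma> l P \<longleftrightarrow> obtained_by_gluing \<Gamma> l P \<or> obtained_by_cutting \<Gamma> l P"

definition fixed_width :: "'a wgraph \<Rightarrow> nat \<Rightarrow> (nat \<Rightarrow> 'a wgraph) \<Rightarrow> real \<Rightarrow> bool" where
  "fixed_width \<Gamma> l P \<delta> \<longleftrightarrow>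
     \<delta> > 0 \<and> (\<forall>v\<in>verts (P 0). \<exists>i\<in>{1..l}. v \<in> nbhd \<Gamma> (verts (P i)) \<delta>)"


section \<open>The function \<open>F\<close>\<close>

definition augmented_page :: "'a wgraph \<Rightarrow> (nat \<Rightarrow> 'a wgraph) \<Rightarrow> real \<Rightarrow> nat \<Rightarrow> 'a set" where
  "augmented_page \<Gamma> P \<delta> i = nbhd \<Gamma> (verts (P i)) \<delta> \<inter> (verts (P i) \<union> verts (P 0))"

definition hit_pages :: "'a wgraph \<Rightarrow> nat \<Rightarrow> (nat \<Rightarrow> 'a wgraph) \<Rightarrow> real \<Rightarrow> 'a set \<Rightarrow> nat set" where
  "hit_pages \<Gamma> l P \<delta> B = {i \<in> {1..l}. B \<inter> augmented_page \<Gamma> P \<delta> i \<noteq> {}}"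

text \<open>
  Where this is used, i.e. when no page contains the ball, all sets minimised over are finite and
  nonempty.
\<close>

definition V_min :: "'a wgraph \<Rightarrow> nat \<Rightarrow> (nat \<Rightarrow> 'a wgraph) \<Rightarrow> real \<Rightarrow> 'a \<Rightarrow> real \<Rightarrow> real" where
  "V_min \<Gamma> l P \<delta> z r =
     Min ((\<lambda>i. Min ((\<lambda>y. vol (P i) y r) `
                 (nbhd \<Gamma> (gball \<Gamma> z r) \<delta> \<inter> verts (P i) \<inter> nbhd \<Gamma> (verts (P 0)) \<delta>))) `
          hit_pages \<Gamma> l P \<delta> (gball \<Gamma> z r))"

text \<open>
  If several pages contain the ball, any of them may be used; hence a predicate, satisfied by
  every function arising from such a choice.
\<close>

definition is_page_volume_function ::
  "'a wgraph \<Rightarrow> nat \<Rightarrow> (nat \<Rightarrow> 'a wgraph) \<Rightarrow> real \<Rightarrow> ('a \<Rightarrow> real \<Rightarrow> real) \<Rightarrow> bool" where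
  "is_page_volume_function \<Gamma> l P \<delta> F \<longleftrightarrow>
     (\<forall>z\<in>verts \<Gamma>. \<forall>r>0.
        if \<exists>i\<in>{1..l}. gball \<Gamma> z r \<subseteq> verts (P i)
        then \<exists>i\<in>{1..l}. gball \<Gamma> z r \<subseteq> verts (P i) \<and> F z r = vol (P i) z r
        else F z r = V_min \<Gamma> l P \<delta> z r)"

end

theory Submission
  imports Defs
begin

text \<open>
  Fix \<open>x\<close>, put $r = \sqrt n$, let $u_k = p(k, \cdot, x)$ and
  $M_k = \sum_y u_k(y)^2 \exp((d(x,y)^2 + 1) / (D (k + 1))) \pi(y)$. By laziness, one step of the
  walk decreases $M_k$ both by a multiple of the energy of $u_k$ and by a multiple of the second
  moment of $d(x, \cdot)$ divided by $k^2$. If most of $M_k$ lives at distance much more than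
  $\sqrt k$, then the second moment alone forces polynomial decay of as high a degree as we like.
  Otherwise cut $u_k$ off at distance of order $\sqrt k \le r$; it has mass at most $1$, so the
  Nash inequality that follows from the Faber-Krahn inequality in $B(x, r)$ applies. Either way
  $M_k \le (B / F(x,r)) (n / k)^{1/\alpha}$ for $k$ up to a multiple of $n$, and $M_k$ does not
  increase afterwards. The balls $B(x, r)$ and $B(y, r)$ are the only ones used, so the values of
  $F$ at different radii never have to be compared. Chapman-Kolmogorov at time about $n/2$, the Cauchy-Schwarz
  inequality and $d(x,y)^2 \le 2 d(x,z)^2 + 2 d(z,y)^2$ give the off-diagonal bound.
\<close>

section \<open>One step of a lazy walk on a finite network\<close>

text \<open>No volume doubling is assumed, so an iteration over shrinking balls is out of reach; one
  Nash inequality at the final scale sqrt n has to do all the work. At early times it is far from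
  sharp, which is why the barrier is as large as (n / k)^(1/\<alpha>); this is harmless, because
  only times comparable to n are used in the end. The Gaussian weight follows the integrated maximum
  principle: its decrease in time pays for its gradient in space, with a remainder left over as
  profit. Discreteness causes two difficulties. The squared increment of a step competes with the
  energy, and laziness leaves a definite share of the energy. Also, far away the weight changes by
  an unbounded factor across an edge, but \<open>u_k\<close> vanishes beyond distance k, and on the
  edges that matter the exponent changes by at most 1. The pages and the spine supply a locally
  finite, uniformly lazy graph and the positivity of \<open>F\<close>. The latter takes an argument,
  since \<open>F\<close> is a minimum over sets that must first be seen to be finite and
  nonempty.\<close>

lemma sum_symmetrize:
  fixes a :: "'a \<Rightarrow> 'a \<Rightarrow> real"
  shows "(\<Sum>x\<in>W. \<Sum>y\<in>W. a x y) = (\<Sum>x\<in>W. \<Sum>y\<in>W. (a x y + a y x) / 2)"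
proof -
  have "(\<Sum>x\<in>W. \<Sum>y\<in>W. a y x) = (\<Sum>x\<in>W. \<Sum>y\<in>W. a x y)" by (rule sum.swap)
  then show ?thesis by (simp add: add_divide_distrib sum.distrib flip: sum_divide_distrib)
qed

lemma weighted_Cauchy_Schwarz:
  fixes w a b :: "'a \<Rightarrow> real"
  assumes "\<And>x. x \<in> W \<Longrightarrow> w x \<ge> 0"
  shows "(\<Sum>x\<in>W. w x * (a x * b x))\<^sup>2 \<le> (\<Sum>x\<in>W. w x * (a x)\<^sup>2) * (\<Sum>x\<in>W. w x * (b x)\<^sup>2)"
proof -
  have "(\<Sum>x\<in>W. (sqrt (w x) * a x) * (sqrt (w x) * b x))\<^sup>2
      \<le> (\<Sum>x\<in>W. (sqrt (w x) * a x)\<^sup>2) * (\<Sum>x\<in>W. (sqrt (w x) * b x)\<^sup>2)"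
    by (rule Cauchy_Schwarz_ineq_sum)
  moreover have "(\<Sum>x\<in>W. (sqrt (w x) * a x) * (sqrt (w x) * b x)) = (\<Sum>x\<in>W. w x * (a x * b x))"
  proof (rule sum.cong)
    fix x assume "x \<in> W"
    then have "sqrt (w x) * sqrt (w x) = w x" using assms by simp
    then show "(sqrt (w x) * a x) * (sqrt (w x) * b x) = w x * (a x * b x)"
      by (metis (no_types, lifting) mult.assoc mult.left_commute)
  qed simp
  moreover have "(\<Sum>x\<in>W. (sqrt (w x) * c x)\<^sup>2) = (\<Sum>x\<in>W. w x * (c x)\<^sup>2)" for c
    by (intro sum.cong) (simp_all add: power_mult_distrib assms)
  ultimately show ?thesis by simp
qed

text \<open>Young's inequality absorbs the product of the gradients of \<open>u\<close> and of the
  weight into half of the energy. The gradient of an exponential is comparable to its value at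
  either end only if \<open>s \<le> 1\<close>; the alternative with both values 0 covers edges not
  yet reached by the walk.\<close>

lemma weighted_square_difference_bound:
  fixes a b e h1 h2 s u v :: real
  assumes e: "0 < e" and h2: "h2 = exp b" and h1: "h1 = exp a"
    and s: "\<bar>a - b\<bar> \<le> s" and s1: "s \<le> 1 \<or> (u = 0 \<and> v = 0)"
  shows "- (e * ((h1 + h2) / 2) * (u - v)\<^sup>2 + (u - v) * ((u + v) / 2) * (h1 - h2))
    \<le> - (e / 2) * ((h1 + h2) / 2) * (u - v)\<^sup>2 + 9 / (4 * e) * s\<^sup>2 * (u\<^sup>2 * h1 + v\<^sup>2 * h2)"
proof (cases "u = 0 \<and> v = 0")
  case True then show ?thesis by simp
next
  case False
  then have s1: "s \<le> 1" using s1 by blast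
  have s0: "s \<ge> 0" using s by linarith
  have key: "(h1 - h2)\<^sup>2 \<le> 9 * h2\<^sup>2 * s\<^sup>2 \<and> (h1 - h2)\<^sup>2 \<le> 9 * h1\<^sup>2 * s\<^sup>2"
  proof -
    have *: "\<bar>exp x - exp y\<bar> \<le> 3 * exp y * s" if "\<bar>x - y\<bar> \<le> s" for x y :: real
    proof -
      have "\<bar>exp (x - y) - 1\<bar> \<le> 3 * s"
      proof (cases "x \<ge> y")
        case True
        have "exp (x - y) - 1 = exp (x-y) * (1 - exp (-(x - y)))"
          by (simp add: algebra_simps flip: exp_add)
        also have "\<dots> \<le> exp (x-y) * (x - y)"
          using exp_ge_add_one_self[of "-(x-y)"] by (intro mult_left_mono) (linarith, simp)
        also have "\<dots> \<le> 3 * s"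
        proof (intro mult_mono)
          have "exp (x - y) \<le> exp 1" using that s1 by simp
          then show "exp (x - y) \<le> 3" using exp_le by linarith
        qed (use True that in auto)
        finally show ?thesis using True by simp
      next
        case False
        have "1 - exp (x - y) \<le> - (x - y)" using exp_ge_add_one_self[of "x-y"] by linarith
        then show ?thesis using False that s0 by (simp add: abs_if)
      qed
      then have "exp y * \<bar>exp (x - y) - 1\<bar> \<le> exp y * (3 * s)" by (intro mult_left_mono) auto
      moreover have "exp y * \<bar>exp (x - y) - 1\<bar> = \<bar>exp x - exp y\<bar>"
      proof -
        have "exp x - exp y = exp y * (exp (x - y) - 1)" by (simp add: exp_diff right_diff_distrib)
        then show ?thesis by (simp add: abs_mult)
      qed
      ultimately show ?thesis by simp
    qed
    have "\<bar>h1 - h2\<bar> \<le> 3 * h2 * s" using *[OF s] h1 h2 by simp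
    moreover have "\<bar>h1 - h2\<bar> \<le> 3 * h1 * s" using *[of b a] s h1 h2 by (simp add: abs_minus_commute)
    ultimately have "\<bar>h1 - h2\<bar>\<^sup>2 \<le> (3 * h2 * s)\<^sup>2 \<and> \<bar>h1 - h2\<bar>\<^sup>2 \<le> (3 * h1 * s)\<^sup>2"
      by (intro conjI power_mono) auto
    then show ?thesis by (simp add: power_mult_distrib)
  qed
  \<comment> \<open>The squared increment of the weight is at most 9 m^2 s^2 and the denominator
    contains H \<ge> m, so a single factor m is left, and m lies below both \<open>h1\<close> and
    \<open>h2\<close>.\<close>
  define m where "m = min h1 h2"
  define H where "H = (h1 + h2) / 2"
  have m0: "m > 0" "m \<le> H" "m \<le> h1" "m \<le> h2" using h1 h2 by (auto simp: m_def H_def)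
  have d: "(h1 - h2)\<^sup>2 \<le> 9 * m\<^sup>2 * s\<^sup>2" using key by (auto simp: m_def min_def)
  have "- ((u - v) * ((u + v) / 2) * (h1 - h2))
    \<le> e / 2 * H * (u - v)\<^sup>2 + ((u + v) / 2)\<^sup>2 * (h1 - h2)\<^sup>2 / (2 * e * H)"
  proof -
    \<comment> \<open>A completed square, balanced so that exactly half of the energy term is
      spent.\<close>
    have "0 \<le> (e * H * (u - v) + ((u + v) / 2) * (h1 - h2))\<^sup>2 / (2 * e * H)" using e m0 by simp
    also have "\<dots> = e / 2 * H * (u - v)\<^sup>2 + (u - v) * ((u + v) / 2) * (h1 - h2) + ((u
      + v) / 2)\<^sup>2 * (h1 - h2)\<^sup>2 / (2 * e * H)"
      using e m0 by (simp add: power2_eq_square field_simps)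
    finally show ?thesis by linarith
  qed
  moreover have "((u + v) / 2)\<^sup>2 * (h1 - h2)\<^sup>2 / (2 * e * H)
    \<le> 9 / (4 * e) * s\<^sup>2 * (u\<^sup>2 * h1 + v\<^sup>2 * h2)"
  proof -
    have "((u + v) / 2)\<^sup>2 * (h1 - h2)\<^sup>2 / (2 * e * H)
      \<le> ((u + v) / 2)\<^sup>2 * (9 * m\<^sup>2 * s\<^sup>2) / (2 * e * m)"
      using e m0 d by (intro frac_le mult_left_mono mult_nonneg_nonneg) auto
    also have "\<dots> = 9 / (2 * e) * s\<^sup>2 * (((u + v) / 2)\<^sup>2 * m)" using m0 e
      by (simp add: power2_eq_square field_simps)
    also have "\<dots> \<le> 9 / (2 * e) * s\<^sup>2 * ((u\<^sup>2 * h1 + v\<^sup>2 * h2) / 2)"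
    proof (intro mult_left_mono)
      have "((u + v) / 2)\<^sup>2 \<le> (u\<^sup>2 + v\<^sup>2) / 2"
        using zero_le_power2[of "u - v"] by (simp add: power2_eq_square field_simps)
      then have "((u + v) / 2)\<^sup>2 * m \<le> (u\<^sup>2 + v\<^sup>2) / 2 * m" using m0 by (intro mult_right_mono) auto
      also have "\<dots> = (u\<^sup>2 * m + v\<^sup>2 * m) / 2" by (simp add: field_simps)
      also have "\<dots> \<le> (u\<^sup>2 * h1 + v\<^sup>2 * h2) / 2" using m0
        by (intro divide_right_mono add_mono mult_left_mono) auto
      finally show "((u + v) / 2)\<^sup>2 * m \<le> (u\<^sup>2 * h1 + v\<^sup>2 * h2) / 2" .
    qed (use e in auto)
    finally show ?thesis by (simp add: field_simps)
  qed
  ultimately show ?thesis unfolding H_def[symmetric] by (simp add: algebra_simps)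
qed

section \<open>One-step inequality for the Gaussian-weighted mass\<close>

text \<open>The model for a large ball in an infinite graph, with the edges leaving \<open>W\<close>
  dropped. Laziness is an upper bound on degrees and survives this truncation. \<open>d\<close>
  stands for the distance to the centre.\<close>

locale finite_lazy_network =
  fixes W :: "'a set" and \<mu> :: "'a \<Rightarrow> 'a \<Rightarrow> real" and \<pi> :: "'a \<Rightarrow> real" and \<epsilon> :: real
    and d :: "'a \<Rightarrow> nat"
  assumes finite_W: "finite W"
    and \<mu>_sym: "\<And>x y. x \<in> W \<Longrightarrow> y \<in> W \<Longrightarrow> \<mu> x y = \<mu> y x"
    and \<mu>_nonneg: "\<And>x y. x \<in> W \<Longrightarrow> y \<in> W \<Longrightarrow> \<mu> x y \<ge> 0"
    and \<pi>_pos: "\<And>x. x \<in> W \<Longrightarrow> \<pi> x > 0"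
    and lazy: "\<And>x. x \<in> W \<Longrightarrow> (\<Sum>y\<in>W. \<mu> x y) \<le> (1 - \<epsilon>) * \<pi> x"
    and \<epsilon>: "0 < \<epsilon>" "\<epsilon> < 1"
    and d_lip: "\<And>x y. x \<in> W \<Longrightarrow> y \<in> W \<Longrightarrow> \<mu> x y \<noteq> 0 \<Longrightarrow> d x \<le> d y + 1"
begin

text \<open>Sums run over ordered pairs, so this is twice the Dirichlet energy.\<close>

definition energy :: "('a \<Rightarrow> real) \<Rightarrow> real" where
  "energy f = (\<Sum>x\<in>W. \<Sum>y\<in>W. \<mu> x y * (f x - f y)\<^sup>2)"

text \<open>The Markov operator, written through differences so that the holding probability does
  not appear.\<close>

definition step :: "('a \<Rightarrow> real) \<Rightarrow> 'a \<Rightarrow> real" where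
  "step u x = u x - (\<Sum>y\<in>W. \<mu> x y * (u x - u y)) / \<pi> x"

lemma energy_nonneg: "energy f \<ge> 0"
  unfolding energy_def by (intro sum_nonneg mult_nonneg_nonneg) (auto simp: \<mu>_nonneg)

lemma degree_le: "x \<in> W \<Longrightarrow> (\<Sum>y\<in>W. \<mu> x y) \<le> \<pi> x"
proof -
  assume x: "x \<in> W"
  have "(1 - \<epsilon>) * \<pi> x \<le> 1 * \<pi> x" using \<epsilon> \<pi>_pos[OF x] by (intro mult_right_mono) auto
  then show ?thesis using lazy[OF x] by simp
qed

lemma weighted_degree_sum_le:
  assumes "\<And>x. x \<in> W \<Longrightarrow> a x \<ge> 0"
  shows "(\<Sum>x\<in>W. \<Sum>y\<in>W. \<mu> x y * a x) \<le> (\<Sum>x\<in>W. a x * \<pi> x)"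
    and "(\<Sum>x\<in>W. \<Sum>y\<in>W. \<mu> x y * a y) \<le> (\<Sum>x\<in>W. a x * \<pi> x)"
proof -
  have "(\<Sum>x\<in>W. \<Sum>y\<in>W. \<mu> x y * a x) = (\<Sum>x\<in>W. (\<Sum>y\<in>W. \<mu> x y) * a x)" by (simp add: sum_distrib_right)
  also have "\<dots> \<le> (\<Sum>x\<in>W. a x * \<pi> x)"
    by (intro sum_mono) (metis assms degree_le mult.commute mult_left_mono)
  finally show 1: "(\<Sum>x\<in>W. \<Sum>y\<in>W. \<mu> x y * a x) \<le> (\<Sum>x\<in>W. a x * \<pi> x)" .
  have "(\<Sum>x\<in>W. \<Sum>y\<in>W. \<mu> x y * a y) = (\<Sum>y\<in>W. \<Sum>x\<in>W. \<mu> x y * a y)" by (rule sum.swap)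
  also have "\<dots> = (\<Sum>y\<in>W. \<Sum>x\<in>W. \<mu> y x * a y)" by (intro sum.cong) (auto simp: \<mu>_sym)
  finally show "(\<Sum>x\<in>W. \<Sum>y\<in>W. \<mu> x y * a y) \<le> (\<Sum>x\<in>W. a x * \<pi> x)" using 1 by simp
qed

text \<open>By Cauchy-Schwarz and laziness the squared increment costs at most 1 - \<epsilon> times
  the local energy, while the cross term, once symmetrised, returns the whole energy: the surplus
  \<epsilon> is the gain. The remaining term pairs the increment of \<open>h\<close> with that of
  u^2.\<close>

lemma step_weighted_square:
  assumes h: "\<And>x. x \<in> W \<Longrightarrow> h x \<ge> 0"
  shows "(\<Sum>x\<in>W. (step u x)\<^sup>2 * h x * \<pi> x) \<le> (\<Sum>x\<in>W. (u x)\<^sup>2 * h x * \<pi> x) +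
    (\<Sum>x\<in>W. \<Sum>y\<in>W. \<mu> x y * - (\<epsilon> * ((h x + h y) / 2) * (u x - u y)\<^sup>2 + (u x - u y) * ((u x + u y) / 2) * (h x - h y)))"
proof -
  define b where "b x y = \<mu> x y * ((1 - \<epsilon>) * h x * (u x - u y)\<^sup>2 - 2 * u x * h x * (u x - u y))"
    for x y
  have "(step u x)\<^sup>2 * h x * \<pi> x \<le> (u x)\<^sup>2 * h x * \<pi> x + (\<Sum>y\<in>W. b x y)" if x: "x \<in> W" for x
  proof -
    define G where "G = (\<Sum>y\<in>W. \<mu> x y * (u x - u y))"
    define Q where "Q = (\<Sum>y\<in>W. \<mu> x y * (u x - u y)\<^sup>2)"
    have Q0: "Q \<ge> 0" unfolding Q_def by (intro sum_nonneg mult_nonneg_nonneg) (auto simp: \<mu>_nonneg x)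
    have "G\<^sup>2 \<le> (\<Sum>y\<in>W. \<mu> x y) * Q"
      using weighted_Cauchy_Schwarz[of W "\<mu> x" "\<lambda>_. 1" "\<lambda>y. u x - u y"] x \<mu>_nonneg
        by (simp add: G_def Q_def)
    also have "\<dots> \<le> (1 - \<epsilon>) * \<pi> x * Q" using lazy[OF x] Q0 by (rule mult_right_mono)
    finally have G: "G\<^sup>2 / \<pi> x \<le> (1 - \<epsilon>) * Q" using \<pi>_pos[OF x] by (simp add: field_simps)
    have "step u x = u x - G / \<pi> x" by (simp add: step_def G_def)
    moreover have "(u x - G / \<pi> x)\<^sup>2 * h x * \<pi> x
      = (u x)\<^sup>2 * h x * \<pi> x - 2 * u x * h x * G + h x * (G\<^sup>2 / \<pi> x)"
      using \<pi>_pos[OF x] by (simp add: power2_eq_square field_simps)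
    ultimately have "(step u x)\<^sup>2 * h x * \<pi> x
      = (u x)\<^sup>2 * h x * \<pi> x - 2 * u x * h x * G + h x * (G\<^sup>2 / \<pi> x)"
      by simp
    also have "h x * (G\<^sup>2 / \<pi> x) \<le> h x * ((1 - \<epsilon>) * Q)" using G h[OF x] by (rule mult_left_mono)
    also have "(u x)\<^sup>2 * h x * \<pi> x - 2 * u x * h x * G + h x * ((1 - \<epsilon>) * Q)
      = (u x)\<^sup>2 * h x * \<pi> x + (\<Sum>y\<in>W. b x y)"
      unfolding G_def Q_def b_def sum_distrib_left right_diff_distrib sum_subtractf
      by (simp add: mult_ac)
    finally show ?thesis by simp
  qed
  then have "(\<Sum>x\<in>W. (step u x)\<^sup>2 * h x * \<pi> x) \<le> (\<Sum>x\<in>W. (u x)\<^sup>2 * h x * \<pi> x + (\<Sum>y\<in>W. b x y))"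
    by (rule sum_mono)
  also have "\<dots> = (\<Sum>x\<in>W. (u x)\<^sup>2 * h x * \<pi> x) + (\<Sum>x\<in>W. \<Sum>y\<in>W. (b x y + b y x) / 2)"
    by (simp add: sum.distrib sum_symmetrize[of b])
  also have "(\<Sum>x\<in>W. \<Sum>y\<in>W. (b x y + b y x) / 2)
    = (\<Sum>x\<in>W. \<Sum>y\<in>W. \<mu> x y * - (\<epsilon> * ((h x + h y) / 2) * (u x - u y)\<^sup>2 + (u x - u y) * ((u x + u y) / 2) * (h x - h y)))"
  proof (intro sum.cong refl)
    fix x y assume "x \<in> W" "y \<in> W"
    then have "\<mu> y x = \<mu> x y" using \<mu>_sym by blast
    \<comment> \<open>Discrete product rule: the increment of u h is the mean of \<open>h\<close>
      times the increment of \<open>u\<close> plus the mean of \<open>u\<close> times the increment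
      of \<open>h\<close>.\<close>
    then show "(b x y + b y x) / 2 = \<mu> x y * - (\<epsilon> * ((h x + h y) / 2) * (u x - u y)\<^sup>2 + (u x
      - u y) * ((u x + u y) / 2) * (h x - h y))"
      by (simp add: b_def power2_eq_square field_simps)
  qed
  finally show ?thesis .
qed

text \<open>
  The constant \<open>45 / \<epsilon>\<close> makes the error term of \<open>mass2_step_le\<close> half of the gain in
  \<open>mass2_decrease_of_weight\<close>. The summand \<open>1\<close> is there because the weight has a nonzero gradient
  on the edges at the centre, where \<open>d = 0\<close> gives no gain.
\<close>

definition gauss :: "nat \<Rightarrow> 'a \<Rightarrow> real" where
  "gauss k x = exp (((real (d x))\<^sup>2 + 1) / (45 / \<epsilon> * real (k + 1)))"

definition mass2 :: "nat \<Rightarrow> ('a \<Rightarrow> real) \<Rightarrow> real" where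
  "mass2 k u = (\<Sum>x\<in>W. (u x)\<^sup>2 * gauss k x * \<pi> x)"

definition moment2 :: "nat \<Rightarrow> ('a \<Rightarrow> real) \<Rightarrow> real" where
  "moment2 k u = (\<Sum>x\<in>W. (u x)\<^sup>2 * gauss k x * ((real (d x))\<^sup>2 + 1) * \<pi> x)"

lemma gauss_ge_1: "gauss k x \<ge> 1"
  using \<epsilon> by (simp add: gauss_def)

lemma mass2_nonneg: "mass2 k u \<ge> 0"
  unfolding mass2_def by (intro sum_nonneg mult_nonneg_nonneg) (auto simp: gauss_def intro: less_imp_le[OF \<pi>_pos])

lemma moment2_nonneg: "moment2 k u \<ge> 0"
  unfolding moment2_def by (intro sum_nonneg mult_nonneg_nonneg) (auto simp: gauss_def intro: less_imp_le[OF \<pi>_pos])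

lemma sum_square_le_mass2: "(\<Sum>x\<in>W. (u x)\<^sup>2 * \<pi> x) \<le> mass2 k u"
  unfolding mass2_def
proof (intro sum_mono mult_right_mono)
  fix x assume "x \<in> W"
  show "(u x)\<^sup>2 \<le> (u x)\<^sup>2 * gauss k x" using gauss_ge_1[of k x]
    by (simp add: mult_left_le mult_le_cancel_left1)
  show "0 \<le> \<pi> x" using \<pi>_pos \<open>x \<in> W\<close> by (simp add: less_imp_le)
qed

text \<open>On the support, d^2 + 1 \<le> (k + 2)^2. This crude bound serves to show that, for a
  fixed weight, a step at most doubles the mass.\<close>

lemma moment2_le_mass2:
  assumes "\<And>x. x \<in> W \<Longrightarrow> d x > k \<Longrightarrow> u x = 0"
  shows "moment2 (Suc k) u \<le> (real (k + 2))\<^sup>2 * mass2 (Suc k) u"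
  unfolding moment2_def mass2_def sum_distrib_left
proof (rule sum_mono)
  fix x assume x: "x \<in> W"
  show "(u x)\<^sup>2 * gauss (Suc k) x * ((real (d x))\<^sup>2 + 1) * \<pi> x
    \<le> (real (k + 2))\<^sup>2 * ((u x)\<^sup>2 * gauss (Suc k) x * \<pi> x)"
  proof (cases "d x > k")
    case True then show ?thesis using assms x by simp
  next
    case False
    then have "(real (d x))\<^sup>2 \<le> (real k)\<^sup>2" by (intro power_mono) auto
    also have "\<dots> + 1 \<le> (real (k + 2))\<^sup>2" by (simp add: power2_eq_square algebra_simps)
    finally have "(real (d x))\<^sup>2 + 1 \<le> (real (k + 2))\<^sup>2" by simp
    moreover have "(u x)\<^sup>2 * gauss (Suc k) x * \<pi> x \<ge> 0"
      using \<pi>_pos[OF x] gauss_ge_1[of "Suc k" x] by (intro mult_nonneg_nonneg) auto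
    ultimately have "((real (d x))\<^sup>2 + 1) * ((u x)\<^sup>2 * gauss (Suc k) x * \<pi> x)
      \<le> (real (k + 2))\<^sup>2 * ((u x)\<^sup>2 * gauss (Suc k) x * \<pi> x)"
      by (rule mult_right_mono)
    then show ?thesis by (simp add: mult_ac)
  qed
qed

text \<open>A discrete time derivative of the Gaussian: with b = (d^2 + 1) / D the exponent drops by
  b / ((k + 1) (k + 2)), which is at least b / (k + 2)^2, and exp t \<ge> 1 + t converts this into
  the second moment.\<close>

lemma mass2_decrease_of_weight:
  "mass2 (Suc k) u + moment2 (Suc k) u / (45 / \<epsilon> * (real (k + 2))\<^sup>2) \<le> mass2 k u"
proof -
  have *: "gauss (Suc k) x * (1 + ((real (d x))\<^sup>2 + 1) / (45 / \<epsilon> * (real (k + 2))\<^sup>2)) \<le> gauss k x"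
    for x
  proof -
    define b where "b = ((real (d x))\<^sup>2 + 1) / (45 / \<epsilon>)"
    have b: "b \<ge> 0" using \<epsilon> by (simp add: b_def)
    have "1 + b / (real (k + 2))\<^sup>2 \<le> exp (b / (real (k + 2))\<^sup>2)" by (rule exp_ge_add_one_self)
    also have "\<dots> \<le> exp (b / real (k + 1) - b / real (k + 2))"
    proof -
      have "b / real (k + 1) - b / real (k + 2) = b / (real (k + 1) * real (k + 2))"
        by (simp add: field_simps)
      moreover have "b / (real (k + 2))\<^sup>2 \<le> b / (real (k + 1) * real (k + 2))"
        using b unfolding power2_eq_square
          by (intro divide_left_mono mult_right_mono mult_pos_pos) auto
      ultimately show ?thesis by simp
    qed
    also have "\<dots> = gauss k x / gauss (Suc k) x"
      by (simp add: gauss_def b_def exp_diff add.commute)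
    finally have "1 + b / (real (k + 2))\<^sup>2 \<le> gauss k x / gauss (Suc k) x" .
    moreover have "gauss (Suc k) x > 0" using gauss_ge_1[of "Suc k" x] by linarith
    ultimately show ?thesis by (simp add: b_def field_simps)
  qed
  have "mass2 (Suc k) u + moment2 (Suc k) u / (45 / \<epsilon> * (real (k + 2))\<^sup>2)
     = (\<Sum>x\<in>W. (u x)\<^sup>2 * (gauss (Suc k) x * (1 + ((real (d x))\<^sup>2 + 1) / (45 / \<epsilon> * (real (k + 2))\<^sup>2))) * \<pi> x)"
    unfolding mass2_def moment2_def sum_divide_distrib sum.distrib[symmetric]
    by (intro sum.cong refl) (simp add: distrib_left distrib_right mult_ac)
  also have "\<dots> \<le> mass2 k u"
    unfolding mass2_def using * \<pi>_pos by (intro sum_mono mult_right_mono mult_left_mono) (auto intro: less_imp_le)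
  finally show ?thesis .
qed

text \<open>The number 45 is 9 times 5: the 9 stems from the squared gradient of the exponential,
  the 5 from that of d^2. Each edge charges both of its ends, so the error is 2 * 45 / (4 \<epsilon>
  (D \<kappa>)^2) times the moment, and D = 45 / \<epsilon> reduces the coefficient to 1 / (2 D
  \<kappa>^2).\<close>

lemma mass2_step_le:
  assumes supp: "\<And>x. x \<in> W \<Longrightarrow> d x > k \<Longrightarrow> u x = 0"
  shows "mass2 (Suc k) (step u) \<le> mass2 (Suc k) u - \<epsilon> / 2 * energy u
    + moment2 (Suc k) u / (2 * (45 / \<epsilon>) * (real (k + 2))\<^sup>2)"
proof -
  define h where "h = gauss (Suc k)"
  define D where "D = 45 / \<epsilon>"
  define \<kappa> where "\<kappa> = real (k + 2)"
  define a where "a x = (u x)\<^sup>2 * h x * ((real (d x))\<^sup>2 + 1)" for x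
  have D: "D \<ge> 45" using \<epsilon> by (simp add: D_def field_simps)
  have \<kappa>: "\<kappa> \<ge> 2" by (simp add: \<kappa>_def)
  have h1: "h x \<ge> 1" for x by (simp add: h_def gauss_ge_1)
  have hexp: "h x = exp (((real (d x))\<^sup>2 + 1) / (D * \<kappa>))" for x
    by (simp add: h_def gauss_def D_def \<kappa>_def)
  have a0: "a x \<ge> 0" for x using h1[of x] by (simp add: a_def)
  have edge: "\<mu> x y * - (\<epsilon> * ((h x + h y) / 2) * (u x - u y)\<^sup>2 + (u x - u y) * ((u x
    + u y) / 2) * (h x - h y))
      \<le> - (\<epsilon> / 2) * (\<mu> x y * (u x - u y)\<^sup>2) + 45 / (4 * \<epsilon>) / (D * \<kappa>)\<^sup>2 * (\<mu> x y * a x + \<mu> x y * a y)"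
    if x: "x \<in> W" and y: "y \<in> W" for x y
  proof (cases "\<mu> x y = 0")
    case True then show ?thesis by simp
  next
    case False
    define p q where "p = real (d x)" and "q = real (d y)"
    have pq: "p \<le> q + 1" "q \<le> p + 1" "p \<ge> 0" "q \<ge> 0"
      using d_lip[OF x y False] d_lip[OF y x] False \<mu>_sym[OF x y] by (auto simp: p_def q_def)
    define t where "t = \<bar>p\<^sup>2 - q\<^sup>2\<bar>"
    have t: "t \<le> 2 * min p q + 1"
    proof -
      have "t = \<bar>p - q\<bar> * (p + q)"
        unfolding t_def using pq by (simp add: power2_eq_square square_diff_square_factored abs_mult)
      also have "\<dots> \<le> 1 * (p + q)" using pq by (intro mult_right_mono) auto
      also have "\<dots> \<le> 2 * min p q + 1" using pq by auto
      finally show ?thesis .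
    qed
    have t0: "t \<ge> 0" by (simp add: t_def)
    \<comment> \<open>Cauchy-Schwarz for (2, 1) and (v, 1), written as an identity. It holds at
      either end of the edge, so the error can be charged to each vertex separately.\<close>
    have tsq: "t\<^sup>2 \<le> 5 * (v\<^sup>2 + 1)" if "v = p \<or> v = q" for v
    proof -
      have "t\<^sup>2 \<le> (2 * v + 1)\<^sup>2" using t t0 that by (intro power_mono) auto
      also have "\<dots> = 5 * (v\<^sup>2 + 1) - (v - 2)\<^sup>2" by (simp add: power2_eq_square algebra_simps)
      also have "\<dots> \<le> 5 * (v\<^sup>2 + 1)" by simp
      finally show ?thesis .
    qed
    define s where "s = t / (D * \<kappa>)"
    \<comment> \<open>If \<open>u\<close> is nonzero at one end, that end is within distance k, and
      t \<le> 2 k + 1 stays below D (k + 2).\<close>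
    have s1: "s \<le> 1 \<or> (u x = 0 \<and> u y = 0)"
    proof (cases "u x = 0 \<and> u y = 0")
      case False
      then have "min p q \<le> real k" using supp[OF x] supp[OF y]
        by (force simp: p_def q_def min_def not_less)
      then have "t \<le> 2 * \<kappa>" using t by (simp add: \<kappa>_def)
      also have "\<dots> \<le> D * \<kappa>" using D \<kappa> by (intro mult_right_mono) auto
      finally show ?thesis using D \<kappa> by (simp add: s_def)
    qed auto
    have "(p\<^sup>2 + 1) / (D * \<kappa>) - (q\<^sup>2 + 1) / (D * \<kappa>) = (p\<^sup>2 - q\<^sup>2) / (D * \<kappa>)"
      by (simp add: diff_divide_distrib add_divide_distrib)
    then have sd: "\<bar>(p\<^sup>2 + 1) / (D * \<kappa>) - (q\<^sup>2 + 1) / (D * \<kappa>)\<bar> \<le> s"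
      using D \<kappa> by (simp add: s_def t_def abs_divide abs_mult)
    have "- (\<epsilon> * ((h x + h y) / 2) * (u x - u y)\<^sup>2 + (u x - u y) * ((u x + u y) / 2) * (h x - h y))
      \<le> - (\<epsilon> / 2) * ((h x + h y) / 2) * (u x - u y)\<^sup>2 + 9 / (4 * \<epsilon>) * s\<^sup>2 * ((u x)\<^sup>2 * h x + (u y)\<^sup>2 * h y)"
      by (rule weighted_square_difference_bound[OF \<epsilon>(1) hexp hexp sd[unfolded p_def q_def] s1])
    also have "\<dots> \<le> - (\<epsilon> / 2) * (u x - u y)\<^sup>2 + 9 / (4 * \<epsilon>) * (5 / (D * \<kappa>)\<^sup>2 * (a x + a y))"
    proof -
      \<comment> \<open>The Gaussian factor is discarded from the energy, since the Nash inequality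
        concerns the unweighted one; in the error term it stays, as part of the moment.\<close>
      have "1 * (u x - u y)\<^sup>2 \<le> (h x + h y) / 2 * (u x - u y)\<^sup>2"
        using h1[of x] h1[of y] by (intro mult_right_mono) auto
      then have 1: "- (\<epsilon> / 2) * ((h x + h y) / 2) * (u x - u y)\<^sup>2 \<le> - (\<epsilon> / 2) * (u x - u y)\<^sup>2"
        using \<epsilon> by (simp add: mult.assoc)
      define c where "c = 5 / (D * \<kappa>)\<^sup>2"
      have sc: "s\<^sup>2 \<le> c * (v\<^sup>2 + 1)" if "v = p \<or> v = q" for v
        using divide_right_mono[OF tsq[OF that], of "(D * \<kappa>)\<^sup>2"]
          by (simp add: s_def c_def power_divide)
      have "s\<^sup>2 * ((u x)\<^sup>2 * h x) \<le> c * (p\<^sup>2 + 1) * ((u x)\<^sup>2 * h x)"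
        using h1[of x] by (intro mult_right_mono sc) auto
      moreover have "s\<^sup>2 * ((u y)\<^sup>2 * h y) \<le> c * (q\<^sup>2 + 1) * ((u y)\<^sup>2 * h y)"
        using h1[of y] by (intro mult_right_mono sc) auto
      ultimately have "s\<^sup>2 * ((u x)\<^sup>2 * h x + (u y)\<^sup>2 * h y) \<le> c * (a x + a y)"
        unfolding a_def p_def q_def by (simp add: distrib_left mult_ac)
      then have "s\<^sup>2 * ((u x)\<^sup>2 * h x + (u y)\<^sup>2 * h y) \<le> 5 / (D * \<kappa>)\<^sup>2 * (a x + a y)"
        by (simp only: c_def)
      then have "9 / (4 * \<epsilon>) * (s\<^sup>2 * ((u x)\<^sup>2 * h x + (u y)\<^sup>2 * h y))
        \<le> 9 / (4 * \<epsilon>) * (5 / (D * \<kappa>)\<^sup>2 * (a x + a y))"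
        using \<epsilon> by (intro mult_left_mono) auto
      with 1 show ?thesis by (simp add: mult.assoc)
    qed
    finally have "\<mu> x y * - (\<epsilon> * ((h x + h y) / 2) * (u x - u y)\<^sup>2 + (u x - u y) * ((u x
      + u y) / 2) * (h x - h y))
      \<le> \<mu> x y * (- (\<epsilon> / 2) * (u x - u y)\<^sup>2 + 9 / (4 * \<epsilon>) * (5 / (D * \<kappa>)\<^sup>2 * (a x + a y)))"
      using \<mu>_nonneg[OF x y] by (rule mult_left_mono)
    also have "9 / (4 * \<epsilon>) * (5 / (D * \<kappa>)\<^sup>2 * (a x + a y)) = 45 / (4 * \<epsilon>) / (D * \<kappa>)\<^sup>2 * (a x + a y)"
      by simp
    finally show ?thesis by (simp only: distrib_left mult.left_commute)
  qed
  have "mass2 (Suc k) (step u) \<le> mass2 (Suc k) u +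
    (\<Sum>x\<in>W. \<Sum>y\<in>W. \<mu> x y * - (\<epsilon> * ((h x + h y) / 2) * (u x - u y)\<^sup>2 + (u x - u y) * ((u x + u y) / 2) * (h x - h y)))"
    unfolding mass2_def h_def[symmetric] using h1
      by (intro step_weighted_square) (auto intro: order_trans[OF zero_le_one])
  also have "\<dots> \<le> mass2 (Suc k) u + (\<Sum>x\<in>W. \<Sum>y\<in>W. - (\<epsilon> / 2) * (\<mu> x y * (u x - u y)\<^sup>2)
    + 45 / (4 * \<epsilon>) / (D * \<kappa>)\<^sup>2 * (\<mu> x y * a x + \<mu> x y * a y))"
    using edge by (intro add_left_mono sum_mono) auto
  also have "\<dots> = mass2 (Suc k) u - \<epsilon> / 2 * energy u
    + 45 / (4 * \<epsilon>) / (D * \<kappa>)\<^sup>2 * ((\<Sum>x\<in>W. \<Sum>y\<in>W. \<mu> x y * a x) + (\<Sum>x\<in>W. \<Sum>y\<in>W. \<mu> x y * a y))"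
    by (simp only: energy_def sum.distrib sum_distrib_left[symmetric])
  also have "\<dots> \<le> mass2 (Suc k) u - \<epsilon> / 2 * energy u + 45 / (4 * \<epsilon>) / (D * \<kappa>)\<^sup>2 * ((\<Sum>x\<in>W. a x * \<pi> x)
    + (\<Sum>x\<in>W. a x * \<pi> x))"
    using \<epsilon> a0 weighted_degree_sum_le[of a] by (intro add_left_mono mult_left_mono add_mono) auto
  also have "(\<Sum>x\<in>W. a x * \<pi> x) = moment2 (Suc k) u" by (simp add: a_def moment2_def h_def)
  also have "45 / (4 * \<epsilon>) / (D * \<kappa>)\<^sup>2 * (moment2 (Suc k) u + moment2 (Suc k) u)
    = moment2 (Suc k) u / (2 * D * \<kappa>\<^sup>2)"
    using D \<kappa> \<epsilon> by (simp add: D_def power2_eq_square field_simps)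
  finally show ?thesis by (simp add: D_def \<kappa>_def)
qed

section \<open>Decay of the mass below a barrier\<close>

text \<open>Chebyshev's inequality splits the mass at distance \<rho> / 2, where (\<rho> / 2)^2 = A
  (k + 2). The far part is at most the moment divided by A (k + 2); on the near part the Gaussian is
  at most H, uniformly in k. If the moment does not account for half of the mass, the function cut
  off at \<rho> has a comparable squared norm and the Nash inequality applies to it.\<close>

lemma energy_or_moment_lower_bound:
  assumes u0: "\<And>x. x \<in> W \<Longrightarrow> u x \<ge> 0" and mass: "(\<Sum>x\<in>W. u x * \<pi> x) \<le> 1"
    and nash: "\<And>f. (\<And>x. x \<in> W \<Longrightarrow> f x \<ge> 0) \<Longrightarrow> (\<And>x. x \<in> W \<Longrightarrow> real (d x) > r \<Longrightarrow> f x = 0) \<Longrightarrow>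
      (\<Sum>x\<in>W. f x * \<pi> x) \<le> 1 \<Longrightarrow> N * (\<Sum>x\<in>W. (f x)\<^sup>2 * \<pi> x) powr (1 + \<alpha>) \<le> energy f / 2"
    and N: "N \<ge> 0" and \<alpha>: "\<alpha> > 0" and A: "A > 0" and r: "r > 0" "4 * A * real (k + 2) \<le> r\<^sup>2"
    and H: "H = exp ((A + 1) / (45 / \<epsilon>))"
  shows "A * real (k + 2) / 2 * mass2 (Suc k) u \<le> moment2 (Suc k) u \<or>
    N * (mass2 (Suc k) u / (8 * H)) powr (1 + \<alpha>) - mass2 (Suc k) u / (4 * A * real (k + 2)) \<le> energy u"
proof -
  define \<rho> where "\<rho> = sqrt (4 * A * real (k + 2))"
  define \<psi> where "\<psi> x = max 0 (1 - real (d x) / \<rho>)" for x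
  define f where "f x = \<psi> x * u x" for x
  define m where "m = (\<Sum>x\<in>W. (f x)\<^sup>2 * \<pi> x)"
  define M where "M = mass2 (Suc k) u"
  have H0: "H > 0" by (simp add: H)
  have \<rho>2: "\<rho>\<^sup>2 = 4 * A * real (k + 2)" using A by (simp add: \<rho>_def)
  have \<rho>0: "\<rho> > 0" using A by (simp add: \<rho>_def)
  \<comment> \<open>Here k has to be small against r^2: the cut-off function must live in the ball
    where the Nash inequality holds.\<close>
  have \<rho>r: "\<rho> \<le> r" using r by (simp add: \<rho>_def real_le_lsqrt)
  have \<psi>01: "0 \<le> \<psi> x" "\<psi> x \<le> 1" for x using \<rho>0 by (auto simp: \<psi>_def)
  have \<psi>_lip: "(\<psi> x - \<psi> y)\<^sup>2 \<le> 1 / \<rho>\<^sup>2" if "x \<in> W" "y \<in> W" "\<mu> x y \<noteq> 0" for x y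
  proof -
    have "\<bar>real (d x) - real (d y)\<bar> \<le> 1"
      using d_lip[OF that] d_lip[of y x] that \<mu>_sym[of x y] by auto
    then have "\<bar>real (d x) / \<rho> - real (d y) / \<rho>\<bar> \<le> 1 / \<rho>"
      using \<rho>0 by (simp add: divide_right_mono flip: diff_divide_distrib)
    then have "\<bar>\<psi> x - \<psi> y\<bar> \<le> 1 / \<rho>" unfolding \<psi>_def by linarith
    then have "\<bar>\<psi> x - \<psi> y\<bar>\<^sup>2 \<le> (1 / \<rho>)\<^sup>2" by (intro power_mono) auto
    then show ?thesis by (simp add: power_divide)
  qed
  have "N * m powr (1 + \<alpha>) \<le> energy f / 2"
    unfolding m_def
  proof (rule nash)
    show "f x \<ge> 0" if "x \<in> W" for x using u0[OF that] \<psi>01 by (simp add: f_def)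
    show "f x = 0" if "x \<in> W" "real (d x) > r" for x
    proof -
      have "real (d x) / \<rho> \<ge> 1" using that \<rho>r \<rho>0 by simp
      then show ?thesis by (simp add: f_def \<psi>_def)
    qed
    have "(\<Sum>x\<in>W. f x * \<pi> x) \<le> (\<Sum>x\<in>W. u x * \<pi> x)"
      using \<pi>_pos u0 \<psi>01 by (intro sum_mono mult_right_mono) (auto simp: f_def mult_left_le_one_le less_imp_le)
    then show "(\<Sum>x\<in>W. f x * \<pi> x) \<le> 1" using mass by simp
  qed
  also have "energy f \<le> (\<Sum>x\<in>W. \<Sum>y\<in>W. 2 * (\<mu> x y * (u x - u y)\<^sup>2) + 2 / \<rho>\<^sup>2 * (\<mu> x y * (u y)\<^sup>2))"
    unfolding energy_def
  proof (intro sum_mono)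
    fix x y assume xy: "x \<in> W" "y \<in> W"
    show "\<mu> x y * (f x - f y)\<^sup>2 \<le> 2 * (\<mu> x y * (u x - u y)\<^sup>2) + 2 / \<rho>\<^sup>2 * (\<mu> x y * (u y)\<^sup>2)"
    proof (cases "\<mu> x y = 0")
      case False
      \<comment> \<open>The product rule is taken asymmetrically, with \<psi> at \<open>x\<close>
        and \<open>u\<close> at \<open>y\<close>, so that the error involves only u(y)^2 and sums to
        a multiple of the squared norm.\<close>
      have "f x - f y = \<psi> x * (u x - u y) + (\<psi> x - \<psi> y) * u y" by (simp add: f_def algebra_simps)
      then have "(f x - f y)\<^sup>2 \<le> 2 * (\<psi> x * (u x - u y))\<^sup>2 + 2 * ((\<psi> x - \<psi> y) * u y)\<^sup>2"
        using zero_le_power2[of "\<psi> x * (u x - u y) - (\<psi> x - \<psi> y) * u y"]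
          by (simp add: power2_sum power2_diff)
      also have "\<dots> \<le> 2 * (1 * (u x - u y)\<^sup>2) + 2 * (1 / \<rho>\<^sup>2 * (u y)\<^sup>2)"
        unfolding power_mult_distrib using \<psi>_lip[OF xy False] \<psi>01[of x]
        by (intro add_mono mult_left_mono mult_right_mono) (auto simp: power_le_one)
      finally have "\<mu> x y * (f x - f y)\<^sup>2
        \<le> \<mu> x y * (2 * (1 * (u x - u y)\<^sup>2) + 2 * (1 / \<rho>\<^sup>2 * (u y)\<^sup>2))"
        using \<mu>_nonneg[OF xy] by (rule mult_left_mono)
      then show ?thesis by (simp add: algebra_simps)
    qed simp
  qed
  also have "\<dots> = 2 * energy u + 2 / \<rho>\<^sup>2 * (\<Sum>x\<in>W. \<Sum>y\<in>W. \<mu> x y * (u y)\<^sup>2)"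
    by (simp only: energy_def sum.distrib sum_distrib_left[symmetric])
  also have "\<dots> \<le> 2 * energy u + 2 / \<rho>\<^sup>2 * M"
  proof -
    have "(\<Sum>x\<in>W. \<Sum>y\<in>W. \<mu> x y * (u y)\<^sup>2) \<le> M"
      unfolding M_def by (rule order_trans[OF weighted_degree_sum_le(2) sum_square_le_mass2]) simp
    then show ?thesis by (intro add_left_mono mult_left_mono) auto
  qed
  finally have E: "N * m powr (1 + \<alpha>) \<le> energy u + M / \<rho>\<^sup>2" by simp
  have "M \<le> (\<Sum>x\<in>W. 4 * H * ((f x)\<^sup>2 * \<pi> x) + ((u x)\<^sup>2 * gauss (Suc k) x * ((real (d x))\<^sup>2
    + 1) * \<pi> x) / (A * real (k + 2)))"
    unfolding M_def mass2_def
  proof (rule sum_mono)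
    fix x assume x: "x \<in> W"
    have g1: "gauss (Suc k) x \<ge> 1" by (rule gauss_ge_1)
    have p0: "\<pi> x > 0" by (rule \<pi>_pos[OF x])
    show "(u x)\<^sup>2 * gauss (Suc k) x * \<pi> x
      \<le> 4 * H * ((f x)\<^sup>2 * \<pi> x) + ((u x)\<^sup>2 * gauss (Suc k) x * ((real (d x))\<^sup>2 + 1) * \<pi> x) / (A * real (k + 2))"
    proof (cases "real (d x) \<le> \<rho> / 2")
      case True
      then have "(real (d x))\<^sup>2 \<le> (\<rho> / 2)\<^sup>2" by (intro power_mono) auto
      then have d2: "(real (d x))\<^sup>2 \<le> A * real (k + 2)" by (simp add: power_divide \<rho>2)
      have "\<psi> x \<ge> 1 / 2" using True \<rho>0 by (simp add: \<psi>_def field_simps max_def)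
      then have "(1 / 2)\<^sup>2 \<le> (\<psi> x)\<^sup>2" by (intro power_mono) auto
      then have psi: "1 \<le> 4 * (\<psi> x)\<^sup>2" by (simp add: power_divide)
      have "gauss (Suc k) x \<le> H"
      proof -
        have "((real (d x))\<^sup>2 + 1) / (45 / \<epsilon> * real (k + 2))
          \<le> ((A + 1) * real (k + 2)) / (45 / \<epsilon> * real (k + 2))"
          using d2 \<epsilon> by (intro divide_right_mono) (auto simp: algebra_simps)
        also have "\<dots> = (A + 1) / (45 / \<epsilon>)" by (rule mult_divide_mult_cancel_right) simp
        finally show ?thesis by (simp add: gauss_def H)
      qed
      then have "gauss (Suc k) x * 1 \<le> H * (4 * (\<psi> x)\<^sup>2)" using psi H0
        by (intro mult_mono) (simp_all add: less_imp_le)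
      then have "gauss (Suc k) x * ((u x)\<^sup>2 * \<pi> x) \<le> H * (4 * (\<psi> x)\<^sup>2) * ((u x)\<^sup>2 * \<pi> x)"
        using p0 by (intro mult_right_mono) auto
      moreover have "0 \<le> ((u x)\<^sup>2 * gauss (Suc k) x * ((real (d x))\<^sup>2 + 1) * \<pi> x) / (A * real (k
        + 2))"
        using p0 g1 A by (intro divide_nonneg_nonneg mult_nonneg_nonneg) auto
      ultimately show ?thesis by (simp add: f_def power_mult_distrib mult_ac)
    next
      case False
      then have "(\<rho> / 2)\<^sup>2 \<le> (real (d x))\<^sup>2" using \<rho>0 by (intro power_mono) auto
      then have d2: "A * real (k + 2) \<le> (real (d x))\<^sup>2 + 1" by (simp add: power_divide \<rho>2)
      define b where "b = (u x)\<^sup>2 * gauss (Suc k) x * \<pi> x"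
      have b: "b \<ge> 0" using p0 g1 by (simp add: b_def)
      have "b * (A * real (k + 2)) \<le> b * ((real (d x))\<^sup>2 + 1)" using d2 b by (rule mult_left_mono)
      moreover have "A * real (k + 2) > 0" using A by simp
      ultimately have "b \<le> b * ((real (d x))\<^sup>2 + 1) / (A * real (k + 2))"
        by (simp only: pos_le_divide_eq)
      moreover have "b * ((real (d x))\<^sup>2 + 1)
        = (u x)\<^sup>2 * gauss (Suc k) x * ((real (d x))\<^sup>2 + 1) * \<pi> x" by (simp add: b_def mult_ac)
      moreover have "0 \<le> 4 * H * ((f x)\<^sup>2 * \<pi> x)" using H0 p0 by simp
      ultimately have "b \<le> 4 * H * ((f x)\<^sup>2 * \<pi> x) + ((u x)\<^sup>2 * gauss (Suc k) x * ((real (d x))\<^sup>2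
        + 1) * \<pi> x) / (A * real (k + 2))"
        by (metis add.commute add_increasing2)
      then show ?thesis unfolding b_def .
    qed
  qed
  also have "\<dots> = 4 * H * m + moment2 (Suc k) u / (A * real (k + 2))"
    by (simp only: sum.distrib sum_distrib_left[symmetric] sum_divide_distrib[symmetric] m_def moment2_def)
  finally have M: "M \<le> 4 * H * m + moment2 (Suc k) u / (A * real (k + 2))" .
  have M0: "M \<ge> 0" by (simp add: M_def mass2_nonneg)
  \<comment> \<open>If the far part is less than M / 2, the near part exceeds it, so M / 2 \<le> 4 H
    m; this is the origin of 8 H.\<close>
  show ?thesis
  proof (cases "M / 2 \<le> moment2 (Suc k) u / (A * real (k + 2))")
    case True
    moreover have "A * real (k + 2) > 0" using A by simp
    ultimately have "M / 2 * (A * real (k + 2)) \<le> moment2 (Suc k) u"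
      by (simp only: pos_le_divide_eq)
    then show ?thesis by (simp add: M_def mult_ac)
  next
    case False
    then have "M / 2 \<le> 4 * H * m" using M by linarith
    then have "M / (8 * H) \<le> m" using H0 by (simp add: field_simps)
    then have "(M / (8 * H)) powr (1 + \<alpha>) \<le> m powr (1 + \<alpha>)" using M0 H0 \<alpha> by (intro powr_mono2) auto
    then have "N * (M / (8 * H)) powr (1 + \<alpha>) \<le> N * m powr (1 + \<alpha>)" using N by (rule mult_left_mono)
    then show ?thesis using E by (simp add: M_def \<rho>2)
  qed
qed

text \<open>
  \<open>T0\<close> and \<open>T1\<close> are consecutive values of the barrier of order \<open>(n / k) powr (1 / \<alpha>)\<close> below which
  \<open>mass2\<close> is to be kept; \<open>1 + q / (k + 2)\<close> bounds their quotient.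
\<close>

lemma mass2_step_decay:
  assumes supp: "\<And>x. x \<in> W \<Longrightarrow> d x > k \<Longrightarrow> u x = 0"
    and u0: "\<And>x. x \<in> W \<Longrightarrow> u x \<ge> 0" and mass: "(\<Sum>x\<in>W. u x * \<pi> x) \<le> 1"
    and nash: "\<And>f. (\<And>x. x \<in> W \<Longrightarrow> f x \<ge> 0) \<Longrightarrow> (\<And>x. x \<in> W \<Longrightarrow> real (d x) > sqrt n \<Longrightarrow> f x = 0) \<Longrightarrow>
      (\<Sum>x\<in>W. f x * \<pi> x) \<le> 1 \<Longrightarrow>
      c * \<Phi> powr \<alpha> / n * (\<Sum>x\<in>W. (f x)\<^sup>2 * \<pi> x) powr (1 + \<alpha>) \<le> energy f / 2"
    and pos: "c > 0" "\<Phi> > 0" "\<alpha> > 0" "n > 0" "q > 0" "B > 0"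
    and A: "A \<ge> 8 * (45 / \<epsilon>) * q" "A > 0"
    and H: "H = exp ((A + 1) / (45 / \<epsilon>))"
    and B: "(16 * H) powr \<alpha> * (8 * H) * (4 * q / \<epsilon> + 1 / (4 * A)) \<le> c * B powr \<alpha>"
    and n: "4 * A * real (k + 2) \<le> n"
    and T: "mass2 k u \<le> T0" "T0 \<le> (1 + q / real (k + 2)) * T1" "B / \<Phi> * (n / real (k
      + 2)) powr (1 / \<alpha>) \<le> T1"
  shows "mass2 (Suc k) (step u) \<le> T1"
proof (rule ccontr)
  define D where "D = 45 / \<epsilon>"
  define \<kappa> where "\<kappa> = real (k + 2)"
  define M0 where "M0 = mass2 k u"
  define M where "M = mass2 (Suc k) u"
  define M1 where "M1 = mass2 (Suc k) (step u)"
  define S where "S = moment2 (Suc k) u"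
  define X where "X = S / (2 * D * \<kappa>\<^sup>2)"
  \<comment> \<open>The contradiction hypothesis provides a lower bound: with \<open>M12\<close> it
    gives M > T1 / 2, which makes the superlinear Nash term linear in M with an explicit
    rate.\<close>
  assume "\<not> ?thesis"
  then have M1T: "M1 > T1" by (simp add: M1_def)
  have D: "D \<ge> 45" using \<epsilon> by (simp add: D_def field_simps)
  have \<kappa>: "\<kappa> \<ge> 2" by (simp add: \<kappa>_def)
  have T1: "T1 > 0"
  proof -
    have "0 < B / \<Phi> * (n / real (k + 2)) powr (1 / \<alpha>)" using pos by simp
    then show ?thesis using T(3) by linarith
  qed
  have M0': "M \<ge> 0" by (simp add: M_def mass2_nonneg)
  have S0: "S \<ge> 0" by (simp add: S_def moment2_nonneg)
  have X0: "X \<ge> 0" using S0 D by (simp add: X_def)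
  have a: "M1 \<le> M - \<epsilon> / 2 * energy u + X"
    using mass2_step_le[OF supp] by (simp add: M1_def M_def X_def S_def D_def \<kappa>_def)
  \<comment> \<open>The decrease of the weight gains \<open>2 * X\<close>; one \<open>X\<close> pays
    for its gradient in \<open>a\<close>, the other is profit.\<close>
  have b: "M + 2 * X \<le> M0"
    using mass2_decrease_of_weight[of k u]
      by (simp add: M0_def M_def X_def S_def D_def \<kappa>_def mult.commute)
  have "S \<le> \<kappa>\<^sup>2 * M" using moment2_le_mass2[OF supp] by (simp add: M_def S_def \<kappa>_def)
  also have "\<dots> \<le> 2 * D * \<kappa>\<^sup>2 * M"
    using D M0' by (intro mult_right_mono) (auto simp: mult_le_cancel_right1)
  finally have XM: "X \<le> M" using D \<kappa> by (simp add: X_def divide_le_eq mult.commute)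
  have E0: "\<epsilon> / 2 * energy u \<ge> 0" using energy_nonneg \<epsilon> by simp
  have M12: "M1 \<le> 2 * M" using a XM E0 by linarith
  have "A * \<kappa> / 2 * M \<le> S \<or> c * \<Phi> powr \<alpha> / n * (M / (8 * H)) powr (1 + \<alpha>) - M / (4 * A * \<kappa>)
    \<le> energy u"
    unfolding M_def \<kappa>_def S_def
    by (intro energy_or_moment_lower_bound[where r =
      "sqrt n", OF u0 mass _ _ pos(3) A(2) _ _ H] nash)
      (use pos n in auto)
  \<comment> \<open>Both alternatives have to yield a loss of 2 q / \<kappa> relative to the
    intermediate mass \<open>M\<close>; the factor 2 pays for passing to M1 \<le> 2 M.\<close>
  then have "M1 + 2 * q / \<kappa> * M \<le> M0"
  proof
    \<comment> \<open>Mass far out: the moment alone gives the rate A / (4 D \<kappa>), whence the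
      requirement A \<ge> 8 D q.\<close>
    assume "A * \<kappa> / 2 * M \<le> S"
    then have "A * \<kappa> / 2 * M / (2 * D * \<kappa>\<^sup>2) \<le> X"
      unfolding X_def using D by (intro divide_right_mono) auto
    moreover have "A * \<kappa> / 2 * M / (2 * D * \<kappa>\<^sup>2) = A / (4 * D) / \<kappa> * M"
      using D \<kappa> by (simp add: power2_eq_square field_simps)
    moreover have "2 * q / \<kappa> * M \<le> A / (4 * D) / \<kappa> * M"
      using A(1) D \<kappa> M0' unfolding D_def[symmetric]
        by (intro mult_right_mono divide_right_mono) (auto simp: field_simps)
    ultimately have "2 * q / \<kappa> * M \<le> X" by simp
    then show ?thesis using a b E0 by linarith
  next
    assume E: "c * \<Phi> powr \<alpha> / n * (M / (8 * H)) powr (1 + \<alpha>) - M / (4 * A * \<kappa>) \<le> energy u"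
    have H0: "H > 0" by (simp add: H)
    have MT: "M > T1 / 2" using M1T M12 by linarith
    have M0: "M > 0" using MT T1 by simp
    have "(4 * q / \<epsilon> + 1 / (4 * A)) * (M / \<kappa>) \<le> c * \<Phi> powr \<alpha> / n * (M / (8 * H)) powr (1 + \<alpha>)"
    proof -
      \<comment> \<open>The shape of the barrier is dictated here: T1^\<alpha> is at least (B /
        \<Phi>)^\<alpha> n / \<kappa>, so n and \<Phi> cancel against the Nash constant and a rate
        of order B^\<alpha> / \<kappa> remains.\<close>
      have t: "T1 powr \<alpha> \<ge> (B / \<Phi>) powr \<alpha> * (n / \<kappa>)"
      proof -
        have "(B / \<Phi> * (n / \<kappa>) powr (1 / \<alpha>)) powr \<alpha> \<le> T1 powr \<alpha>"
          using T(3) pos by (intro powr_mono2) (auto simp: \<kappa>_def)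
        moreover have "(B / \<Phi> * (n / \<kappa>) powr (1 / \<alpha>)) powr \<alpha> = (B / \<Phi>) powr \<alpha> * (n / \<kappa>)"
          using pos \<kappa> by (simp add: powr_mult powr_powr powr_divide)
        ultimately show ?thesis by simp
      qed
      have "(T1 / (16 * H)) powr \<alpha> \<le> (M / (8 * H)) powr \<alpha>"
        using MT T1 H0 pos by (intro powr_mono2) (auto simp: field_simps)
      then have "M / (8 * H) * (T1 / (16 * H)) powr \<alpha> \<le> M / (8 * H) * (M / (8 * H)) powr \<alpha>"
        using M0 H0 by (intro mult_left_mono) auto
      also have "\<dots> = (M / (8 * H)) powr (1 + \<alpha>)" using M0 H0 by (simp add: powr_add)
      finally have 1: "M / (8 * H) * (T1 / (16 * H)) powr \<alpha> \<le> (M / (8 * H)) powr (1 + \<alpha>)" .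
      have 2: "(T1 / (16 * H)) powr \<alpha> = T1 powr \<alpha> / (16 * H) powr \<alpha>"
        using T1 H0 by (simp add: powr_divide)
      have "c * \<Phi> powr \<alpha> / n * (M / (8 * H) * ((B / \<Phi>) powr \<alpha> * (n / \<kappa>) / (16 * H) powr \<alpha>))
          \<le> c * \<Phi> powr \<alpha> / n * (M / (8 * H) * (T1 / (16 * H)) powr \<alpha>)"
        unfolding 2 using t M0 H0 pos by (intro mult_left_mono divide_right_mono) auto
      also have "\<dots> \<le> c * \<Phi> powr \<alpha> / n * (M / (8 * H)) powr (1 + \<alpha>)"
        using 1 pos by (intro mult_left_mono) auto
      also have "c * \<Phi> powr \<alpha> / n * (M / (8 * H) * ((B / \<Phi>) powr \<alpha> * (n / \<kappa>) / (16 * H) powr \<alpha>))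
          = c * B powr \<alpha> / ((16 * H) powr \<alpha> * (8 * H)) * (M / \<kappa>)"
        using pos by (simp add: powr_divide mult_ac)
      finally have 3: "c * B powr \<alpha> / ((16 * H) powr \<alpha> * (8 * H)) * (M / \<kappa>)
        \<le> c * \<Phi> powr \<alpha> / n * (M / (8 * H)) powr (1 + \<alpha>)" .
      have "(16 * H) powr \<alpha> * (8 * H) > 0" using H0 by simp
      then have "4 * q / \<epsilon> + 1 / (4 * A) \<le> c * B powr \<alpha> / ((16 * H) powr \<alpha> * (8 * H))"
        using B by (simp only: pos_le_divide_eq mult.commute)
      then have "(4 * q / \<epsilon> + 1 / (4 * A)) * (M / \<kappa>)
        \<le> c * B powr \<alpha> / ((16 * H) powr \<alpha> * (8 * H)) * (M / \<kappa>)"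
        using M0 \<kappa> by (intro mult_right_mono) auto
      with 3 show ?thesis by linarith
    qed
    moreover have "(4 * q / \<epsilon> + 1 / (4 * A)) * (M / \<kappa>) = 4 * q / \<epsilon> * (M / \<kappa>) + M / (4 * A * \<kappa>)"
      by (simp add: distrib_right add_divide_distrib)
    ultimately have "4 * q / \<epsilon> * (M / \<kappa>) \<le> energy u" using E by linarith
    then have "\<epsilon> / 2 * (4 * q / \<epsilon> * (M / \<kappa>)) \<le> \<epsilon> / 2 * energy u" using \<epsilon>
      by (intro mult_left_mono) auto
    moreover have "\<epsilon> / 2 * (4 * q / \<epsilon> * (M / \<kappa>)) = 2 * q / \<kappa> * M" using \<epsilon> by simp
    ultimately show ?thesis using a b X0 by linarith
  qed
  moreover have "q / \<kappa> * M1 \<le> q / \<kappa> * (2 * M)" using M12 pos \<kappa> by (intro mult_left_mono) auto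
  ultimately have "M1 + q / \<kappa> * M1 \<le> M0" by (simp add: mult_ac)
  then have "(1 + q / \<kappa>) * M1 \<le> M0" by (simp only: distrib_right mult_1)
  also have "\<dots> \<le> (1 + q / \<kappa>) * T1" using T by (simp add: M0_def \<kappa>_def)
  finally have "M1 \<le> T1" using pos \<kappa> by (simp add: mult_le_cancel_left_pos add_pos_pos)
  then show False using M1T by simp
qed

text \<open>The spectrum of the normalised Laplacian lies in [0, 2]; this a priori bound starts the
  induction.\<close>

lemma energy_le_sum_squares: "energy u / 2 \<le> 2 * (\<Sum>x\<in>W. (u x)\<^sup>2 * \<pi> x)"
proof -
  have "energy u \<le> (\<Sum>x\<in>W. \<Sum>y\<in>W. 2 * (\<mu> x y * (u x)\<^sup>2) + 2 * (\<mu> x y * (u y)\<^sup>2))"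
    unfolding energy_def
  proof (intro sum_mono)
    fix x y assume xy: "x \<in> W" "y \<in> W"
    have "(u x - u y)\<^sup>2 \<le> 2 * (u x)\<^sup>2 + 2 * (u y)\<^sup>2"
      using zero_le_power2[of "u x + u y"] by (simp add: power2_sum power2_diff)
    then have "\<mu> x y * (u x - u y)\<^sup>2 \<le> \<mu> x y * (2 * (u x)\<^sup>2 + 2 * (u y)\<^sup>2)"
      using \<mu>_nonneg[OF xy] by (rule mult_left_mono)
    then show "\<mu> x y * (u x - u y)\<^sup>2 \<le> 2 * (\<mu> x y * (u x)\<^sup>2) + 2 * (\<mu> x y * (u y)\<^sup>2)"
      by (simp add: distrib_left)
  qed
  also have "\<dots> = 2 * (\<Sum>x\<in>W. \<Sum>y\<in>W. \<mu> x y * (u x)\<^sup>2) + 2 * (\<Sum>x\<in>W. \<Sum>y\<in>W. \<mu> x y * (u y)\<^sup>2)"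
    by (simp only: sum.distrib sum_distrib_left[symmetric])
  also have "\<dots> \<le> 2 * (\<Sum>x\<in>W. (u x)\<^sup>2 * \<pi> x) + 2 * (\<Sum>x\<in>W. (u x)\<^sup>2 * \<pi> x)"
    by (intro add_mono mult_left_mono weighted_degree_sum_le) auto
  finally show ?thesis by simp
qed

text \<open>Nash against the trivial upper bound for the energy limits the squared norm of a
  function concentrated at the centre. For a normalised point mass this says that the weight of the
  centre is at least a multiple of \<Phi> / n^(1/\<alpha>).\<close>

lemma mass2_initial:
  assumes supp: "\<And>x. x \<in> W \<Longrightarrow> d x > 0 \<Longrightarrow> u x = 0"
    and nash: "c * \<Phi> powr \<alpha> / n * (\<Sum>x\<in>W. (u x)\<^sup>2 * \<pi> x) powr (1 + \<alpha>) \<le> energy u / 2"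
    and pos: "c > 0" "\<Phi> > 0" "\<alpha> > 0" "n > 0"
  shows "mass2 0 u \<le> 3 * (2 / c) powr (1 / \<alpha>) / \<Phi> * n powr (1 / \<alpha>)"
proof -
  define m where "m = (\<Sum>x\<in>W. (u x)\<^sup>2 * \<pi> x)"
  have m0: "m \<ge> 0" unfolding m_def by (intro sum_nonneg mult_nonneg_nonneg) (auto intro: less_imp_le[OF \<pi>_pos])
  have "mass2 0 u \<le> 3 * m"
    unfolding mass2_def m_def sum_distrib_left
  proof (rule sum_mono)
    fix x assume x: "x \<in> W"
    show "(u x)\<^sup>2 * gauss 0 x * \<pi> x \<le> 3 * ((u x)\<^sup>2 * \<pi> x)"
    proof (cases "d x > 0")
      case True then show ?thesis using supp[OF x] by simp
    next
      case False
      then have "gauss 0 x = exp (\<epsilon> / 45)" by (simp add: gauss_def)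
      also have "\<dots> \<le> exp 1" using \<epsilon> by simp
      also have "\<dots> \<le> 3" by (rule exp_le)
      finally have "gauss 0 x * ((u x)\<^sup>2 * \<pi> x) \<le> 3 * ((u x)\<^sup>2 * \<pi> x)"
        using \<pi>_pos[OF x] by (intro mult_right_mono) auto
      then show ?thesis by (simp add: mult_ac)
    qed
  qed
  also have "m \<le> (2 / c) powr (1 / \<alpha>) / \<Phi> * n powr (1 / \<alpha>)"
  proof (cases "m = 0")
    case True then show ?thesis using pos by simp
  next
    case False
    then have m: "m > 0" using m0 by simp
    have "c * \<Phi> powr \<alpha> / n * m powr (1 + \<alpha>) \<le> 2 * m"
      unfolding m_def by (rule order_trans[OF nash energy_le_sum_squares])
    then have "m * (c * \<Phi> powr \<alpha> / n * m powr \<alpha>) \<le> m * 2" using m by (simp add: powr_add mult_ac)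
    then have "c * \<Phi> powr \<alpha> / n * m powr \<alpha> \<le> 2" using m by (simp only: mult_le_cancel_left_pos)
    then have "m powr \<alpha> \<le> 2 / c * n / \<Phi> powr \<alpha>" using pos by (simp add: field_simps)
    then have "(m powr \<alpha>) powr (1 / \<alpha>) \<le> (2 / c * n / \<Phi> powr \<alpha>) powr (1 / \<alpha>)" using pos
      by (intro powr_mono2) auto
    moreover have "(m powr \<alpha>) powr (1 / \<alpha>) = m" using pos m by (simp add: powr_powr)
    moreover have "(2 / c * n / \<Phi> powr \<alpha>) powr (1 / \<alpha>) = (2 / c) powr (1 / \<alpha>) / \<Phi> * n powr (1 / \<alpha>)"
      using pos by (simp add: powr_divide powr_mult powr_powr)
    ultimately show ?thesis by simp
  qed
  finally show ?thesis by simp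
qed

text \<open>Induction on k below a barrier. While 4 A (k + 2) \<le> n, the cut-off fits into the
  ball of radius sqrt n and \<open>mass2_step_decay\<close> applies; later the barrier rests at its
  floor and monotonicity of the mass suffices.\<close>

lemma mass2_bound:
  assumes step: "\<And>k x. k < n \<Longrightarrow> x \<in> W \<Longrightarrow> u (Suc k) x = step (u k) x"
    and supp: "\<And>k x. k \<le> n \<Longrightarrow> x \<in> W \<Longrightarrow> d x > k \<Longrightarrow> u k x = 0"
    and u0: "\<And>k x. k \<le> n \<Longrightarrow> x \<in> W \<Longrightarrow> u k x \<ge> 0"
    and mass: "\<And>k. k \<le> n \<Longrightarrow> (\<Sum>x\<in>W. u k x * \<pi> x) \<le> 1"
    and nash: "\<And>f. (\<And>x. x \<in> W \<Longrightarrow> f x \<ge> 0) \<Longrightarrow> (\<And>x. x \<in> W \<Longrightarrow> real (d x) > sqrt (real n) \<Longrightarrow> f x = 0) \<Longrightarrow>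
      (\<Sum>x\<in>W. f x * \<pi> x) \<le> 1 \<Longrightarrow>
      c * \<Phi> powr \<alpha> / real n * (\<Sum>x\<in>W. (f x)\<^sup>2 * \<pi> x) powr (1 + \<alpha>) \<le> energy f / 2"
    and pos: "c > 0" "\<Phi> > 0" "\<alpha> > 0" "n > 0" "B > 0"
    and q: "q = 2 / \<alpha> * exp (1 / \<alpha>)"
    and A: "A \<ge> 8 * (45 / \<epsilon>) * q" "A > 0"
    and H: "H = exp ((A + 1) / (45 / \<epsilon>))"
    and B: "(16 * H) powr \<alpha> * (8 * H) * (4 * q / \<epsilon> + 1 / (4 * A)) \<le> c * B powr \<alpha>"
      "B \<ge> 3 * (2 / c) powr (1 / \<alpha>)"
  shows "k \<le> n \<Longrightarrow> mass2 k (u k) \<le> B / \<Phi> * (max (real n / real (k + 1)) (8 * A)) powr (1 / \<alpha>)"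
proof (induction k)
  case 0
  have "mass2 0 (u 0) \<le> 3 * (2 / c) powr (1 / \<alpha>) / \<Phi> * real n powr (1 / \<alpha>)"
  proof (rule mass2_initial[OF supp[of 0] nash])
    show "u 0 x = 0" if "x \<in> W" "real (d x) > sqrt (real n)" for x
    proof -
      have "real (d x) > 0" using that(2) real_sqrt_ge_zero[of "real n"] by linarith
      then show ?thesis using supp[of 0] that(1) by simp
    qed
  qed (use u0[of 0] mass[of 0] pos in auto)
  also have "\<dots> \<le> B / \<Phi> * (max (real n) (8 * A)) powr (1 / \<alpha>)"
    using B(2) pos by (intro mult_mono divide_right_mono powr_mono2) auto
  finally show ?case by simp
next
  case (Suc k)
  define \<gamma> where "\<gamma> = 1 / \<alpha>"
  define \<kappa> where "\<kappa> = real (k + 2)"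
  have \<gamma>: "\<gamma> > 0" using pos by (simp add: \<gamma>_def)
  have \<kappa>: "\<kappa> \<ge> 2" by (simp add: \<kappa>_def)
  have k: "k < n" "k \<le> n" using Suc.prems by auto
  have IH: "mass2 k (u k) \<le> B / \<Phi> * (max (real n / (\<kappa> - 1)) (8 * A)) powr \<gamma>"
    using Suc.IH k by (simp add: \<gamma>_def \<kappa>_def add.commute)
  have eq: "mass2 (Suc k) (u (Suc k)) = mass2 (Suc k) (local.step (u k))"
    unfolding mass2_def using step[OF k(1)] by (intro sum.cong) auto
  have q0: "q > 0" using pos by (simp add: q)
  have goal: "mass2 (Suc k) (local.step (u k)) \<le> B / \<Phi> * (max (real n / \<kappa>) (8 * A)) powr \<gamma>"
  proof (cases "4 * A * \<kappa> \<le> real n")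
    case True
    show ?thesis
    proof (rule mass2_step_decay[where u = "u k", OF supp[OF k(2)] u0[OF k(2)] mass[OF k(2)] nash])
      show "mass2 k (u k) \<le> B / \<Phi> * (max (real n / (\<kappa> - 1)) (8 * A)) powr \<gamma>" by (rule IH)
      show "B / \<Phi> * (real n / real (k + 2)) powr (1 / \<alpha>)
        \<le> B / \<Phi> * (max (real n / \<kappa>) (8 * A)) powr \<gamma>"
        using pos unfolding \<gamma>_def \<kappa>_def by (intro mult_left_mono powr_mono2) auto
      \<comment> \<open>Consecutive barriers have quotient at most (1 + 2 / \<kappa>)^(1/\<alpha>).
        Since exp t \<le> 1 + t exp t, and t = 2 / (\<alpha> \<kappa>) is at most 1 / \<alpha>, this
        is at most 1 + q / \<kappa>; hence the form of q.\<close>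
      have "(max (real n / (\<kappa> - 1)) (8 * A)) powr \<gamma>
        \<le> ((1 + 2 / \<kappa>) * max (real n / \<kappa>) (8 * A)) powr \<gamma>"
      proof (intro powr_mono2)
        have "real n / (\<kappa> - 1) \<le> (1 + 2 / \<kappa>) * (real n / \<kappa>)"
        proof -
          have "1 / (\<kappa> - 1) \<le> (1 + 2 / \<kappa>) / \<kappa>" using \<kappa> by (simp add: field_simps)
          then have "real n * (1 / (\<kappa> - 1)) \<le> real n * ((1 + 2 / \<kappa>) / \<kappa>)"
            by (intro mult_left_mono) auto
          then show ?thesis by (simp add: mult.commute)
        qed
        also have "\<dots> \<le> (1 + 2 / \<kappa>) * max (real n / \<kappa>) (8 * A)" using \<kappa>
          by (intro mult_left_mono) auto
        finally have 1: "real n / (\<kappa> - 1) \<le> (1 + 2 / \<kappa>) * max (real n / \<kappa>) (8 * A)" .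
        have "1 * (8 * A) \<le> (1 + 2 / \<kappa>) * max (real n / \<kappa>) (8 * A)"
          using \<kappa> A(2) by (intro mult_mono) auto
        with 1 show "max (real n / (\<kappa> - 1)) (8 * A) \<le> (1 + 2 / \<kappa>) * max (real n / \<kappa>) (8 * A)"
          by simp
      qed (use \<gamma> A in auto)
      also have "\<dots> = (1 + 2 / \<kappa>) powr \<gamma> * (max (real n / \<kappa>) (8 * A)) powr \<gamma>"
        by (rule powr_mult)
      also have "\<dots> \<le> (1 + q / \<kappa>) * (max (real n / \<kappa>) (8 * A)) powr \<gamma>"
      proof (intro mult_right_mono)
        have "(1 + 2 / \<kappa>) powr \<gamma> \<le> exp (2 / \<kappa>) powr \<gamma>"
          using \<kappa> \<gamma> by (intro powr_mono2 exp_ge_add_one_self) auto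
        also have "\<dots> = exp (\<gamma> * (2 / \<kappa>))" by (simp add: powr_def)
        also have "\<dots> \<le> 1 + (\<gamma> * (2 / \<kappa>)) * exp (\<gamma> * (2 / \<kappa>))"
        proof -
          define t where "t = \<gamma> * (2 / \<kappa>)"
          have "exp t * (1 + - t) \<le> exp t * exp (- t)"
            by (intro mult_left_mono exp_ge_add_one_self) simp
          then have "exp t \<le> 1 + t * exp t" by (simp add: exp_minus algebra_simps)
          then show ?thesis by (simp add: t_def)
        qed
        also have "\<dots> \<le> 1 + (\<gamma> * (2 / \<kappa>)) * exp \<gamma>"
        proof -
          have "\<gamma> * (2 / \<kappa>) \<le> \<gamma> * 1" using \<kappa> \<gamma> by (intro mult_left_mono) auto
          then show ?thesis using \<kappa> \<gamma> by (intro add_left_mono mult_left_mono) auto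
        qed
        also have "\<dots> = 1 + q / \<kappa>" by (simp add: q \<gamma>_def)
        finally show "(1 + 2 / \<kappa>) powr \<gamma> \<le> 1 + q / \<kappa>" .
      qed simp
      finally have "B / \<Phi> * (max (real n / (\<kappa> - 1)) (8 * A)) powr \<gamma>
        \<le> B / \<Phi> * ((1 + q / \<kappa>) * (max (real n / \<kappa>) (8 * A)) powr \<gamma>)"
        using pos by (intro mult_left_mono) auto
      then show "B / \<Phi> * (max (real n / (\<kappa> - 1)) (8 * A)) powr \<gamma>
        \<le> (1 + q / real (k + 2)) * (B / \<Phi> * (max (real n / \<kappa>) (8 * A)) powr \<gamma>)"
        by (simp add: \<kappa>_def mult_ac)
    qed (use pos q0 A H B True in \<open>auto simp: \<kappa>_def\<close>)
  next
    case False
    \<comment> \<open>As \<kappa> \<le> 2 (\<kappa> - 1), the preceding barrier is already at the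
      floor; this is why the floor is 8 A and not 4 A.\<close>
    have "real n / (\<kappa> - 1) \<le> 4 * A * \<kappa> / (\<kappa> - 1)" using False \<kappa> by (intro divide_right_mono) auto
    also have "\<dots> \<le> 8 * A"
    proof -
      have "4 * A * \<kappa> \<le> 4 * A * (2 * (\<kappa> - 1))" using \<kappa> A by (intro mult_left_mono) auto
      then show ?thesis using \<kappa> by (simp add: divide_le_eq right_diff_distrib)
    qed
    finally have "max (real n / (\<kappa> - 1)) (8 * A) = 8 * A" by simp
    then have "mass2 k (u k) \<le> B / \<Phi> * (max (real n / \<kappa>) (8 * A)) powr \<gamma>"
      using IH pos A \<gamma> by (elim order_trans) (auto intro!: divide_right_mono mult_left_mono powr_mono2)
    \<comment> \<open>The integrated maximum principle, obtained without Nash: the decrease of the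
      weight outweighs the error from its gradient.\<close>
    moreover have "mass2 (Suc k) (local.step (u k)) \<le> mass2 k (u k)"
    proof -
      have "moment2 (Suc k) (u k) / (2 * (45 / \<epsilon>) * (real (k + 2))\<^sup>2)
        \<le> moment2 (Suc k) (u k) / (45 / \<epsilon> * (real (k + 2))\<^sup>2)"
        using moment2_nonneg[of "Suc k" "u k"] \<epsilon>
          by (intro divide_left_mono mult_right_mono) (auto intro: divide_right_mono)
      moreover have "\<epsilon> / 2 * energy (u k) \<ge> 0" using energy_nonneg \<epsilon> by simp
      ultimately show ?thesis
        using mass2_step_le[of k "u k", OF supp[OF k(2)]] mass2_decrease_of_weight[of k "u k"]
          by linarith
    qed
    ultimately show ?thesis by linarith
  qed
  show ?case using goal unfolding eq \<gamma>_def \<kappa>_def by (simp add: add.commute)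
qed

end

section \<open>Heat kernel bounds from a relative Faber-Krahn inequality\<close>

text \<open>Controlled weights enter as local finiteness. Together with a common laziness constant,
  this passes directly to a union of graphs whose weights are added.\<close>

locale lazy_wgraph =
  fixes G :: "'a wgraph" and \<epsilon> :: real
  assumes simple: "simple_graph G"
    and connected: "connected_graph G"
    and vwt_pos: "\<And>x. x \<in> verts G \<Longrightarrow> vwt G x > 0"
    and symmetric: "symmetric_weights G"
    and adapted: "adapted G"
    and finite_nbrs: "\<And>x. x \<in> verts G \<Longrightarrow> finite (nbrs G x)"
    and lazy: "\<And>x. x \<in> verts G \<Longrightarrow> (\<Sum>y\<in>nbrs G x. ewt G x y) \<le> (1 - \<epsilon>) * vwt G x"
    and \<epsilon>: "0 < \<epsilon>" "\<epsilon> < 1"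
begin

section \<open>Graph distance and finite balls\<close>

lemma adjD: "(x, y) \<in> adj G \<Longrightarrow> x \<in> verts G \<and> y \<in> verts G \<and> x \<noteq> y"
proof -
  assume "(x, y) \<in> adj G"
  then obtain a b where "{x, y} = {a, b}" "a \<in> verts G" "b \<in> verts G" "a \<noteq> b"
    using simple unfolding simple_graph_def adj_def by blast
  then show ?thesis by (auto simp: doubleton_eq_iff)
qed

lemma adj_sym: "(x, y) \<in> adj G \<Longrightarrow> (y, x) \<in> adj G"
  by (simp add: adj_def insert_commute)

lemma nbrs_iff_adj: "y \<in> nbrs G x \<longleftrightarrow> (x, y) \<in> adj G"
  by (simp add: nbrs_def adj_def)

lemma nbrsD: "y \<in> nbrs G x \<Longrightarrow> x \<in> verts G \<and> y \<in> verts G \<and> x \<noteq> y"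
  unfolding nbrs_iff_adj by (rule adjD)

lemma nbrs_sym: "y \<in> nbrs G x \<Longrightarrow> x \<in> nbrs G y"
  unfolding nbrs_iff_adj by (rule adj_sym)

lemma ewt_sym: "x \<in> verts G \<Longrightarrow> y \<in> verts G \<Longrightarrow> ewt G x y = ewt G y x"
  using symmetric by (simp add: symmetric_weights_def)

lemma ewt_nonneg: "x \<in> verts G \<Longrightarrow> y \<in> verts G \<Longrightarrow> ewt G x y \<ge> 0"
  using symmetric by (simp add: symmetric_weights_def)

lemma ewt_eq_0_iff: "x \<in> verts G \<Longrightarrow> y \<in> verts G \<Longrightarrow> ewt G x y = 0 \<longleftrightarrow> y \<notin> nbrs G x"
  using adapted by (auto simp: adapted_def nbrs_def)

lemma relpow_adj_sym: "(x, y) \<in> adj G ^^ n \<Longrightarrow> (y, x) \<in> adj G ^^ n"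
proof (induction n arbitrary: y)
  case (Suc n)
  then obtain z where "(x, z) \<in> adj G ^^ n" "(z, y) \<in> adj G" by auto
  then show ?case using Suc.IH adj_sym by (meson relpow_Suc_I2)
qed auto

lemma gdist_le: "(x, y) \<in> adj G ^^ n \<Longrightarrow> gdist G x y \<le> n"
  unfolding gdist_def by (rule Least_le)

text \<open>Connectedness makes the set under \<open>LEAST\<close> nonempty, so the minimum is
  attained.\<close>

lemma gdist_walk: 
  assumes "x \<in> verts G" "y \<in> verts G"
  shows "(x, y) \<in> adj G ^^ gdist G x y"
proof -
  have "(x, y) \<in> (Restr (adj G) (verts G))\<^sup>*"
    using connected assms by (simp add: connected_graph_def connected_in_def)
  then have "(x, y) \<in> (adj G)\<^sup>*" by (rule rtrancl_mono[THEN subsetD, rotated]) auto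
  then show ?thesis unfolding gdist_def rtrancl_power by (elim exE) (rule LeastI)
qed

lemma gdist_refl [simp]: "gdist G x x = 0"
  using gdist_le[of x x 0] by simp

lemma gdist_sym: "x \<in> verts G \<Longrightarrow> y \<in> verts G \<Longrightarrow> gdist G x y = gdist G y x"
  by (metis antisym gdist_le gdist_walk relpow_adj_sym)

lemma gdist_triangle:
  assumes "x \<in> verts G" "y \<in> verts G" "z \<in> verts G"
  shows "gdist G x z \<le> gdist G x y + gdist G y z"
  using relcompI[OF gdist_walk[OF assms(1,2)] gdist_walk[OF assms(2,3)]]
  by (intro gdist_le) (simp only: relpow_add)

lemma gdist_nbr: "x \<in> verts G \<Longrightarrow> z \<in> nbrs G y \<Longrightarrow> gdist G x z \<le> gdist G x y + 1"
  using relpow_Suc_I[OF gdist_walk[of x y], of z] nbrsD[of z y] gdist_le[of x z "Suc (gdist G x y)"]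
  by (simp add: nbrs_iff_adj del: relpow.simps)

lemma gdist_nbr': 
  assumes "x \<in> verts G" "z \<in> nbrs G y"
  shows "gdist G y x \<le> gdist G z x + 1"
  using gdist_nbr[of x y z] assms nbrsD[of z y] nbrs_sym[of z y] gdist_sym[of x y] gdist_sym[of x z]
    by simp

lemma finite_relpow_image: "x \<in> verts G \<Longrightarrow> finite ((adj G ^^ n) `` {x})"
proof (induction n)
  case (Suc n)
  have "(adj G ^^ Suc n) `` {x} \<subseteq> (\<Union>y\<in>(adj G ^^ n) `` {x}. nbrs G y)"
    by (auto simp: nbrs_iff_adj)
  moreover have "finite (nbrs G y)" for y
    using finite_nbrs nbrsD by (cases "nbrs G y = {}") auto
  ultimately show ?case using Suc by (elim finite_subset) (intro finite_UN_I)
qed auto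

lemma finite_gball:
  assumes "x \<in> verts G"
  shows "finite (gball G x r)"
proof -
  have "gball G x r \<subseteq> (\<Union>n\<in>{..nat \<lfloor>r\<rfloor>}. (adj G ^^ n) `` {x})"
  proof
    fix y assume "y \<in> gball G x r"
    then have "y \<in> verts G" "gdist G x y \<le> nat \<lfloor>r\<rfloor>" by (auto simp: gball_def le_nat_floor)
    then show "y \<in> (\<Union>n\<in>{..nat \<lfloor>r\<rfloor>}. (adj G ^^ n) `` {x})"
      using gdist_walk[OF assms, of y] by blast
  qed
  moreover have "finite (\<Union>n\<in>{..nat \<lfloor>r\<rfloor>}. (adj G ^^ n) `` {x})"
    by (intro finite_UN_I finite_atMost finite_relpow_image assms)
  ultimately show ?thesis by (rule finite_subset)
qed

lemma gball_nat: "gball G x (real n) = {y \<in> verts G. gdist G x y \<le> n}"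
  by (simp add: gball_def)

lemma gball_subset_verts: "gball G x r \<subseteq> verts G"
  by (auto simp: gball_def)

section \<open>Powers of the Markov kernel\<close>

text \<open>Local finiteness collapses the infinite sum to the vertex itself, carrying the holding
  probability, and its finitely many neighbours.\<close>

lemma kernel_power_Suc:
  assumes x: "x \<in> verts G"
  shows "kernel_power G (Suc n) x y = (1 - (\<Sum>z\<in>nbrs G x. ewt G x z / vwt G x))
    * kernel_power G n x y
    + (\<Sum>z\<in>nbrs G x. ewt G x z / vwt G x * kernel_power G n z y)"
proof -
  have "kernel_power G (Suc n) x y = (\<Sum>\<^sub>\<infinity>z\<in>insert x (nbrs G x). markov_kernel G x z
    * kernel_power G n z y)"
    unfolding kernel_power.simps
    by (rule infsum_cong_neutral) (use x nbrsD ewt_eq_0_iff in \<open>auto simp: markov_kernel_def\<close>)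
  also have "\<dots> = markov_kernel G x x * kernel_power G n x y
    + (\<Sum>z\<in>nbrs G x. markov_kernel G x z * kernel_power G n z y)"
    using finite_nbrs[OF x] nbrsD by (subst infsum_finite) (auto simp: sum.insert_if)
  also have "(\<Sum>z\<in>nbrs G x. markov_kernel G x z * kernel_power G n z y)
    = (\<Sum>z\<in>nbrs G x. ewt G x z / vwt G x * kernel_power G n z y)"
    using nbrsD by (intro sum.cong) (auto simp: markov_kernel_def)
  finally show ?thesis using finite_nbrs[OF x] by (simp add: markov_kernel_def)
qed

lemma degree_le_1:
  assumes x: "x \<in> verts G"
  shows "(\<Sum>z\<in>nbrs G x. ewt G x z / vwt G x) \<le> 1"
proof -
  have "(\<Sum>y\<in>nbrs G x. ewt G x y) \<le> 1 * vwt G x"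
    using lazy[OF x] \<epsilon> vwt_pos[OF x] by (elim order_trans) (intro mult_right_mono, auto)
  then show ?thesis using vwt_pos[OF x] by (simp flip: sum_divide_distrib)
qed

lemma kernel_power_nonneg: "x \<in> verts G \<Longrightarrow> kernel_power G n x y \<ge> 0"
proof (induction n arbitrary: x)
  case (Suc n)
  have "0 \<le> (\<Sum>z\<in>nbrs G x. ewt G x z / vwt G x * kernel_power G n z y)"
    using Suc nbrsD ewt_nonneg vwt_pos
    by (intro sum_nonneg mult_nonneg_nonneg divide_nonneg_nonneg) (auto intro: less_imp_le)
  then show ?case unfolding kernel_power_Suc[OF Suc.prems]
    using Suc degree_le_1 by (intro add_nonneg_nonneg mult_nonneg_nonneg) auto
qed simp

text \<open>Finite propagation speed, which lets an infinite graph be treated on finite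
  balls.\<close>

lemma kernel_power_eq_0:
  "x \<in> verts G \<Longrightarrow> y \<in> verts G \<Longrightarrow> gdist G x y > n \<Longrightarrow> kernel_power G n x y = 0"
proof (induction n arbitrary: x)
  case (Suc n)
  have "kernel_power G n z y = 0" if "z \<in> nbrs G x" for z
    using Suc that nbrsD[OF that] gdist_nbr'[of y z x] by auto
  then show ?case using Suc by (simp add: kernel_power_Suc del: kernel_power.simps)
qed auto

lemma gball_nbr_subset: "z \<in> nbrs G x \<Longrightarrow> gball G z (real k) \<subseteq> gball G x (real (Suc k))"
  using nbrsD[of z x] gdist_nbr'[of _ z x] unfolding gball_nat by fastforce

text \<open>Chapman-Kolmogorov. Any finite superset of the ball is allowed as \<open>W\<close>, so
  that one set can serve expansions from two centres.\<close>

lemma kernel_power_add: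
  assumes "finite W" "x \<in> verts G" "gball G x (real k) \<subseteq> W"
  shows "kernel_power G (k + l) x y = (\<Sum>w\<in>W. kernel_power G k x w * kernel_power G l w y)"
  using assms(2,3)
proof (induction k arbitrary: x)
  case 0
  then have "x \<in> W" by (auto simp: gball_def)
  have "(\<Sum>w\<in>W. kernel_power G 0 x w * kernel_power G l w y) = (\<Sum>w\<in>W. if x
    = w then kernel_power G l w y else 0)"
    by (intro sum.cong) auto
  then show ?case using \<open>finite W\<close> \<open>x \<in> W\<close> by simp
next
  case (Suc k)
  define b where "b z = ewt G x z / vwt G x" for z
  have "gball G x (real k) \<subseteq> gball G x (real (Suc k))" by (auto simp: gball_def)
  then have IH: "kernel_power G (k + l) x y = (\<Sum>w\<in>W. kernel_power G k x w * kernel_power G l w y)"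
    using Suc by auto
  have IHz: "kernel_power G (k + l) z y = (\<Sum>w\<in>W. kernel_power G k z w * kernel_power G l w y)"
    if "z \<in> nbrs G x" for z
    using Suc.IH[of z] nbrsD[OF that] gball_nbr_subset[OF that, of k] Suc.prems by blast
  have "kernel_power G (Suc k + l) x y
      = (1 - sum b (nbrs G x)) * kernel_power G (k + l) x y + (\<Sum>z\<in>nbrs G x. b z * kernel_power G (k + l) z y)"
    using kernel_power_Suc[OF Suc.prems(1), of "k + l"] by (simp add: b_def del: kernel_power.simps)
  also have "(\<Sum>z\<in>nbrs G x. b z * kernel_power G (k + l) z y)
    = (\<Sum>z\<in>nbrs G x. \<Sum>w\<in>W. b z * kernel_power G k z w * kernel_power G l w y)"
    by (intro sum.cong refl) (simp add: IHz sum_distrib_left mult.assoc)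
  also have "\<dots> = (\<Sum>w\<in>W. \<Sum>z\<in>nbrs G x. b z * kernel_power G k z w * kernel_power G l w y)"
    by (rule sum.swap)
  also have "(1 - sum b (nbrs G x)) * kernel_power G (k + l) x y + \<dots> =
      (\<Sum>w\<in>W. ((1 - sum b (nbrs G x)) * kernel_power G k x w + (\<Sum>z\<in>nbrs G x. b z * kernel_power G k z w)) * kernel_power G l w y)"
    by (simp add: IH sum_distrib_left sum_distrib_right distrib_right sum.distrib mult.assoc)
  also have "\<dots> = (\<Sum>w\<in>W. kernel_power G (Suc k) x w * kernel_power G l w y)"
    by (simp add: kernel_power_Suc[OF Suc.prems(1)] b_def del: kernel_power.simps)
  finally show ?case .
qed

lemma kernel_power_mass:
  assumes "finite W" "x \<in> verts G" "gball G x (real k) \<subseteq> W"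
  shows "(\<Sum>w\<in>W. kernel_power G k x w) = 1"
  using assms(2,3)
proof (induction k arbitrary: x)
  case 0
  then have "x \<in> W" by (auto simp: gball_def)
  then show ?case using \<open>finite W\<close> by simp
next
  case (Suc k)
  define b where "b z = ewt G x z / vwt G x" for z
  have "gball G x (real k) \<subseteq> gball G x (real (Suc k))" by (auto simp: gball_def)
  then have IH: "(\<Sum>w\<in>W. kernel_power G k x w) = 1" using Suc by auto
  have IHz: "(\<Sum>w\<in>W. kernel_power G k z w) = 1" if "z \<in> nbrs G x" for z
    using Suc.IH[of z] nbrsD[OF that] gball_nbr_subset[OF that, of k] Suc.prems by blast
  have "(\<Sum>w\<in>W. kernel_power G (Suc k) x w)
      = (1 - sum b (nbrs G x)) * (\<Sum>w\<in>W. kernel_power G k x w) + (\<Sum>w\<in>W. \<Sum>z\<in>nbrs G x. b z * kernel_power G k z w)"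
    by (simp add: kernel_power_Suc[OF Suc.prems(1)] b_def sum.distrib sum_distrib_left del: kernel_power.simps)
  also have "(\<Sum>w\<in>W. \<Sum>z\<in>nbrs G x. b z * kernel_power G k z w)
    = (\<Sum>z\<in>nbrs G x. \<Sum>w\<in>W. b z * kernel_power G k z w)"
    by (rule sum.swap)
  also have "\<dots> = sum b (nbrs G x)"
    using IHz by (intro sum.cong) (auto simp flip: sum_distrib_left)
  finally show ?case using IH by simp
qed

lemma kernel_power_1_reversible:
  assumes "x \<in> verts G" "y \<in> verts G"
  shows "vwt G x * kernel_power G 1 x y = vwt G y * kernel_power G 1 y x"
proof (cases "x = y")
  case False
  have *: "vwt G a * kernel_power G 1 a b = ewt G a b" if "a \<in> verts G" "b \<in> verts G" "a \<noteq> b"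
    for a b
  proof -
    have "kernel_power G 1 a b = (\<Sum>z\<in>nbrs G a. if z = b then ewt G a z / vwt G a else 0)"
      using that kernel_power_Suc[of a 0 b]
        by (auto simp del: kernel_power.simps(2) intro: sum.cong)
    also have "\<dots> = ewt G a b / vwt G a"
      using finite_nbrs[of a] ewt_eq_0_iff[of a b] that by (simp add: sum.delta')
    finally show ?thesis using vwt_pos[OF that(1)] by simp
  qed
  show ?thesis using False assms * ewt_sym by metis
qed simp

lemma kernel_power_reversible:
  "x \<in> verts G \<Longrightarrow> y \<in> verts G \<Longrightarrow> vwt G x * kernel_power G n x y = vwt G y * kernel_power G n y x"
proof (induction n arbitrary: x y)
  case (Suc n)
  \<comment> \<open>The same sum is read as one step from \<open>x\<close> followed by
    \<open>n\<close> steps, and as \<open>n\<close> steps from \<open>y\<close> followed by one, so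
    both balls are needed.\<close>
  define W where "W = gball G x (real 1) \<union> gball G y (real n)"
  have W: "finite W" "W \<subseteq> verts G" using finite_gball[of x 1] finite_gball[of y n] gball_subset_verts Suc.prems by (auto simp: W_def)
  have "vwt G x * kernel_power G (Suc n) x y
    = (\<Sum>w\<in>W. vwt G x * kernel_power G 1 x w * kernel_power G n w y)"
    using kernel_power_add[OF W(1) Suc.prems(1), of 1 n y]
      by (simp add: W_def sum_distrib_left mult.assoc)
  also have "\<dots> = (\<Sum>w\<in>W. vwt G y * kernel_power G n y w * kernel_power G 1 w x)"
  proof (intro sum.cong refl)
    fix w assume "w \<in> W"
    then have w: "w \<in> verts G" using W by auto
    show "vwt G x * kernel_power G 1 x w * kernel_power G n w y
      = vwt G y * kernel_power G n y w * kernel_power G 1 w x"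
      unfolding kernel_power_1_reversible[OF Suc.prems(1) w] Suc.IH[OF w Suc.prems(2), symmetric]
      by (simp only: mult_ac)
  qed
  also have "\<dots> = vwt G y * kernel_power G (n + 1) y x"
    using kernel_power_add[OF W(1) Suc.prems(2), of n 1 x]
      by (simp add: W_def sum_distrib_left mult.assoc)
  finally show ?case by simp
qed auto

section \<open>Restriction to finite networks\<close>

lemma sum_ewt_eq_sum_nbrs:
  assumes z: "z \<in> verts G" and W: "finite W" "W \<subseteq> verts G"
    and f: "\<And>w. w \<in> nbrs G z \<Longrightarrow> w \<notin> W \<Longrightarrow> f w = 0"
  shows "(\<Sum>w\<in>W. ewt G z w * f w) = (\<Sum>w\<in>nbrs G z. ewt G z w * f w)"
proof -
  have "(\<Sum>w\<in>W. ewt G z w * f w) = (\<Sum>w\<in>W \<union> nbrs G z. ewt G z w * f w)"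
    using W f finite_nbrs[OF z] by (intro sum.mono_neutral_left) auto
  also have "\<dots> = (\<Sum>w\<in>nbrs G z. ewt G z w * f w)"
    using W z ewt_eq_0_iff[of z] finite_nbrs[OF z] by (intro sum.mono_neutral_right) auto
  finally show ?thesis .
qed

lemma finite_lazy_network_gball:
  assumes x: "x \<in> verts G"
  shows "finite_lazy_network (gball G x (real n)) (ewt G) (vwt G) \<epsilon> (gdist G x)"
proof
  show "finite (gball G x (real n))" by (rule finite_gball[OF x])
  fix y z assume y: "y \<in> gball G x (real n)" and z: "z \<in> gball G x (real n)"
  then have yz: "y \<in> verts G" "z \<in> verts G" by (auto simp: gball_def)
  show "ewt G y z = ewt G z y" "0 \<le> ewt G y z" using yz ewt_sym ewt_nonneg by auto
  assume "ewt G y z \<noteq> 0"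
  then have "z \<in> nbrs G y" using yz ewt_eq_0_iff by blast
  then show "gdist G x y \<le> gdist G x z + 1" using nbrs_sym[of z y] gdist_nbr[OF x, of y z] by simp
next
  fix y assume "y \<in> gball G x (real n)"
  then have y: "y \<in> verts G" by (auto simp: gball_def)
  then show "0 < vwt G y" by (rule vwt_pos)
  have "(\<Sum>w\<in>gball G x (real n). ewt G y w) = (\<Sum>w\<in>gball G x (real n) \<inter> nbrs G y. ewt G y w)"
    using finite_gball[OF x, of n] ewt_eq_0_iff[OF y] gball_subset_verts[of x n]
      by (intro sum.mono_neutral_right) auto
  also have "\<dots> \<le> (\<Sum>w\<in>nbrs G y. ewt G y w)"
    using finite_nbrs[OF y] ewt_nonneg[OF y] nbrsD by (intro sum_mono2) auto
  finally show "(\<Sum>w\<in>gball G x (real n). ewt G y w) \<le> (1 - \<epsilon>) * vwt G y" using lazy[OF y] by simp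
qed (rule \<epsilon>)+

lemma dirichlet_energy_nonneg: "dirichlet_energy G f \<ge> 0"
  unfolding dirichlet_energy_def using ewt_nonneg by (auto intro!: infsum_nonneg)

text \<open>Edges leaving the support still contribute to the energy, so \<open>W\<close> must
  contain one more layer of vertices around it.\<close>

lemma dirichlet_energy_finite:
  assumes W: "finite W" "W \<subseteq> verts G"
    and f: "\<And>x. f x \<noteq> 0 \<Longrightarrow> insert x (nbrs G x) \<subseteq> W"
  shows "dirichlet_energy G f = (\<Sum>x\<in>W. \<Sum>y\<in>W. ewt G x y * (f x - f y)\<^sup>2) / 2"
proof -
  have "(\<Sum>\<^sub>\<infinity>(x, y)\<in>verts G \<times> verts G. \<bar>f x - f y\<bar>\<^sup>2 * ewt G x y)
      = (\<Sum>\<^sub>\<infinity>(x, y)\<in>W \<times> W. \<bar>f x - f y\<bar>\<^sup>2 * ewt G x y)"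
  proof (rule infsum_cong_neutral)
    fix p assume p: "p \<in> verts G \<times> verts G - W \<times> W"
    obtain x y where xy: "p = (x, y)" by (cases p)
    have "f x = 0 \<and> f y = 0 \<or> y \<notin> nbrs G x"
      using p xy f[of x] f[of y] nbrs_sym[of y x] by blast
    then show "(case p of (x, y) \<Rightarrow> \<bar>f x - f y\<bar>\<^sup>2 * ewt G x y) = 0"
      using p xy ewt_eq_0_iff[of x y] by auto
  qed (use W in auto)
  also have "\<dots> = (\<Sum>x\<in>W. \<Sum>y\<in>W. ewt G x y * (f x - f y)\<^sup>2)"
    using W by (simp add: sum.cartesian_product mult.commute)
  finally show ?thesis by (simp add: dirichlet_energy_def)
qed

text \<open>Written as a product rather than a quotient, so that f = 0 need not be excluded.\<close>

lemma lambda1_le_Rayleigh: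
  assumes W: "finite W" "W \<subseteq> verts G"
    and f: "\<And>x. f x \<noteq> 0 \<Longrightarrow> insert x (nbrs G x) \<subseteq> W"
    and \<Omega>: "{x. f x \<noteq> 0} \<subseteq> \<Omega>"
  shows "lambda1 G \<Omega> * (\<Sum>x\<in>W. (f x)\<^sup>2 * vwt G x) \<le> (\<Sum>x\<in>W. \<Sum>y\<in>W. ewt G x y * (f x - f y)\<^sup>2) / 2"
proof (cases "f = (\<lambda>_. 0)")
  case False
  then obtain x where x: "f x \<noteq> 0" by auto
  then have xW: "x \<in> W" using f by blast
  have eq: "(\<Sum>\<^sub>\<infinity>x\<in>verts G. \<bar>f x\<bar>\<^sup>2 * vwt G x) = (\<Sum>x\<in>W. (f x)\<^sup>2 * vwt G x)"
  proof -
    have "(\<Sum>\<^sub>\<infinity>x\<in>verts G. \<bar>f x\<bar>\<^sup>2 * vwt G x) = (\<Sum>\<^sub>\<infinity>x\<in>W. \<bar>f x\<bar>\<^sup>2 * vwt G x)"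
      using W f by (intro infsum_cong_neutral) auto
    then show ?thesis using W by simp
  qed
  have "(\<Sum>x\<in>W. (f x)\<^sup>2 * vwt G x) > 0"
  proof (rule sum_pos2[OF W(1) xW])
    show "0 < (f x)\<^sup>2 * vwt G x" using x xW W vwt_pos by auto
    show "\<And>i. i \<in> W \<Longrightarrow> 0 \<le> (f i)\<^sup>2 * vwt G i" using W vwt_pos
      by (auto intro!: mult_nonneg_nonneg intro: less_imp_le)
  qed
  moreover have "lambda1 G \<Omega> \<le> dirichlet_energy G f / (\<Sum>x\<in>W. (f x)\<^sup>2 * vwt G x)"
    unfolding lambda1_def eq[symmetric]
  proof (rule cINF_lower)
    show "f \<in> {f. f \<noteq> (\<lambda>_. 0) \<and> {x. f x \<noteq> 0} \<subseteq> \<Omega>}" using False \<Omega> by simp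
    show "bdd_below ((\<lambda>f. dirichlet_energy G f / (\<Sum>\<^sub>\<infinity>x\<in>verts G. \<bar>f x\<bar>\<^sup>2
      * vwt G x)) ` {f. f \<noteq> (\<lambda>_. 0) \<and> {x. f x \<noteq> 0} \<subseteq> \<Omega>})"
      using vwt_pos dirichlet_energy_nonneg
      by (intro bdd_belowI2[where m = 0] divide_nonneg_nonneg infsum_nonneg mult_nonneg_nonneg) (auto intro: less_imp_le)
  qed
  ultimately show ?thesis
    using dirichlet_energy_finite[OF W f] by (simp add: pos_le_divide_eq)
qed simp

section \<open>From Faber-Krahn through Nash to the heat kernel\<close>

text \<open>Truncation at the level t = m / 4. As the mass is at most 1, the superlevel set has
  measure at most 4 / m, which is inserted into Faber-Krahn. The truncated function keeps half of
  the squared norm, and truncation, being a contraction, does not increase the energy.\<close>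

lemma nash_of_faber_krahn:
  assumes x: "x \<in> verts G" and n: "n > 0" and pos: "C > 0" "\<alpha> > 0" "\<Phi> > 0"
    and fk: "\<And>\<Omega>. \<Omega> \<noteq> {} \<Longrightarrow> \<Omega> \<subseteq> gball G x (sqrt (real n)) \<Longrightarrow>
      C / real n * (\<Phi> / measure_of_set G \<Omega>) powr \<alpha> \<le> lambda1 G \<Omega>"
    and W: "W = gball G x (real (Suc n))"
    and f0: "\<And>y. y \<in> W \<Longrightarrow> f y \<ge> 0"
    and supp: "\<And>y. y \<in> W \<Longrightarrow> real (gdist G x y) > sqrt (real n) \<Longrightarrow> f y = 0"
    and mass: "(\<Sum>y\<in>W. f y * vwt G y) \<le> 1"
  shows "C / (2 * 4 powr \<alpha>) * \<Phi> powr \<alpha> / real n * (\<Sum>y\<in>W. (f y)\<^sup>2 * vwt G y) powr (1 + \<alpha>)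
    \<le> (\<Sum>y\<in>W. \<Sum>z\<in>W. ewt G y z * (f y - f z)\<^sup>2) / 2"
proof -
  define m where "m = (\<Sum>y\<in>W. (f y)\<^sup>2 * vwt G y)"
  define t where "t = m / 4"
  define g where "g y = (if y \<in> W then max 0 (f y - t) else 0)" for y
  define \<Omega> where "\<Omega> = {y \<in> W. f y > t}"
  have finW: "finite W" and WV: "W \<subseteq> verts G" using finite_gball[OF x] by (auto simp: W gball_def)
  have vw: "vwt G y \<ge> 0" if "y \<in> W" for y using vwt_pos WV that by (auto intro: less_imp_le)
  have m0: "m \<ge> 0" unfolding m_def by (intro sum_nonneg mult_nonneg_nonneg) (auto intro: vw)
  have mono: "(\<Sum>y\<in>W. \<Sum>z\<in>W. ewt G y z * (g y - g z)\<^sup>2) \<le> (\<Sum>y\<in>W. \<Sum>z\<in>W. ewt G y z * (f y - f z)\<^sup>2)"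
  proof (intro sum_mono mult_left_mono)
    fix y z assume yz: "y \<in> W" "z \<in> W"
    have "\<bar>g y - g z\<bar> \<le> \<bar>f y - f z\<bar>" using yz by (simp add: g_def)
    then show "(g y - g z)\<^sup>2 \<le> (f y - f z)\<^sup>2" by (simp add: abs_le_square_iff)
    show "0 \<le> ewt G y z" using yz WV ewt_nonneg by auto
  qed
  show ?thesis
  proof (cases "m = 0")
    case True
    have "0 \<le> (\<Sum>y\<in>W. \<Sum>z\<in>W. ewt G y z * (f y - f z)\<^sup>2)"
      using WV ewt_nonneg by (intro sum_nonneg mult_nonneg_nonneg) auto
    then show ?thesis using True by (simp add: m_def[symmetric])
  next
    case False
    then have m: "m > 0" using m0 by simp
    then have t: "t > 0" by (simp add: t_def)
    have half: "m / 2 \<le> (\<Sum>y\<in>W. (g y)\<^sup>2 * vwt G y)"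
    proof -
      \<comment> \<open>The pointwise bound f^2 - 2 t f \<le> g^2 loses 2 t times the mass, at most
        m / 2 by the choice of t.\<close>
      have "m - 2 * t * (\<Sum>y\<in>W. f y * vwt G y) = (\<Sum>y\<in>W. ((f y)\<^sup>2 - 2 * t * f y) * vwt G y)"
        by (simp add: m_def left_diff_distrib sum_subtractf sum_distrib_left mult.assoc)
      also have "\<dots> \<le> (\<Sum>y\<in>W. (g y)\<^sup>2 * vwt G y)"
      proof (intro sum_mono mult_right_mono vw)
        fix y assume y: "y \<in> W"
        show "(f y)\<^sup>2 - 2 * t * f y \<le> (g y)\<^sup>2"
        proof (cases "f y > t")
          case True
          then have "(g y)\<^sup>2 = (f y - t)\<^sup>2" using y by (simp add: g_def)
          then show ?thesis by (simp add: power2_diff mult_ac)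
        next
          case False
          then have "f y * f y \<le> 2 * t * f y" using f0[OF y] t by (intro mult_right_mono) auto
          then show ?thesis using False y by (simp add: g_def power2_eq_square)
        qed
      qed auto
      finally have "m - 2 * t * (\<Sum>y\<in>W. f y * vwt G y) \<le> (\<Sum>y\<in>W. (g y)\<^sup>2 * vwt G y)" .
      moreover have "2 * t * (\<Sum>y\<in>W. f y * vwt G y) \<le> 2 * t * 1" using mass t
        by (intro mult_left_mono) auto
      ultimately show ?thesis by (simp add: t_def)
    qed
    have \<Omega>W: "\<Omega> \<subseteq> W" by (auto simp: \<Omega>_def)
    have \<Omega>ne: "\<Omega> \<noteq> {}"
    proof
      assume "\<Omega> = {}"
      then have "g y = 0" if "y \<in> W" for y using that by (auto simp: \<Omega>_def g_def)
      then have "(\<Sum>y\<in>W. (g y)\<^sup>2 * vwt G y) = 0" by simp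
      then show False using half m by simp
    qed
    have \<Omega>ball: "\<Omega> \<subseteq> gball G x (sqrt (real n))"
      using supp t WV by (force simp: \<Omega>_def gball_def not_le)
    have meas: "measure_of_set G \<Omega> = (\<Sum>y\<in>\<Omega>. vwt G y)"
      using finite_subset[OF \<Omega>W finW] by (simp add: measure_of_set_def)
    have meas0: "measure_of_set G \<Omega> > 0"
      unfolding meas using \<Omega>ne finite_subset[OF \<Omega>W finW] \<Omega>W WV vwt_pos by (intro sum_pos) auto
    have "t * measure_of_set G \<Omega> = (\<Sum>y\<in>\<Omega>. t * vwt G y)" by (simp add: meas sum_distrib_left)
    also have "\<dots> \<le> (\<Sum>y\<in>\<Omega>. f y * vwt G y)"
      using \<Omega>W vw by (intro sum_mono mult_right_mono) (auto simp: \<Omega>_def)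
    also have "\<dots> \<le> (\<Sum>y\<in>W. f y * vwt G y)"
      using \<Omega>W finW f0 vw by (intro sum_mono2) auto
    finally have "t * measure_of_set G \<Omega> \<le> 1" using mass by simp
    then have "m / 4 * \<Phi> \<le> \<Phi> / measure_of_set G \<Omega>"
      using meas0 pos by (simp add: t_def pos_le_divide_eq mult_ac mult_left_le)
    then have "(m / 4 * \<Phi>) powr \<alpha> \<le> (\<Phi> / measure_of_set G \<Omega>) powr \<alpha>"
      using m pos by (intro powr_mono2) auto
    then have "C / real n * (m / 4 * \<Phi>) powr \<alpha> \<le> C / real n * (\<Phi> / measure_of_set G \<Omega>) powr \<alpha>"
      using pos by (intro mult_left_mono) auto
    also have "\<dots> \<le> lambda1 G \<Omega>" by (rule fk[OF \<Omega>ne \<Omega>ball])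
    finally have l: "C / real n * (m / 4 * \<Phi>) powr \<alpha> \<le> lambda1 G \<Omega>" .
    have gsupp: "insert y (nbrs G y) \<subseteq> W" if "g y \<noteq> 0" for y
    proof -
      have "y \<in> \<Omega>" using that by (auto simp: g_def \<Omega>_def split: if_splits)
      then have y: "y \<in> W" "real (gdist G x y) \<le> sqrt (real n)" using \<Omega>ball
        by (auto simp: \<Omega>_def gball_def)
      \<comment> \<open>The support reaches at most distance n, and the radius n + 1 of
        \<open>W\<close> leaves room for its neighbours.\<close>
      have "sqrt (real n) \<le> real n" using n by (simp add: real_le_lsqrt power2_eq_square)
      then have "gdist G x y \<le> n" using y by linarith
      then show ?thesis using y gdist_nbr[OF x, of _ y] nbrsD unfolding W gball_nat by fastforce
    qed
    have "C / real n * (m / 4 * \<Phi>) powr \<alpha> * (m / 2) \<le> lambda1 G \<Omega> * (\<Sum>y\<in>W. (g y)\<^sup>2 * vwt G y)"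
      using l half m pos by (intro mult_mono) (auto intro: order_trans[OF _ l])
    also have "\<dots> \<le> (\<Sum>y\<in>W. \<Sum>z\<in>W. ewt G y z * (g y - g z)\<^sup>2) / 2"
      by (rule lambda1_le_Rayleigh[OF finW WV gsupp]) (auto simp: g_def \<Omega>_def split: if_splits)
    also have "\<dots> \<le> (\<Sum>y\<in>W. \<Sum>z\<in>W. ewt G y z * (f y - f z)\<^sup>2) / 2" using mono by simp
    finally have "C / real n * (m / 4 * \<Phi>) powr \<alpha> * (m / 2)
      \<le> (\<Sum>y\<in>W. \<Sum>z\<in>W. ewt G y z * (f y - f z)\<^sup>2) / 2" .
    moreover have "C / real n * (m / 4 * \<Phi>) powr \<alpha> * (m / 2)
      = C / (2 * 4 powr \<alpha>) * \<Phi> powr \<alpha> / real n * m powr (1 + \<alpha>)"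
      using m pos by (simp add: powr_mult powr_divide powr_add mult_ac)
    ultimately show ?thesis by (simp add: m_def)
  qed
qed

text \<open>The constants depend on C, \<alpha> and \<epsilon> only. For n \<le> 2 (k + 1) the
  barrier is at its floor and becomes a fixed multiple of 1 / \<Phi>.\<close>

lemma gaussian_L2_bound:
  assumes pos: "C > 0" "\<alpha> > 0"
  shows "\<exists>B>0. \<forall>x\<in>verts G. \<forall>n>0. \<forall>\<Phi>>0.
    (\<forall>\<Omega>. \<Omega> \<noteq> {} \<longrightarrow> \<Omega> \<subseteq> gball G x (sqrt (real n)) \<longrightarrow>
      C / real n * (\<Phi> / measure_of_set G \<Omega>) powr \<alpha> \<le> lambda1 G \<Omega>) \<longrightarrow>
    (\<forall>k\<le>n. n \<le> 2 * (k + 1) \<longrightarrow>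
      (\<Sum>y\<in>gball G x (real (Suc n)). (kernel_power G k y x / vwt G x)\<^sup>2 *
        exp ((real (gdist G x y))\<^sup>2 / (45 / \<epsilon> * real (k + 1))) * vwt G y) \<le> B / \<Phi>)"
proof -
  define c where "c = C / (2 * 4 powr \<alpha>)"
  define q where "q = 2 / \<alpha> * exp (1 / \<alpha>)"
  define A where "A = 8 * (45 / \<epsilon>) * q + 1"
  define H where "H = exp ((A + 1) / (45 / \<epsilon>))"
  define Z where "Z = (16 * H) powr \<alpha> * (8 * H) * (4 * q / \<epsilon> + 1 / (4 * A)) / c"
  \<comment> \<open>The first summand meets the requirement at time 0, the second solves the
    inequality \<open>BZ\<close> needed for the decay step.\<close>
  define B where "B = 3 * (2 / c) powr (1 / \<alpha>) + Z powr (1 / \<alpha>)"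
  have c: "c > 0" using pos by (simp add: c_def)
  have q: "q > 0" using pos by (simp add: q_def)
  have A: "A \<ge> 1" using q \<epsilon> by (simp add: A_def)
  have A': "A \<ge> 8 * (45 / \<epsilon>) * q" "A > 0" using A by (simp_all add: A_def)
  have H: "H > 0" by (simp add: H_def)
  have "4 * q / \<epsilon> + 1 / (4 * A) > 0" using q A \<epsilon> by (intro add_pos_pos divide_pos_pos) auto
  then have Z: "Z > 0" using c H by (simp add: Z_def)
  have B: "B > 0" using c Z by (simp add: B_def add_pos_pos)
  have B': "B \<ge> 3 * (2 / c) powr (1 / \<alpha>)" by (simp add: B_def)
  have "(Z powr (1 / \<alpha>)) powr \<alpha> \<le> B powr \<alpha>" using c pos by (intro powr_mono2) (auto simp: B_def)
  then have "Z \<le> B powr \<alpha>" using Z pos by (simp add: powr_powr)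
  then have BZ: "(16 * H) powr \<alpha> * (8 * H) * (4 * q / \<epsilon> + 1 / (4 * A)) \<le> c * B powr \<alpha>"
    using c by (simp add: Z_def divide_le_eq mult.commute)
  show ?thesis
  proof (intro exI[of _ "B * (8 * A) powr (1 / \<alpha>)"] conjI ballI allI impI)
    show "B * (8 * A) powr (1 / \<alpha>) > 0" using B A by simp
    fix x n k and \<Phi> :: real
    assume x: "x \<in> verts G" and n: "n > 0" and \<Phi>: "\<Phi> > 0" and k: "k \<le> n" "n \<le> 2 * (k + 1)"
      and fk: "\<forall>\<Omega>. \<Omega> \<noteq> {} \<longrightarrow> \<Omega> \<subseteq> gball G x (sqrt (real n)) \<longrightarrow>
        C / real n * (\<Phi> / measure_of_set G \<Omega>) powr \<alpha> \<le> lambda1 G \<Omega>"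
    define W where "W = gball G x (real (Suc n))"
    define u where "u k y = kernel_power G k y x / vwt G x" for k y
    interpret N: finite_lazy_network W "ewt G" "vwt G" \<epsilon> "gdist G x"
      unfolding W_def by (rule finite_lazy_network_gball[OF x])
    have WV: "W \<subseteq> verts G" by (auto simp: W_def gball_def)
    have vx: "vwt G x > 0" by (rule vwt_pos[OF x])
    have usupp: "u j y = 0" if "y \<in> verts G" "gdist G x y > j" for j y
      using that kernel_power_eq_0[of y x j] gdist_sym[OF x] x by (simp add: u_def)
    have "N.mass2 k (u k) \<le> B / \<Phi> * (max (real n / real (k + 1)) (8 * A)) powr (1 / \<alpha>)"
    proof (rule N.mass2_bound[where u = u and n = n and c = c and q = q and A = A and H = H
      and \<Phi> = \<Phi> and \<alpha> = \<alpha> and B = B])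
      fix j y assume j: "j < n" and "y \<in> W"
      then have y: "y \<in> verts G" using WV by auto
      \<comment> \<open>A neighbour outside \<open>W\<close> is at distance more than n + 1, hence
        \<open>y\<close> is at distance at least n + 1 > j. Neither has been reached by time j, so
        the truncated step agrees with the kernel.\<close>
      have "(\<Sum>w\<in>W. ewt G y w * (u j y - u j w)) = (\<Sum>w\<in>nbrs G y. ewt G y w * (u j y - u j w))"
      proof (rule sum_ewt_eq_sum_nbrs[OF y N.finite_W WV])
        fix w assume w: "w \<in> nbrs G y" "w \<notin> W"
        then have "gdist G x w > Suc n" using nbrsD[of w y] unfolding W_def gball_nat by auto
        moreover have "gdist G x w \<le> gdist G x y + 1" by (rule gdist_nbr[OF x w(1)])
        ultimately show "u j y - u j w = 0" using j y nbrsD[OF w(1)] usupp[of y j] usupp[of w j]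
          by simp
      qed
      then have "N.step (u j) y = u j y - (\<Sum>w\<in>nbrs G y. ewt G y w * (u j y - u j w)) / vwt G y"
        by (simp add: N.step_def)
      also have "\<dots> = (1 - (\<Sum>z\<in>nbrs G y. ewt G y z / vwt G y)) * u j y
        + (\<Sum>z\<in>nbrs G y. ewt G y z / vwt G y * u j z)"
        by (simp add: right_diff_distrib sum_subtractf diff_divide_distrib sum_divide_distrib sum_distrib_right left_diff_distrib)
      also have "\<dots> = u (Suc j) y"
        unfolding u_def kernel_power_Suc[OF y] by (simp add: add_divide_distrib sum_divide_distrib)
      finally show "u (Suc j) y = N.step (u j) y" by simp
    next
      fix j y assume "y \<in> W" "j < gdist G x y" then show "u j y = 0" using usupp WV by auto
    next
      fix j y assume "y \<in> W" then show "u j y \<ge> 0"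
        using kernel_power_nonneg[of y] WV vx by (auto simp: u_def)
    next
      fix j assume j: "j \<le> n"
      \<comment> \<open>Reversibility turns the mass of the heat kernel in its first argument into a
        row sum of the kernel.\<close>
      have "(\<Sum>y\<in>W. u j y * vwt G y) = (\<Sum>y\<in>W. kernel_power G j x y)"
      proof (intro sum.cong refl)
        fix y assume "y \<in> W"
        then have "vwt G x * kernel_power G j x y = vwt G y * kernel_power G j y x"
          using WV kernel_power_reversible[OF x] by auto
        then show "u j y * vwt G y = kernel_power G j x y" using vx by (simp add: u_def field_simps)
      qed
      also have "\<dots> = 1" using j by (intro kernel_power_mass[OF N.finite_W x]) (auto simp: W_def gball_def)
      finally show "(\<Sum>y\<in>W. u j y * vwt G y) \<le> 1" by simp
    next
      fix f assume "\<And>y. y \<in> W \<Longrightarrow> 0 \<le> f y" "\<And>y. y \<in> W \<Longrightarrow> sqrt (real n) < real (gdist G x y) \<Longrightarrow> f y = 0"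
        "(\<Sum>x\<in>W. f x * vwt G x) \<le> 1"
      then show "c * \<Phi> powr \<alpha> / real n * (\<Sum>x\<in>W. (f x)\<^sup>2 * vwt G x) powr (1 + \<alpha>) \<le> N.energy f / 2"
        unfolding c_def N.energy_def using fk
        by (intro nash_of_faber_krahn[OF x n pos \<Phi> _ W_def]) auto
    qed (fact c \<Phi> pos n B q_def A' H_def BZ B' k)+
    also have "max (real n / real (k + 1)) (8 * A) = 8 * A"
    proof -
      have "real n / real (k + 1) \<le> 2" using k(2) by (simp add: divide_le_eq)
      then show ?thesis using A by simp
    qed
    finally have "N.mass2 k (u k) \<le> B * (8 * A) powr (1 / \<alpha>) / \<Phi>" by simp
    moreover have "(\<Sum>y\<in>W. (u k y)\<^sup>2 * exp ((real (gdist G x y))\<^sup>2 / (45 / \<epsilon> * real (k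
      + 1))) * vwt G y) \<le> N.mass2 k (u k)"
      unfolding N.mass2_def N.gauss_def
    proof (intro sum_mono mult_right_mono mult_left_mono)
      fix y assume "y \<in> W"
      then show "0 \<le> vwt G y" using WV vwt_pos by (auto intro: less_imp_le)
      show "exp ((real (gdist G x y))\<^sup>2 / (45 / \<epsilon> * real (k + 1)))
        \<le> exp (((real (gdist G x y))\<^sup>2 + 1) / (45 / \<epsilon> * real (k + 1)))"
        unfolding exp_le_cancel_iff using \<epsilon> by (intro divide_right_mono) auto
    qed simp
    ultimately show "(\<Sum>y\<in>gball G x (real (Suc n)). (kernel_power G k y x / vwt G x)\<^sup>2 *
        exp ((real (gdist G x y))\<^sup>2 / (45 / \<epsilon> * real (k + 1))) * vwt G y) \<le> B * (8 * A) powr (1 / \<alpha>) / \<Phi>"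
      unfolding u_def W_def by linarith
  qed
qed

text \<open>The 8 in the exponent is a product of three factors 2: the square root in
  Cauchy-Schwarz, (a + b)^2 \<le> 2 a^2 + 2 b^2, and the bound 2 n for k + 1 and l + 1.\<close>

lemma heat_kernel_le_of_L2_bounds:
  assumes xy: "x \<in> verts G" "y \<in> verts G" and kl: "n = k + l" "n > 0"
    and D: "D > 0"
    and bx: "(\<Sum>z\<in>gball G x (real (Suc n)). (kernel_power G k z x / vwt G x)\<^sup>2 *
        exp ((real (gdist G x z))\<^sup>2 / (D * real (k + 1))) * vwt G z) \<le> bx"
    and b': "(\<Sum>z\<in>gball G y (real (Suc n)). (kernel_power G l z y / vwt G y)\<^sup>2 *
        exp ((real (gdist G y z))\<^sup>2 / (D * real (l + 1))) * vwt G z) \<le> b'"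
  shows "heat_kernel G n x y \<le> sqrt (bx * b') * exp (- (real (gdist G x y))\<^sup>2 / (8 * D * real n))"
proof -
  define W where "W = gball G x (real (Suc n)) \<union> gball G y (real (Suc n))"
  define a where "a v j z = kernel_power G j z v / vwt G v * exp ((real (gdist G v z))\<^sup>2 / (2 * D
    * real (j + 1)))" for v j z
  define E where "E = exp ((real (gdist G x y))\<^sup>2 / (8 * D * real n))"
  have "finite W" unfolding W_def by (intro finite_UnI finite_gball xy)
  moreover have "W \<subseteq> verts G" unfolding W_def by (intro Un_least gball_subset_verts)
  ultimately have W: "finite W" "W \<subseteq> verts G" by -
  have vw: "vwt G z \<ge> 0" if "z \<in> W" for z using vwt_pos W that by (auto intro: less_imp_le)
  \<comment> \<open>Enlarging the ball around one centre to \<open>W\<close> adds nothing, since the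
    walk from that centre stays in the ball for n steps.\<close>
  have sq: "(\<Sum>z\<in>W. vwt G z * (a v j z)\<^sup>2)
    = (\<Sum>z\<in>gball G v (real (Suc n)). (kernel_power G j z v / vwt G v)\<^sup>2 *
        exp ((real (gdist G v z))\<^sup>2 / (D * real (j + 1))) * vwt G z)"
    if v: "v \<in> {x, y}" and j: "j \<le> n" for v j
  proof -
    have vV: "v \<in> verts G" using v xy by auto
    have "(\<Sum>z\<in>W. vwt G z * (a v j z)\<^sup>2) = (\<Sum>z\<in>gball G v (real (Suc n)). vwt G z * (a v j z)\<^sup>2)"
    proof (intro sum.mono_neutral_right ballI)
      fix z assume z: "z \<in> W - gball G v (real (Suc n))"
      then have "kernel_power G j z v = 0"
        using W j vV gdist_sym[OF vV, of z] by (intro kernel_power_eq_0) (auto simp: gball_def)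
      then show "vwt G z * (a v j z)\<^sup>2 = 0" by (simp add: a_def)
    qed (use W v in \<open>auto simp: W_def\<close>)
    also have "\<dots> = (\<Sum>z\<in>gball G v (real (Suc n)). (kernel_power G j z v / vwt G v)\<^sup>2 *
        exp ((real (gdist G v z))\<^sup>2 / (D * real (j + 1))) * vwt G z)"
    proof (intro sum.cong refl)
      fix z
      have "(exp ((real (gdist G v z))\<^sup>2 / (2 * D * real (j + 1))))\<^sup>2
        = exp ((real (gdist G v z))\<^sup>2 / (D * real (j + 1)))"
        by (simp add: power2_eq_square flip: exp_add)
      then show "vwt G z * (a v j z)\<^sup>2 = (kernel_power G j z v / vwt G v)\<^sup>2 *
        exp ((real (gdist G v z))\<^sup>2 / (D * real (j + 1))) * vwt G z"
        unfolding a_def power_mult_distrib by (simp only: mult_ac)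
    qed
    finally show ?thesis .
  qed
  have "heat_kernel G n x y = (\<Sum>z\<in>W. kernel_power G k x z * kernel_power G l z y) / vwt G y"
  proof -
    have "gball G x (real k) \<subseteq> W" using kl(1) by (auto simp: W_def gball_def)
    then show ?thesis using kernel_power_add[OF W(1) xy(1), of k l y] kl(1)
      by (simp only: heat_kernel_def)
  qed
  also have "\<dots> = (\<Sum>z\<in>W. vwt G z * (kernel_power G k z x / vwt G x
    * (kernel_power G l z y / vwt G y)))"
    unfolding sum_divide_distrib
  proof (intro sum.cong refl)
    fix z assume "z \<in> W"
    then have "vwt G x * kernel_power G k x z = vwt G z * kernel_power G k z x"
      using W kernel_power_reversible[OF xy(1)] by auto
    then have "kernel_power G k x z = vwt G z * kernel_power G k z x / vwt G x"
      using vwt_pos[OF xy(1)] by (simp add: field_simps)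
    then show "kernel_power G k x z * kernel_power G l z y / vwt G y
      = vwt G z * (kernel_power G k z x / vwt G x * (kernel_power G l z y / vwt G y))"
      by simp
  qed
  finally have hk: "heat_kernel G n x y = (\<Sum>z\<in>W. vwt G z * (kernel_power G k z x / vwt G x
    * (kernel_power G l z y / vwt G y)))" .
  have "E * heat_kernel G n x y \<le> (\<Sum>z\<in>W. vwt G z * (a x k z * a y l z))"
    unfolding hk sum_distrib_left
  proof (rule sum_mono)
    fix z assume z: "z \<in> W"
    then have zV: "z \<in> verts G" using W by auto
    define p where "p = kernel_power G k z x / vwt G x * (kernel_power G l z y / vwt G y)"
    define dx dy where "dx = real (gdist G x z)" and "dy = real (gdist G y z)"
    have p0: "vwt G z * p \<ge> 0"
      unfolding p_def using kernel_power_nonneg[OF zV] vw[OF z] vwt_pos xy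
        by (simp add: less_imp_le)
    have "real (gdist G x y) \<le> dx + dy"
      using gdist_triangle[OF xy(1) zV xy(2)] gdist_sym[OF zV xy(2)] by (simp add: dx_def dy_def)
    then have "(real (gdist G x y))\<^sup>2 \<le> (dx + dy)\<^sup>2" by (intro power_mono) auto
    also have "\<dots> \<le> 2 * dx\<^sup>2 + 2 * dy\<^sup>2" using zero_le_power2[of "dx - dy"]
      by (simp add: power2_sum power2_diff)
    finally have "(real (gdist G x y))\<^sup>2 / (8 * D * real n)
      \<le> (2 * dx\<^sup>2 + 2 * dy\<^sup>2) / (8 * D * real n)"
      using D by (intro divide_right_mono) auto
    also have "\<dots> = dx\<^sup>2 / (4 * D * real n) + dy\<^sup>2 / (4 * D * real n)"
      by (simp add: add_divide_distrib)
    also have "\<dots> \<le> dx\<^sup>2 / (2 * D * real (k + 1)) + dy\<^sup>2 / (2 * D * real (l + 1))"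
    proof -
      have *: "b\<^sup>2 / (4 * D * real n) \<le> b\<^sup>2 / (2 * D * real (j + 1))" if "j \<le> n" for j and b :: real
      proof (rule divide_left_mono)
        have "2 * D * real (j + 1) \<le> 2 * D * (2 * real n)" using D that kl(2)
          by (intro mult_left_mono) auto
        then show "2 * D * real (j + 1) \<le> 4 * D * real n" by simp
        show "0 < 4 * D * real n * (2 * D * real (j + 1))" using D kl(2) by simp
      qed simp
      have "k \<le> n" "l \<le> n" using kl(1) by auto
      then show ?thesis by (intro add_mono *)
    qed
    finally have "E \<le> exp (dx\<^sup>2 / (2 * D * real (k + 1))) * exp (dy\<^sup>2 / (2 * D * real (l + 1)))"
      by (simp add: E_def flip: exp_add)
    then have "E * (vwt G z * p) \<le> exp (dx\<^sup>2 / (2 * D * real (k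
      + 1))) * exp (dy\<^sup>2 / (2 * D * real (l + 1))) * (vwt G z * p)"
      using p0 by (rule mult_right_mono)
    then show "E * (vwt G z * (kernel_power G k z x / vwt G x * (kernel_power G l z y / vwt G y)))
      \<le> vwt G z * (a x k z * a y l z)"
      unfolding a_def p_def dx_def dy_def by (simp only: mult_ac)
  qed
  also have "\<dots> \<le> sqrt (bx * b')"
  proof (rule real_le_rsqrt)
    have "(\<Sum>z\<in>W. vwt G z * (a x k z * a y l z))\<^sup>2
      \<le> (\<Sum>z\<in>W. vwt G z * (a x k z)\<^sup>2) * (\<Sum>z\<in>W. vwt G z * (a y l z)\<^sup>2)"
      by (rule weighted_Cauchy_Schwarz) (rule vw)
    also have "\<dots> \<le> bx * b'"
    proof (intro mult_mono)
      show 1: "(\<Sum>z\<in>W. vwt G z * (a x k z)\<^sup>2) \<le> bx" using sq[of x k] bx kl by simp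
      show "(\<Sum>z\<in>W. vwt G z * (a y l z)\<^sup>2) \<le> b'" using sq[of y l] b' kl by simp
      have "0 \<le> (\<Sum>z\<in>W. vwt G z * (a v j z)\<^sup>2)" for v j
        by (intro sum_nonneg mult_nonneg_nonneg vw) auto
      then show "0 \<le> bx" "0 \<le> (\<Sum>z\<in>W. vwt G z * (a y l z)\<^sup>2)" using 1 order_trans by blast+
    qed
    finally show "(\<Sum>z\<in>W. vwt G z * (a x k z * a y l z))\<^sup>2 \<le> bx * b'" .
  qed
  finally have "E * heat_kernel G n x y \<le> sqrt (bx * b')" .
  moreover have "E > 0" by (simp add: E_def)
  ultimately have "heat_kernel G n x y \<le> sqrt (bx * b') / E"
    by (simp add: pos_le_divide_eq mult.commute)
  moreover have "exp (- (real (gdist G x y))\<^sup>2 / (8 * D * real n)) = inverse E"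
    by (simp only: E_def exp_minus[symmetric] minus_divide_left)
  ultimately show ?thesis by (simp only: divide_inverse)
qed

text \<open>Positivity lets the values of \<open>F\<close> at the two centres play the role of
  \<Phi>. The times \<open>n div 2\<close> and n - \<open>n div 2\<close> are both in the admissible
  range k \<le> n \<le> 2 (k + 1), even for n = 1, where one of them is 0.\<close>

lemma gaussian_upper_bound:
  assumes pos: "C > 0" "\<alpha> > 0"
    and F: "\<And>x r. x \<in> verts G \<Longrightarrow> r > 0 \<Longrightarrow> F x r > 0"
    and fk: "relative_faber_krahn G (\<lambda>z r \<nu>. C / r\<^sup>2 * (F z r / \<nu>) powr \<alpha>)"
  shows "\<exists>c1>0. \<exists>c2>0. \<forall>x\<in>verts G. \<forall>y\<in>verts G. \<forall>n::nat. n > 0 \<longrightarrow>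
    heat_kernel G n x y \<le>
      c1 / sqrt (F x (sqrt (real n)) * F y (sqrt (real n)))
        * exp (- (real (gdist G x y))\<^sup>2 / (c2 * real n))"
proof -
  obtain B where B: "B > 0" and bound: "\<forall>x\<in>verts G. \<forall>n>0. \<forall>\<Phi>>0.
    (\<forall>\<Omega>. \<Omega> \<noteq> {} \<longrightarrow> \<Omega> \<subseteq> gball G x (sqrt (real n)) \<longrightarrow>
      C / real n * (\<Phi> / measure_of_set G \<Omega>) powr \<alpha> \<le> lambda1 G \<Omega>) \<longrightarrow>
    (\<forall>k\<le>n. n \<le> 2 * (k + 1) \<longrightarrow>
      (\<Sum>y\<in>gball G x (real (Suc n)). (kernel_power G k y x / vwt G x)\<^sup>2 *
        exp ((real (gdist G x y))\<^sup>2 / (45 / \<epsilon> * real (k + 1))) * vwt G y) \<le> B / \<Phi>)"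
    using gaussian_L2_bound[OF pos] by (elim exE conjE) (rule that)
  show ?thesis
  proof (rule exI[of _ B], rule conjI[OF B], rule exI[of _ "8
    * (45 / \<epsilon>)"], intro conjI ballI allI impI)
    show "0 < 8 * (45 / \<epsilon>)" using \<epsilon> by simp
    fix x y and n :: nat assume xy: "x \<in> verts G" "y \<in> verts G" and n: "n > 0"
    define k l where "k = n div 2" and "l = n - n div 2"
    define Fx Fy where "Fx = F x (sqrt (real n))" and "Fy = F y (sqrt (real n))"
    have F0: "Fx > 0" "Fy > 0" using F xy n by (auto simp: Fx_def Fy_def)
    have fk': "\<forall>\<Omega>. \<Omega> \<noteq> {} \<longrightarrow> \<Omega> \<subseteq> gball G z (sqrt (real n)) \<longrightarrow>
      C / real n * (F z (sqrt (real n)) / measure_of_set G \<Omega>) powr \<alpha> \<le> lambda1 G \<Omega>" if "z \<in> verts G" for z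
    proof -
      \<comment> \<open>n > 0 puts the radius into the range r \<ge> 1 of the Faber-Krahn
        hypothesis.\<close>
      have r: "1 \<le> sqrt (real n)" using n by simp
      show ?thesis
        using fk[unfolded relative_faber_krahn_def, THEN bspec, OF that, THEN spec, THEN mp, OF r, THEN conjunct2]
        by simp
    qed
    have "heat_kernel G n x y \<le> sqrt (B / Fx * (B / Fy)) * exp (- (real (gdist G x y))\<^sup>2 / (8
      * (45 / \<epsilon>) * real n))"
    proof (rule heat_kernel_le_of_L2_bounds[OF xy, where k = k and l = l])
      show "n = k + l" by (simp add: k_def l_def)
      have kl: "k \<le> n" "n \<le> 2 * (k + 1)" "l \<le> n" "n \<le> 2 * (l + 1)" by (auto simp: k_def l_def)
      note bound' = bound[THEN bspec, THEN spec, THEN mp, THEN spec, THEN mp, THEN mp, THEN spec, THEN mp, THEN mp]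
      show "(\<Sum>z\<in>gball G x (real (Suc n)). (kernel_power G k z x / vwt G x)\<^sup>2 *
          exp ((real (gdist G x z))\<^sup>2 / (45 / \<epsilon> * real (k + 1))) * vwt G z) \<le> B / Fx"
        by (rule bound'[OF xy(1) n F0(1) _ kl(1,2)]) (use fk'[OF xy(1)] in \<open>simp only: Fx_def\<close>)
      show "(\<Sum>z\<in>gball G y (real (Suc n)). (kernel_power G l z y / vwt G y)\<^sup>2 *
          exp ((real (gdist G y z))\<^sup>2 / (45 / \<epsilon> * real (l + 1))) * vwt G z) \<le> B / Fy"
        by (rule bound'[OF xy(2) n F0(2) _ kl(3,4)]) (use fk'[OF xy(2)] in \<open>simp only: Fy_def\<close>)
      show "0 < n" "0 < 45 / \<epsilon>" using n \<epsilon> by auto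
    qed
    also have "sqrt (B / Fx * (B / Fy)) = B / sqrt (Fx * Fy)"
      using B by (simp add: real_sqrt_divide real_sqrt_mult)
    finally show "heat_kernel G n x y \<le> B / sqrt (F x (sqrt (real n)) * F y (sqrt (real n)))
        * exp (- (real (gdist G x y))\<^sup>2 / (8 * (45 / \<epsilon>) * real n))"
      by (simp add: Fx_def Fy_def)
  qed
qed

end

section \<open>Graphs with pages and spine\<close>

definition locally_lazy :: "real \<Rightarrow> 'a wgraph \<Rightarrow> bool" where
  "locally_lazy \<epsilon> G \<longleftrightarrow> simple_graph G \<and> symmetric_weights G \<and> adapted G \<and>
    (\<forall>x\<in>verts G. vwt G x \<ge> 0 \<and> finite (nbrs G x) \<and> (\<Sum>y\<in>nbrs G x. ewt G x y) \<le> (1 - \<epsilon>) * vwt G x)"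

lemma simple_graph_edgeD:
  assumes "simple_graph G" "{x, y} \<in> edges G"
  shows "x \<in> verts G" "y \<in> verts G" "x \<noteq> y"
proof -
  obtain a b where "{x, y} = {a, b}" "a \<in> verts G" "b \<in> verts G" "a \<noteq> b"
    using assms unfolding simple_graph_def by blast
  then show "x \<in> verts G" "y \<in> verts G" "x \<noteq> y" by (auto simp: doubleton_eq_iff)
qed

text \<open>Each neighbour takes at least the share 1 / Cc of the vertex weight, so there are at
  most Cc of them.\<close>

lemma finite_nbrs_of_controlled:
  assumes "simple_graph G" "symmetric_weights G" "subordinate G" "controlled_weights G"
    and x: "x \<in> verts G" and pos: "vwt G x > 0"
  shows "finite (nbrs G x)"
proof (rule ccontr)
  assume inf: "infinite (nbrs G x)"
  obtain Cc where Cc: "Cc > 1" "\<And>y. y \<in> nbrs G x \<Longrightarrow> ewt G x y / vwt G x \<ge> 1 / Cc"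
    using assms(4) x unfolding controlled_weights_def by blast
  have summ: "ewt G x summable_on nbrs G x" "(\<Sum>\<^sub>\<infinity>y\<in>nbrs G x. ewt G x y) \<le> vwt G x"
    using assms(3) x unfolding subordinate_def by auto
  have nonneg: "ewt G x y \<ge> 0" if "y \<in> nbrs G x" for y
    using that assms(1,2) x simple_graph_edgeD(2)[of G x y]
      by (auto simp: symmetric_weights_def nbrs_def)
  obtain A where A: "finite A" "card A = nat \<lceil>Cc\<rceil> + 1" "A \<subseteq> nbrs G x"
    using infinite_arbitrarily_large[OF inf] by blast
  have "real (card A) * (vwt G x / Cc) = (\<Sum>y\<in>A. vwt G x / Cc)" by simp
  also have "\<dots> \<le> (\<Sum>y\<in>A. ewt G x y)"
  proof (rule sum_mono)
    fix y assume "y \<in> A"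
    then have "1 / Cc \<le> ewt G x y / vwt G x" using A Cc by blast
    then show "vwt G x / Cc \<le> ewt G x y" using pos by (simp add: field_simps)
  qed
  also have "\<dots> \<le> (\<Sum>\<^sub>\<infinity>y\<in>nbrs G x. ewt G x y)"
    using A nonneg summ by (intro finite_sum_le_infsum) auto
  also have "\<dots> \<le> vwt G x" by (rule summ)
  finally have "real (card A) * (vwt G x / Cc) \<le> vwt G x" .
  then have "real (card A) \<le> Cc" using pos Cc by (simp add: field_simps)
  moreover have "real (card A) > Cc" using A(2) Cc(1) by simp linarith
  ultimately show False by simp
qed

lemma locally_lazyI:
  assumes simple: "simple_graph G" and adm: "admissible_weights G"
    and pos: "\<And>x. x \<in> verts G \<Longrightarrow> vwt G x > 0 \<or> (nbrs G x = {} \<and> vwt G x = 0)"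
  shows "\<exists>\<epsilon>. 0 < \<epsilon> \<and> \<epsilon> < 1 \<and> locally_lazy \<epsilon> G"
proof -
  obtain \<epsilon> where \<epsilon>: "0 < \<epsilon>" "\<epsilon> < 1"
    and lz: "\<And>x. x \<in> verts G \<Longrightarrow> (\<Sum>\<^sub>\<infinity>y\<in>nbrs G x. ewt G x y) \<le> (1 - \<epsilon>) * vwt G x"
    using adm unfolding admissible_weights_def uniformly_lazy_def by blast
  have fin: "finite (nbrs G x)" if "x \<in> verts G" for x
    using pos[OF that] finite_nbrs_of_controlled[OF simple _ _ _ that] adm
      by (auto simp: admissible_weights_def)
  have "vwt G x \<ge> 0 \<and> finite (nbrs G x) \<and> (\<Sum>y\<in>nbrs G x. ewt G x y) \<le> (1 - \<epsilon>) * vwt G x"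
    if "x \<in> verts G" for x
    using pos[OF that] fin[OF that] lz[OF that] by auto
  then show ?thesis using \<epsilon> simple adm by (auto simp: locally_lazy_def admissible_weights_def)
qed

lemma locally_lazy_mono:
  assumes "locally_lazy \<epsilon> G" "\<epsilon>' \<le> \<epsilon>"
  shows "locally_lazy \<epsilon>' G"
proof -
  have "(1 - \<epsilon>) * vwt G x \<le> (1 - \<epsilon>') * vwt G x" if "x \<in> verts G" for x
    using assms that by (intro mult_right_mono) (auto simp: locally_lazy_def)
  then show ?thesis using assms(1) unfolding locally_lazy_def by force
qed

lemma lazy_wgraphI:
  assumes "locally_lazy \<epsilon> G" "0 < \<epsilon>" "\<epsilon> < 1" "connected_graph G" "\<And>x. x \<in> verts G \<Longrightarrow> vwt G x > 0"
  shows "lazy_wgraph G \<epsilon>"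
  using assms by (intro lazy_wgraph.intro) (auto simp: locally_lazy_def)

lemma weighted_graph_lazy:
  assumes "weighted_graph G"
  shows "\<exists>\<epsilon>. lazy_wgraph G \<epsilon>"
proof -
  obtain \<epsilon> where "0 < \<epsilon>" "\<epsilon> < 1" "locally_lazy \<epsilon> G"
    using locally_lazyI[of G] assms by (auto simp: weighted_graph_def)
  then show ?thesis using lazy_wgraphI[of \<epsilon> G] assms by (auto simp: weighted_graph_def)
qed

lemma wgraph_iso_nbrs:
  assumes iso: "wgraph_iso f G H" and simple: "simple_graph G" and x: "x \<in> verts G"
  shows "nbrs H (f x) = f ` nbrs G x"
proof -
  have inj: "inj_on f (verts G)" and E: "edges H = (\<lambda>e. f ` e) ` edges G"
    using iso by (auto simp: wgraph_iso_def bij_betw_def)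
  show ?thesis
  proof (intro set_eqI iffI)
    fix y assume "y \<in> nbrs H (f x)"
    then obtain e where e: "e \<in> edges G" "{f x, y} = f ` e" using E by (auto simp: nbrs_def)
    then obtain a b where ab: "e = {a, b}" "a \<in> verts G" "b \<in> verts G"
      using simple by (auto simp: simple_graph_def)
    have "f x = f a \<and> y = f b \<or> f x = f b \<and> y = f a" using e ab by (auto simp: doubleton_eq_iff)
    then have "x = a \<and> y = f b \<or> x = b \<and> y = f a" using inj x ab by (auto dest: inj_onD)
    then show "y \<in> f ` nbrs G x" using e(1) ab(1) by (auto simp: nbrs_def insert_commute)
  next
    fix y assume "y \<in> f ` nbrs G x"
    then obtain z where "{x, z} \<in> edges G" "y = f z" by (auto simp: nbrs_def)
    then show "y \<in> nbrs H (f x)" using E by (auto simp: nbrs_def intro!: image_eqI[of _ _ "{x, z}"])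
  qed
qed

lemma wgraph_iso_locally_lazy:
  assumes iso: "wgraph_iso f G H" and ll: "locally_lazy \<epsilon> G"
  shows "locally_lazy \<epsilon> H"
proof -
  have simple: "simple_graph G" using ll by (simp add: locally_lazy_def)
  have inj: "inj_on f (verts G)" and V: "verts H = f ` verts G"
    and E: "edges H = (\<lambda>e. f ` e) ` edges G"
    using iso by (auto simp: wgraph_iso_def bij_betw_def)
  have vw: "vwt H (f x) = vwt G x" if "x \<in> verts G" for x using iso that
    by (simp add: wgraph_iso_def)
  have ew: "ewt H (f x) (f y) = ewt G x y" if "x \<in> verts G" "y \<in> verts G" for x y
    using iso that by (simp add: wgraph_iso_def)
  have nb: "nbrs H (f x) = f ` nbrs G x" if "x \<in> verts G" for x
    by (rule wgraph_iso_nbrs[OF iso simple that])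
  have nbV: "nbrs G x \<subseteq> verts G" for x using simple_graph_edgeD[OF simple] by (auto simp: nbrs_def)
  have "simple_graph H"
    unfolding simple_graph_def
  proof
    fix e assume "e \<in> edges H"
    then obtain d where d: "d \<in> edges G" "e = f ` d" using E by auto
    then obtain a b where ab: "d = {a, b}" "a \<in> verts G" "b \<in> verts G" "a \<noteq> b"
      using simple by (auto simp: simple_graph_def)
    then have "e = {f a, f b}" "f a \<noteq> f b" "f a \<in> verts H" "f b \<in> verts H"
      using d inj V by (auto dest: inj_onD)
    then show "e \<in> {{x, y} |x y. x \<in> verts H \<and> y \<in> verts H \<and> x \<noteq> y}" by blast
  qed
  moreover have "symmetric_weights H"
    using ll V ew by (auto simp: symmetric_weights_def locally_lazy_def)
  moreover have "adapted H"
    unfolding adapted_def V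
  proof safe
    fix x y assume xy: "x \<in> verts G" "y \<in> verts G"
    have eq: "ewt G x y \<noteq> 0 \<longleftrightarrow> y \<in> nbrs G x" using ll xy
      by (auto simp: locally_lazy_def adapted_def nbrs_def)
    have "y \<in> nbrs G x \<longleftrightarrow> f y \<in> nbrs H (f x)" using nb[OF xy(1)] nbV[of x] inj xy(2)
      by (auto dest: inj_onD)
    then have *: "ewt H (f x) (f y) \<noteq> 0 \<longleftrightarrow> {f x, f y} \<in> edges H" using eq ew[OF xy]
      by (simp add: nbrs_def)
    show "{f x, f y} \<in> edges H" if "ewt H (f x) (f y) \<noteq> 0" using * that by blast
    show False if "{f x, f y} \<in> edges H" "ewt H (f x) (f y) = 0" using * that by blast
  qed
  moreover have "vwt H y \<ge> 0 \<and> finite (nbrs H y) \<and> (\<Sum>z\<in>nbrs H y. ewt H y z) \<le> (1 - \<epsilon>) * vwt H y"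
    if yH: "y \<in> verts H" for y
  proof -
    obtain x where x: "x \<in> verts G" "y = f x" using yH V by auto
    have "(\<Sum>z\<in>nbrs H y. ewt H y z) = (\<Sum>z\<in>nbrs G x. ewt H (f x) (f z))"
      unfolding x(2) nb[OF x(1)] using inj nbV[of x]
        by (subst sum.reindex) (auto intro: inj_on_subset)
    also have "\<dots> = (\<Sum>z\<in>nbrs G x. ewt G x z)" using ew x nbV[of x] by (intro sum.cong) auto
    finally show ?thesis using ll x vw nb by (auto simp: locally_lazy_def)
  qed
  ultimately show ?thesis by (simp add: locally_lazy_def)
qed

lemma wgraph_iso_connected:
  assumes iso: "wgraph_iso f G H" and conn: "connected_graph G"
  shows "connected_graph H"
proof -
  have V: "verts H = f ` verts G" and E: "edges H = (\<lambda>e. f ` e) ` edges G"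
    using iso by (auto simp: wgraph_iso_def bij_betw_def)
  have "(f x, f y) \<in> (Restr (adj H) (verts H))\<^sup>*" if "(x, y) \<in> (Restr (adj G) (verts G))\<^sup>*" for x y
    using that
  proof (induction rule: rtrancl_induct)
    case (step y z)
    then have "{y, z} \<in> edges G" "y \<in> verts G" "z \<in> verts G" by (auto simp: adj_def)
    then have "f ` {y, z} \<in> edges H" "f y \<in> verts H" "f z \<in> verts H" using E V by blast+
    then have "(f y, f z) \<in> Restr (adj H) (verts H)" by (simp add: adj_def)
    then show ?case using step.IH by (rule rtrancl_into_rtrancl[rotated])
  qed simp
  then show ?thesis using conn V by (auto simp: connected_graph_def connected_in_def)
qed

section \<open>Positivity of the page volume function\<close>

text \<open>The common interface of gluing and cutting. \<open>exit\<close> encodes that pages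
  communicate only through the spine.\<close>

locale paged_graph = lazy_wgraph \<Gamma> \<epsilon> for \<Gamma> :: "'a wgraph" and \<epsilon> :: real +
  fixes l :: nat and P :: "nat \<Rightarrow> 'a wgraph" and \<delta> :: real
  assumes page: "\<And>i. i \<in> {1..l} \<Longrightarrow> \<exists>\<epsilon>'. lazy_wgraph (P i) \<epsilon>'"
    and page_verts: "\<And>i. i \<in> {0..l} \<Longrightarrow> verts (P i) \<subseteq> verts \<Gamma>"
    and cover: "\<And>v. v \<in> verts \<Gamma> \<Longrightarrow> \<exists>i\<in>{0..l}. v \<in> verts (P i)"
    and exit: "\<And>i u w. i \<in> {1..l} \<Longrightarrow> u \<in> verts (P i) \<Longrightarrow> w \<notin> verts (P i) \<Longrightarrow> (u, w) \<in> adj \<Gamma>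
      \<Longrightarrow> u \<in> verts (P 0)"
    and width: "fixed_width \<Gamma> l P \<delta>"
begin

lemma vol_page_pos:
  assumes i: "i \<in> {1..l}" and y: "y \<in> verts (P i)" and r: "r > 0"
  shows "vol (P i) y r > 0"
proof -
  obtain \<epsilon>' where "lazy_wgraph (P i) \<epsilon>'" using page[OF i] by blast
  then interpret Q: lazy_wgraph "P i" \<epsilon>' .
  have fin: "finite (gball (P i) y r)" by (rule Q.finite_gball[OF y])
  have "y \<in> gball (P i) y r" using y r by (simp add: gball_def)
  then have "(\<Sum>x\<in>gball (P i) y r. vwt (P i) x) > 0"
    using fin Q.vwt_pos by (intro sum_pos) (auto simp: gball_def)
  then show ?thesis using fin by (simp add: vol_def measure_of_set_def)
qed

text \<open>Initial pieces of a short walk are short too, so the walk never leaves the ball: balls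
  are connected within themselves.\<close>

lemma gball_walk:
  assumes z: "z \<in> verts \<Gamma>" and n: "(z, y) \<in> adj \<Gamma> ^^ n" "real n \<le> r"
  shows "(z, y) \<in> (Restr (adj \<Gamma>) (gball \<Gamma> z r))\<^sup>*"
  using n
proof (induction n arbitrary: y)
  case (Suc n)
  then obtain w where w: "(z, w) \<in> adj \<Gamma> ^^ n" "(w, y) \<in> adj \<Gamma>" by auto
  have "w \<in> verts \<Gamma>" "y \<in> verts \<Gamma>" using adjD[OF w(2)] by auto
  moreover have "gdist \<Gamma> z w \<le> n" "gdist \<Gamma> z y \<le> Suc n"
    using gdist_le[OF w(1)] gdist_le[OF Suc.prems(1)] by auto
  ultimately have "(w, y) \<in> Restr (adj \<Gamma>) (gball \<Gamma> z r)" using w Suc.prems(2)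
    by (auto simp: gball_def)
  moreover have "(z, w) \<in> (Restr (adj \<Gamma>) (gball \<Gamma> z r))\<^sup>*" using Suc w by simp
  ultimately show ?case by (rule rtrancl_into_rtrancl[rotated])
qed auto

text \<open>Through the centre, \<open>v\<close> and \<open>w\<close> are joined inside the ball;
  where such a path first leaves the page, \<open>exit\<close> gives a spine vertex.\<close>

lemma gball_meets_spine:
  assumes z: "z \<in> verts \<Gamma>" and i: "i \<in> {1..l}"
    and v: "v \<in> gball \<Gamma> z r" "v \<in> verts (P i)" and w: "w \<in> gball \<Gamma> z r" "w \<notin> verts (P i)"
  shows "\<exists>u\<in>gball \<Gamma> z r. u \<in> verts (P i) \<and> u \<in> verts (P 0)"
proof (rule ccontr)
  let ?R = "Restr (adj \<Gamma>) (gball \<Gamma> z r)"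
  assume none: "\<not> ?thesis"
  have walk: "(z, y) \<in> ?R\<^sup>*" if "y \<in> gball \<Gamma> z r" for y
    using that gdist_walk[OF z, of y] by (intro gball_walk[OF z]) (auto simp: gball_def)
  have "sym ?R" using adj_sym by (auto simp: sym_def)
  then have "(v, z) \<in> ?R\<^sup>*" using walk[OF v(1)] by (metis sym_rtrancl symD)
  then have "(v, w) \<in> ?R\<^sup>*" using walk[OF w(1)] by (rule rtrancl_trans)
  then have "w \<in> verts (P i)"
  proof (induction rule: rtrancl_induct)
    case (step a b)
    show ?case
    proof (rule ccontr)
      assume "b \<notin> verts (P i)"
      then have "a \<in> verts (P 0)" using exit[OF i, of a b] step by auto
      then show False using none step by auto
    qed
  qed (rule v)
  then show False using w by simp
qed

text \<open>\<open>Min\<close> carries no information on empty or infinite sets, so the work is to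
  see that every set minimised over is finite and nonempty. The page volumes are positive because a
  ball contains its centre.\<close>

lemma V_min_pos:
  assumes z: "z \<in> verts \<Gamma>" and r: "r > 0" and no: "\<not> (\<exists>i\<in>{1..l}. gball \<Gamma> z r \<subseteq> verts (P i))"
  shows "V_min \<Gamma> l P \<delta> z r > 0"
proof -
  define S where "S i = nbhd \<Gamma> (gball \<Gamma> z r) \<delta> \<inter> verts (P i) \<inter> nbhd \<Gamma> (verts (P 0)) \<delta>" for i
  define J where "J = hit_pages \<Gamma> l P \<delta> (gball \<Gamma> z r)"
  have \<delta>: "\<delta> > 0" using width by (simp add: fixed_width_def)
  have J: "finite J" "J \<subseteq> {1..l}" by (auto simp: J_def hit_pages_def)
  have finS: "finite (S i)" for i
  proof (rule finite_subset)
    show "S i \<subseteq> gball \<Gamma> z (r + \<delta>)"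
    proof
      fix y assume "y \<in> S i"
      then obtain b where b: "y \<in> verts \<Gamma>" "b \<in> gball \<Gamma> z r" "real (gdist \<Gamma> y b) \<le> \<delta>"
        by (auto simp: S_def nbhd_def)
      then have "b \<in> verts \<Gamma>" "real (gdist \<Gamma> z b) \<le> r" by (auto simp: gball_def)
      then show "y \<in> gball \<Gamma> z (r + \<delta>)"
        using gdist_triangle[OF z, of b y] b gdist_sym[of y b] by (auto simp: gball_def)
    qed
    show "finite (gball \<Gamma> z (r + \<delta>))" by (rule finite_gball[OF z])
  qed
  have neS: "S i \<noteq> {}" if "i \<in> J" for i
  proof -
    have i: "i \<in> {1..l}" using that J by auto
    obtain v where v: "v \<in> gball \<Gamma> z r" "v \<in> nbhd \<Gamma> (verts (P i)) \<delta>" "v \<in> verts (P i)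
      \<or> v \<in> verts (P 0)"
      using \<open>i \<in> J\<close> by (auto simp: J_def hit_pages_def augmented_page_def)
    show ?thesis
    \<comment> \<open>If the page is hit through a spine vertex, a page vertex within \<delta> of it
      is close to the ball and to the spine at once. Otherwise the ball meets the page without being
      contained in it, and so contains a common vertex of page and spine.\<close>
    proof (cases "v \<in> verts (P 0)")
      case True
      obtain a where a: "a \<in> verts (P i)" "real (gdist \<Gamma> v a) \<le> \<delta>" using v(2)
        by (auto simp: nbhd_def)
      have "a \<in> verts \<Gamma>" "v \<in> verts \<Gamma>" using a(1) page_verts[of i] i v(1) by (auto simp: gball_def)
      moreover from this have "real (gdist \<Gamma> a v) \<le> \<delta>" using a(2) gdist_sym[of a v] by simp
      ultimately have "a \<in> S i" using a(1) v(1) True unfolding S_def nbhd_def by blast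
      then show ?thesis by blast
    next
      case False
      obtain w where "w \<in> gball \<Gamma> z r" "w \<notin> verts (P i)" using no i by blast
      then obtain u where u: "u \<in> gball \<Gamma> z r" "u \<in> verts (P i)" "u \<in> verts (P 0)"
        using gball_meets_spine[OF z i v(1)] v(3) False by blast
      moreover have "u \<in> verts \<Gamma>" using u(1) by (simp add: gball_def)
      moreover have "real (gdist \<Gamma> u u) \<le> \<delta>" using \<delta> by simp
      ultimately have "u \<in> S i" unfolding S_def nbhd_def by blast
      then show ?thesis by blast
    qed
  qed
  \<comment> \<open>The centre itself hits a page: by fixed width if it lies on the spine, by the
    covering otherwise.\<close>
  have neJ: "J \<noteq> {}"
  proof -
    have zB: "z \<in> gball \<Gamma> z r" using z r by (simp add: gball_def)
    obtain i where i: "i \<in> {1..l}" "z \<in> augmented_page \<Gamma> P \<delta> i"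
    proof (cases "z \<in> verts (P 0)")
      case True
      then obtain i where "i \<in> {1..l}" "z \<in> nbhd \<Gamma> (verts (P i)) \<delta>" using width
        by (auto simp: fixed_width_def)
      then show thesis using True that by (auto simp: augmented_page_def)
    next
      case False
      then obtain i where i: "i \<in> {1..l}" "z \<in> verts (P i)" using cover[OF z]
        by (metis atLeastAtMost_iff less_one not_le)
      have "real (gdist \<Gamma> z z) \<le> \<delta>" using \<delta> by simp
      then have "z \<in> augmented_page \<Gamma> P \<delta> i" using i z unfolding augmented_page_def nbhd_def
        by blast
      then show thesis using i that by blast
    qed
    then show ?thesis using zB by (auto simp: J_def hit_pages_def)
  qed
  have "Min ((\<lambda>y. vol (P i) y r) ` S i) > 0" if "i \<in> J" for i
    using finS[of i] neS[OF that] vol_page_pos[of i _ r] that J r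
      by (subst Min_gr_iff) (auto simp: S_def)
  then show ?thesis
    unfolding V_min_def S_def[symmetric] J_def[symmetric] using J neJ by (subst Min_gr_iff) auto
qed

lemma page_volume_function_pos:
  assumes F: "is_page_volume_function \<Gamma> l P \<delta> F" and z: "z \<in> verts \<Gamma>" and r: "r > 0"
  shows "F z r > 0"
proof (cases "\<exists>i\<in>{1..l}. gball \<Gamma> z r \<subseteq> verts (P i)")
  case True
  then obtain i where i: "i \<in> {1..l}" "gball \<Gamma> z r \<subseteq> verts (P i)" "F z r = vol (P i) z r"
    using F z r unfolding is_page_volume_function_def by (metis (no_types, lifting))
  have "z \<in> gball \<Gamma> z r" using z r by (simp add: gball_def)
  then show ?thesis using vol_page_pos[of i z r] i r by auto
next
  case False
  then have "F z r = V_min \<Gamma> l P \<delta> z r"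
    using F z r unfolding is_page_volume_function_def by (metis (no_types, lifting))
  then show ?thesis using V_min_pos[OF z r False] by simp
qed

end

section \<open>The two constructions\<close>

text \<open>Off the spine, adjacent vertices share a component, and a spine vertex adjacent to a
  component belongs to its page by construction. Hence an edge leaving a page starts on the
  spine.\<close>

lemma paged_graph_cutting:
  assumes cut: "obtained_by_cutting \<Gamma> l P" and width: "fixed_width \<Gamma> l P \<delta>"
  shows "\<exists>\<epsilon>. paged_graph \<Gamma> \<epsilon> l P \<delta>"
proof -
  define S where "S = verts \<Gamma> - verts (P 0)"
  have wg: "weighted_graph \<Gamma>" and P0: "verts (P 0) \<subseteq> verts \<Gamma>"
    and wP: "\<And>i. i \<in> {1..l} \<Longrightarrow> weighted_graph (P i)"
    using cut by (auto simp: obtained_by_cutting_def)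
  obtain K where K: "bij_betw K {1..l} (components_in \<Gamma> S)"
    and Pi: "\<And>i. i \<in> {1..l} \<Longrightarrow> verts (P i) = K i \<union> {v \<in> verts (P 0). \<exists>y\<in>K i. {v, y} \<in> edges \<Gamma>}"
    using cut unfolding obtained_by_cutting_def S_def
      by (elim conjE exE) (simp del: atLeastAtMost_iff)
  obtain \<epsilon> where "lazy_wgraph \<Gamma> \<epsilon>" using weighted_graph_lazy[OF wg] by blast
  then interpret lazy_wgraph \<Gamma> \<epsilon> .
  have comp: "\<exists>x\<in>S. K i = (Restr (adj \<Gamma>) S)\<^sup>* `` {x}" if "i \<in> {1..l}" for i
  proof -
    have "K i \<in> components_in \<Gamma> S" using bij_betwE[OF K] that by blast
    then show ?thesis unfolding components_in_def by blast
  qed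
  have KS: "K i \<subseteq> S" if "i \<in> {1..l}" for i
  proof -
    obtain x where x: "x \<in> S" "K i = (Restr (adj \<Gamma>) S)\<^sup>* `` {x}" using comp[OF \<open>i \<in> {1..l}\<close>]
      by blast
    have "y \<in> S" if "(x, y) \<in> (Restr (adj \<Gamma>) S)\<^sup>*" for y
      using that x(1) by (cases rule: rtranclE) auto
    then show ?thesis using x by auto
  qed
  have "paged_graph \<Gamma> \<epsilon> l P \<delta>"
  proof unfold_locales
    show "\<exists>\<epsilon>'. lazy_wgraph (P i) \<epsilon>'" if "i \<in> {1..l}" for i
      using weighted_graph_lazy[OF wP[OF that]] .
    show "verts (P i) \<subseteq> verts \<Gamma>" if "i \<in> {0..l}" for i
    proof (cases "i = 0")
      case False
      then have i: "i \<in> {1..l}" using that by simp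
      then show ?thesis using Pi[OF i] KS[OF i] P0 by (auto simp: S_def)
    qed (use P0 in simp)
    show "\<exists>i\<in>{0..l}. v \<in> verts (P i)" if v: "v \<in> verts \<Gamma>" for v
    proof (cases "v \<in> verts (P 0)")
      case False
      then have "(Restr (adj \<Gamma>) S)\<^sup>* `` {v} \<in> components_in \<Gamma> S" using v
        by (auto simp: components_in_def S_def)
      then obtain i where i: "i \<in> {1..l}" "K i = (Restr (adj \<Gamma>) S)\<^sup>* `` {v}"
        using bij_betw_imp_surj_on[OF K] by (metis imageE)
      then have "v \<in> verts (P i)" using Pi by auto
      then show ?thesis using i(1) by (intro bexI[of _ i]) auto
    qed auto
    show "u \<in> verts (P 0)" if i: "i \<in> {1..l}" and u: "u \<in> verts (P i)"
      and w: "w \<notin> verts (P i)" "(u, w) \<in> adj \<Gamma>" for i u w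
    proof (rule ccontr)
      assume u0: "u \<notin> verts (P 0)"
      then have uK: "u \<in> K i" using u Pi[OF i] by auto
      have "(w, u) \<in> adj \<Gamma>" using adj_sym[OF w(2)] .
      then have "w \<notin> verts (P 0)" using w(1) uK Pi[OF i] by (auto simp: adj_def)
      then have "(u, w) \<in> Restr (adj \<Gamma>) S" using adjD[OF w(2)] w(2) u0 by (auto simp: S_def)
      then have "w \<in> K i" using comp[OF i] uK by (auto intro: rtrancl_into_rtrancl)
      then show False using w(1) Pi[OF i] by auto
    qed
    show "fixed_width \<Gamma> l P \<delta>" by (rule width)
  qed
  then show ?thesis by blast
qed

text \<open>Here \<Gamma> does not come as a weighted graph: positivity, laziness and local
  finiteness must be derived from the pieces.\<close>

lemma paged_graph_gluing:
  assumes glue: "obtained_by_gluing \<Gamma> l P" and width: "fixed_width \<Gamma> l P \<delta>"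
  shows "\<exists>\<epsilon>. paged_graph \<Gamma> \<epsilon> l P \<delta>"
proof -
  obtain Q :: "nat \<Rightarrow> 'a wgraph" and M M' \<phi> \<iota> where
    gd: "gluing_data l Q M M' \<phi>" and iso': "\<forall>i\<in>{0..l}. wgraph_iso (\<iota> i) (Q i) (P i)"
    and ident': "\<forall>i\<in>{0..l}. \<forall>j\<in>{0..l}. \<forall>x\<in>verts (Q i). \<forall>y\<in>verts (Q j).
            \<iota> i x = \<iota> j y \<longleftrightarrow>
            ((i, x), (j, y)) \<in> (glue_rel l M \<phi> \<union> (glue_rel l M \<phi>)\<inverse>)\<^sup>*"
    and V: "verts \<Gamma> = (\<Union>i\<in>{0..l}. verts (P i))"
    and E: "edges \<Gamma> = (\<Union>i\<in>{0..l}. edges (P i))"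
    and vw': "\<forall>x\<in>verts \<Gamma>. vwt \<Gamma> x = (\<Sum>i | i \<in> {0..l} \<and> x \<in> verts (P i). vwt (P i) x)"
    and ew': "\<forall>x\<in>verts \<Gamma>. \<forall>y\<in>verts \<Gamma>.
            ewt \<Gamma> x y = (\<Sum>i | i \<in> {0..l} \<and> x \<in> verts (P i) \<and> y \<in> verts (P i). ewt (P i) x y)"
    and conn: "connected_graph \<Gamma>"
    and bdry': "\<forall>i\<in>{1..l}. inner_boundary \<Gamma> (verts (P i)) = \<iota> i ` M i"
    using glue unfolding obtained_by_gluing_def by (elim exE conjE) (rule that)
  note iso = bspec[OF iso'] and vw = bspec[OF vw'] and bdry = bspec[OF bdry']
    and ident = ident'[THEN bspec, THEN bspec, THEN bspec, THEN bspec]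
    and ew = ew'[THEN bspec, THEN bspec]
  have wQ: "\<And>i. i \<in> {1..l} \<Longrightarrow> weighted_graph (Q i) \<and> infinite (verts (Q i))"
    and sQ: "spine_graph (Q 0)"
    and MQ: "\<And>i. i \<in> {1..l} \<Longrightarrow> M i \<subseteq> verts (Q i) \<and> M' i \<subseteq> verts (Q 0) \<and> bij_betw (\<phi> i) (M i) (M' i)"
    using gd by (auto simp: gluing_data_def)
  have PV: "verts (P i) = \<iota> i ` verts (Q i)" if "i \<in> {0..l}" for i
    using iso[OF that] by (auto simp: wgraph_iso_def bij_betw_def)
  have "\<exists>e. 0 < e \<and> e < 1 \<and> locally_lazy e (P i)" if i: "i \<in> {0..l}" for i
  proof -
    have "\<exists>e. 0 < e \<and> e < 1 \<and> locally_lazy e (Q i)"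
    proof (cases "i = 0")
      case True
      then show ?thesis using sQ by (intro locally_lazyI) (auto simp: spine_graph_def)
    next
      case False
      then show ?thesis using wQ[of i] i by (intro locally_lazyI) (auto simp: weighted_graph_def)
    qed
    then show ?thesis using wgraph_iso_locally_lazy[OF iso[OF i]] by blast
  qed
  then obtain e where e: "\<And>i. i \<in> {0..l} \<Longrightarrow> 0 < e i \<and> e i < 1 \<and> locally_lazy (e i) (P i)" by metis
  \<comment> \<open>There are finitely many pieces, so the least laziness constant serves all of
    them.\<close>
  define \<epsilon> where "\<epsilon> = Min (e ` {0..l})"
  have \<epsilon>: "0 < \<epsilon>" "\<epsilon> < 1"
  proof -
    show "0 < \<epsilon>" unfolding \<epsilon>_def using e by (subst Min_gr_iff) auto
    have "\<epsilon> \<le> e 0" unfolding \<epsilon>_def by (intro Min_le) auto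
    then show "\<epsilon> < 1" using e[of 0] by simp
  qed
  have ll: "locally_lazy \<epsilon> (P i)" if "i \<in> {0..l}" for i
    using e[OF that] that by (intro locally_lazy_mono[of "e i" "P i" \<epsilon>]) (auto simp: \<epsilon>_def)
  have simP: "simple_graph (P i)" if "i \<in> {0..l}" for i using ll[OF that]
    by (simp add: locally_lazy_def)
  have PG: "verts (P i) \<subseteq> verts \<Gamma>" if "i \<in> {0..l}" for i using V that by blast
  have nbP: "nbrs (P i) x \<subseteq> verts (P i)" if "i \<in> {0..l}" for i x
    using simple_graph_edgeD[OF simP[OF that]] by (auto simp: nbrs_def)
  have nb: "nbrs \<Gamma> x = (\<Union>i\<in>{0..l}. nbrs (P i) x)" for x using E by (auto simp: nbrs_def)
  have ewP: "ewt (P i) x y \<noteq> 0 \<longleftrightarrow> y \<in> nbrs (P i) x" "ewt (P i) x y \<ge> 0" "ewt (P i) x y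
    = ewt (P i) y x"
    if "i \<in> {0..l}" "x \<in> verts (P i)" "y \<in> verts (P i)" for i x y
    using ll[OF that(1)] that by (auto simp: locally_lazy_def adapted_def symmetric_weights_def nbrs_def)
  have vw0: "vwt (P i) x \<ge> 0" if "i \<in> {0..l}" "x \<in> verts (P i)" for i x
    using ll[OF that(1)] that by (auto simp: locally_lazy_def)
  have pageW: "\<And>x. x \<in> verts (P i) \<Longrightarrow> vwt (P i) x
    > 0" "connected_graph (P i)" "infinite (verts (P i))" if i: "i \<in> {1..l}" for i
  proof -
    have i0: "i \<in> {0..l}" using i by simp
    show "vwt (P i) x > 0" if "x \<in> verts (P i)" for x
      using that PV[OF i0] iso[OF i0] wQ[OF i] by (auto simp: wgraph_iso_def weighted_graph_def)
    show "connected_graph (P i)" using wgraph_iso_connected[OF iso[OF i0]] wQ[OF i]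
      by (simp add: weighted_graph_def)
    show "infinite (verts (P i))"
      using wQ[OF i] iso[OF i0] by (auto simp: wgraph_iso_def dest: bij_betw_finite)
  qed
  have spineW: "vwt (P 0) x > 0" if x: "x \<in> verts (P 0)" "nbrs (P 0) x \<noteq> {}" for x
  proof -
    obtain y where y: "y \<in> verts (Q 0)" "x = \<iota> 0 y" using x(1) PV[of 0] by auto
    have "nbrs (P 0) x = \<iota> 0 ` nbrs (Q 0) y"
      unfolding y(2) using wgraph_iso_nbrs[OF iso[of 0] _ y(1)] sQ by (simp add: spine_graph_def)
    then have "nbrs (Q 0) y \<noteq> {}" using x(2) by auto
    then have "vwt (Q 0) y > 0" using sQ y(1) by (auto simp: spine_graph_def)
    then show ?thesis using iso[of 0] y by (simp add: wgraph_iso_def)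
  qed
  have simple\<Gamma>: "simple_graph \<Gamma>"
    unfolding simple_graph_def
  proof
    fix d assume "d \<in> edges \<Gamma>"
    then obtain i where i: "i \<in> {0..l}" "d \<in> edges (P i)" using E by blast
    then obtain a b where "d = {a, b}" "a \<in> verts (P i)" "b \<in> verts (P i)" "a \<noteq> b"
      using simP[OF i(1)] by (auto simp: simple_graph_def)
    then show "d \<in> {{x, y} |x y. x \<in> verts \<Gamma> \<and> y \<in> verts \<Gamma> \<and> x \<noteq> y}" using PG[OF i(1)] by blast
  qed
  have "vwt \<Gamma> x > 0" if x: "x \<in> verts \<Gamma>" for x
  proof -
    have "\<exists>i\<in>{0..l}. x \<in> verts (P i) \<and> vwt (P i) x > 0"
    proof (cases "\<exists>i\<in>{1..l}. x \<in> verts (P i)")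
      case True
      then obtain i where "i \<in> {1..l}" "x \<in> verts (P i)" by blast
      then show ?thesis using pageW(1) by (intro bexI[of _ i]) auto
    next
      case False
      \<comment> \<open>The spine weight might vanish if \<open>x\<close> were isolated there. Fixed
        width provides a page, hence a second vertex, and connectedness an edge at \<open>x\<close>;
        lying in no page, this edge belongs to the spine.\<close>
      then have x0: "x \<in> verts (P 0)" using x V
        by (metis (no_types, lifting) UN_E atLeastAtMost_iff less_one not_le)
      then obtain i where i: "i \<in> {1..l}" using width by (auto simp: fixed_width_def)
      then obtain w where w: "w \<in> verts (P i)" using pageW(3)[OF i]
        by (metis ex_in_conv finite.emptyI)
      have "w \<in> verts \<Gamma>" "w \<noteq> x" using w PG[of i] i False by auto
      then have "(x, w) \<in> (Restr (adj \<Gamma>) (verts \<Gamma>))\<^sup>*" using conn x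
        by (auto simp: connected_graph_def connected_in_def)
      then obtain y where "(x, y) \<in> adj \<Gamma>" using \<open>w \<noteq> x\<close> by (cases rule: converse_rtranclE) auto
      then obtain j where j: "j \<in> {0..l}" "{x, y} \<in> edges (P j)" using E by (auto simp: adj_def)
      then have "x \<in> verts (P j)" using simple_graph_edgeD[OF simP] by blast
      then have "j = 0" using False j(1) by (cases "j = 0") auto
      then have "vwt (P 0) x > 0" using j by (intro spineW[OF x0]) (auto simp: nbrs_def)
      then show ?thesis using x0 by auto
    qed
    then obtain i where i: "i \<in> {0..l}" "x \<in> verts (P i)" "vwt (P i) x > 0" by blast
    show ?thesis unfolding vw[OF x] using i vw0 by (intro sum_pos2[of _ i]) auto
  qed
  note vpos = this
  have "locally_lazy \<epsilon> \<Gamma>"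
    unfolding locally_lazy_def
  proof (intro conjI ballI simple\<Gamma>)
    show "symmetric_weights \<Gamma>"
      unfolding symmetric_weights_def
    proof (intro ballI conjI)
      fix x y assume xy: "x \<in> verts \<Gamma>" "y \<in> verts \<Gamma>"
      show "ewt \<Gamma> x y = ewt \<Gamma> y x"
        unfolding ew[OF xy] ew[OF xy(2) xy(1)] using ewP(3) by (intro sum.cong) auto
      show "0 \<le> ewt \<Gamma> x y" unfolding ew[OF xy] using ewP(2) by (intro sum_nonneg) auto
    qed
    show "adapted \<Gamma>"
      unfolding adapted_def
    proof (intro ballI)
      fix x y assume xy: "x \<in> verts \<Gamma>" "y \<in> verts \<Gamma>"
      \<comment> \<open>Nonnegativity rules out cancellation between the pieces.\<close>
      have "ewt \<Gamma> x y = 0 \<longleftrightarrow> (\<forall>i\<in>{i. i \<in> {0..l} \<and> x \<in> verts (P i) \<and> y \<in> verts (P i)}. ewt (P i) x y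
        = 0)"
        unfolding ew[OF xy] using ewP(2) by (intro sum_nonneg_eq_0_iff) auto
      also have "\<dots> \<longleftrightarrow> \<not> (\<exists>i\<in>{0..l}. {x, y} \<in> edges (P i))"
      proof -
        have "{x, y} \<in> edges (P i) \<longleftrightarrow> x \<in> verts (P i) \<and> y \<in> verts (P i) \<and> ewt (P i) x y \<noteq> 0"
          if i: "i \<in> {0..l}" for i
          using ewP(1)[OF i, of x y] simple_graph_edgeD(1,2)[OF simP[OF i], of x y]
            by (auto simp: nbrs_def)
        then show ?thesis by blast
      qed
      finally show "ewt \<Gamma> x y \<noteq> 0 \<longleftrightarrow> {x, y} \<in> edges \<Gamma>" using E by auto
    qed
    fix x assume x: "x \<in> verts \<Gamma>"
    define I where "I = {i. i \<in> {0..l} \<and> x \<in> verts (P i)}"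
    have finI: "finite I" by (simp add: I_def)
    have finP: "finite (nbrs (P i) x)" if "i \<in> {0..l}" for i
    proof (cases "x \<in> verts (P i)")
      case True then show ?thesis using ll[OF that] by (simp add: locally_lazy_def)
    next
      case False
      then have "nbrs (P i) x = {}" using simple_graph_edgeD[OF simP[OF that]]
        by (auto simp: nbrs_def)
      then show ?thesis by simp
    qed
    show "0 \<le> vwt \<Gamma> x" using vpos[OF x] by simp
    show fin: "finite (nbrs \<Gamma> x)" unfolding nb using finP by simp
    \<comment> \<open>Each piece contributes only along its own edges; exchanging the sums reduces
      the degree in \<Gamma> to the degrees in the pieces.\<close>
    have "(\<Sum>y\<in>nbrs \<Gamma> x. ewt \<Gamma> x y) = (\<Sum>y\<in>nbrs \<Gamma> x. \<Sum>i\<in>I. if y \<in> nbrs (P i) x then ewt (P i) x y else 0)"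
    proof (intro sum.cong refl)
      fix y assume "y \<in> nbrs \<Gamma> x"
      then have y: "y \<in> verts \<Gamma>" using simple_graph_edgeD(2)[OF simple\<Gamma>] by (auto simp: nbrs_def)
      show "ewt \<Gamma> x y = (\<Sum>i\<in>I. if y \<in> nbrs (P i) x then ewt (P i) x y else 0)"
        unfolding ew[OF x y]
      proof (rule sum.mono_neutral_cong_left)
        show "finite I" by (rule finI)
        show "{i. i \<in> {0..l} \<and> x \<in> verts (P i) \<and> y \<in> verts (P i)} \<subseteq> I" by (auto simp: I_def)
        show "\<forall>i\<in>I - {i. i \<in> {0..l} \<and> x \<in> verts (P i)
          \<and> y \<in> verts (P i)}. (if y \<in> nbrs (P i) x then ewt (P i) x y else 0) = 0"
          using nbP by (auto simp: I_def)
        show "ewt (P i) x y = (if y \<in> nbrs (P i) x then ewt (P i) x y else 0)"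
          if "i \<in> {i. i \<in> {0..l} \<and> x \<in> verts (P i) \<and> y \<in> verts (P i)}" for i
          using ewP(1)[of i x y] that by auto
      qed
    qed
    also have "\<dots> = (\<Sum>i\<in>I. \<Sum>y\<in>nbrs \<Gamma> x. if y \<in> nbrs (P i) x then ewt (P i) x y else 0)"
      by (rule sum.swap)
    also have "\<dots> = (\<Sum>i\<in>I. \<Sum>y\<in>nbrs (P i) x. ewt (P i) x y)"
    proof (rule sum.cong[OF refl])
      fix i assume "i \<in> I"
      then have "nbrs (P i) x \<subseteq> nbrs \<Gamma> x" using nb by (auto simp: I_def)
      then have "nbrs \<Gamma> x \<inter> nbrs (P i) x = nbrs (P i) x" by auto
      then show "(\<Sum>y\<in>nbrs \<Gamma> x. if y \<in> nbrs (P i) x then ewt (P i) x y else 0)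
        = (\<Sum>y\<in>nbrs (P i) x. ewt (P i) x y)"
        using sum.inter_restrict[OF fin, of "ewt (P i) x" "nbrs (P i) x"] by simp
    qed
    also have "\<dots> \<le> (\<Sum>i\<in>I. (1 - \<epsilon>) * vwt (P i) x)"
      using ll by (intro sum_mono) (auto simp: I_def locally_lazy_def)
    also have "\<dots> = (1 - \<epsilon>) * vwt \<Gamma> x" by (simp add: vw[OF x] I_def sum_distrib_left)
    finally show "(\<Sum>y\<in>nbrs \<Gamma> x. ewt \<Gamma> x y) \<le> (1 - \<epsilon>) * vwt \<Gamma> x" .
  qed
  then have "lazy_wgraph \<Gamma> \<epsilon>" using \<epsilon> conn vpos by (rule lazy_wgraphI)
  then interpret lazy_wgraph \<Gamma> \<epsilon> .
  have "paged_graph \<Gamma> \<epsilon> l P \<delta>"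
  proof unfold_locales
    show "\<exists>\<epsilon>'. lazy_wgraph (P i) \<epsilon>'" if "i \<in> {1..l}" for i
      using lazy_wgraphI[OF ll[of i] \<epsilon> pageW(2)[OF that] pageW(1)[OF that]] that by auto
    show "verts (P i) \<subseteq> verts \<Gamma>" if "i \<in> {0..l}" for i by (rule PG[OF that])
    show "\<exists>i\<in>{0..l}. v \<in> verts (P i)" if "v \<in> verts \<Gamma>" for v using V that by auto
    show "u \<in> verts (P 0)" if i: "i \<in> {1..l}" and u: "u \<in> verts (P i)"
      and w: "w \<notin> verts (P i)" "(u, w) \<in> adj \<Gamma>" for i u w
    proof -
      \<comment> \<open>The inner boundary consists of glued vertices, and each of these is
        identified with a vertex of the spine.\<close>
      have "u \<in> inner_boundary \<Gamma> (verts (P i))"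
        using u w adjD[OF w(2)] by (auto simp: inner_boundary_def adj_def)
      then obtain x where x: "x \<in> M i" "u = \<iota> i x" using bdry[OF i] by auto
      have q: "x \<in> verts (Q i)" "\<phi> i x \<in> verts (Q 0)" using MQ[OF i] x(1) bij_betwE by blast+
      have "((i, x), (0, \<phi> i x)) \<in> glue_rel l M \<phi>" using i x(1) by (auto simp: glue_rel_def)
      then have "\<iota> i x = \<iota> 0 (\<phi> i x)" using ident[of i 0 x "\<phi> i x"] i q by auto
      then show ?thesis using x(2) q(2) PV[of 0] by auto
    qed
    show "fixed_width \<Gamma> l P \<delta>" by (rule width)
  qed
  then show ?thesis by blast
qed

theorem theorem3:
  fixes \<Gamma> :: "'a wgraph" and l :: nat and P :: "nat \<Rightarrow> 'a wgraph"
    and \<delta> C \<alpha> :: real and F :: "'a \<Rightarrow> real \<Rightarrow> real"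
  assumes "pages_and_spine \<Gamma> l P"
    and "fixed_width \<Gamma> l P \<delta>"
    and "is_page_volume_function \<Gamma> l P \<delta> F"
    and "C > 0" and "\<alpha> > 0"
    and "relative_faber_krahn \<Gamma> (\<lambda>z r \<nu>. C / r\<^sup>2 * (F z r / \<nu>) powr \<alpha>)"
  shows "\<exists>c1>0. \<exists>c2>0. \<forall>x\<in>verts \<Gamma>. \<forall>y\<in>verts \<Gamma>. \<forall>n::nat. n > 0 \<longrightarrow>
    heat_kernel \<Gamma> n x y \<le>
      c1 / sqrt (F x (sqrt (real n)) * F y (sqrt (real n)))
        * exp (- (real (gdist \<Gamma> x y))\<^sup>2 / (c2 * real n))"
proof -
  obtain \<epsilon> where "paged_graph \<Gamma> \<epsilon> l P \<delta>"
    using assms(1,2) paged_graph_cutting paged_graph_gluing unfolding pages_and_spine_def by blast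
  then interpret paged_graph \<Gamma> \<epsilon> l P \<delta> .
  show ?thesis
    using assms(4,5) page_volume_function_pos[OF assms(3)] assms(6) by (rule gaussian_upper_bound)
qed

end
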